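(* Let $N \ge 2$ be an integer, let $1 < p < \infty$ if $N = 2$ and $1 < p < 2^*$ if $N \ge 3$, let $1 \le q < \infty$ with $pq > 2$, and let $1 < b < b_*$. Then, for $s \in [1,\infty]$, $E^{p,q}_b(\mathbb{R}^N)$ is continuously embedded in $L^s(\mathbb{R}^N)$ if and only if $N \ge 3$ and $s = 2^*$, and this embedding (of $E^{p,q}_b(\mathbb{R}^N)$ in $L^{2^*}(\mathbb{R}^N)$ for $N \ge 3$) is not compact.
   Context: $2^* = 2N/(N-2)$ for $N \ge 3$. $b_* = 1 + 2q$ if $N = 2$ and $b_* = 1 + Nq\,(1 - p/2^* )$ if $N \ge 3$. $B_\rho = \{x \in \mathbb{R}^N : |x| < \rho\}$. For a measurable function $u : \mathbb{R}^N \to \mathbb{R}$, $h_u(\rho) = \int_{B_\rho} |u|^p\, dy$ for $\rho > 0$, and $\|u\|_{L^{p,q}_b(\mathbb{R}^N)} = \left(\int_0^\infty \rho^{-b}\, h_u^q(\rho)\, d\rho\right)^{1/pq}$. $E^{p,q}_b(\mathbb{R}^N)$ is the space of all weakly differentiable functions $u : \mathbb{R}^N \to \mathbb{R}$ such that $\|\nabla u\|_{L^2(\mathbb{R}^N)} + \|u\|_{L^{p,q}_b(\mathbb{R}^N)} < \infty$, with norm $\|u\|_{E^{p,q}_b(\mathbb{R}^N)} = \left(\|\nabla u\|_{L^2(\mathbb{R}^N)}^{2pq} + \|u\|_{L^{p,q}_b(\mathbb{R}^N)}^{2pq}\right)^{1/2pq}$. Continuous embedding in $L^s(\mathbb{R}^N)$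 means that there is a constant $C > 0$ with $\|u\|_{L^s(\mathbb{R}^N)} \le C \|u\|_{E^{p,q}_b(\mathbb{R}^N)}$ for all $u \in E^{p,q}_b(\mathbb{R}^N)$. *)

theory Defs
  imports "HOL-Probability.Essential_Supremum"
begin

definition two_star :: "nat \<Rightarrow> real" where
  "two_star N = 2 * real N / (real N - 2)"

definition b_star :: "nat \<Rightarrow> real \<Rightarrow> real \<Rightarrow> real" where
  "b_star N p q = (if N = 2 then 1 + 2 * q else 1 + real N * q * (1 - p / two_star N))"

text \<open>Real powers of extended nonnegative numbers, used for positive exponents only;
  in particular \<open>\<infinity>\<close> is mapped to \<open>\<infinity>\<close>.\<close>

definition ennpow :: "ennreal \<Rightarrow> real \<Rightarrow> ennreal" where
  "ennpow x a = (if x = \<infinity> then \<infinity> else ennreal (enn2real x powr a))"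

primrec Ck :: "nat \<Rightarrow> ('a::euclidean_space \<Rightarrow> real) \<Rightarrow> bool" where
  "Ck 0 f \<longleftrightarrow> continuous_on UNIV f"
| "Ck (Suc k) f \<longleftrightarrow> (\<forall>x. f differentiable (at x)) \<and>
     (\<forall>i\<in>Basis. Ck k (\<lambda>x. frechet_derivative f (at x) i))"

text \<open>The elements of \<open>C\<^sub>c\<^sup>\<infinity>\<close>.\<close>

definition test_fun :: "('a::euclidean_space \<Rightarrow> real) \<Rightarrow> bool" where
  "test_fun \<phi> \<longleftrightarrow> (\<forall>k. Ck k \<phi>) \<and> compact (closure {x. \<phi> x \<noteq> 0})"

definition loc_integrable :: "('a::euclidean_space \<Rightarrow> 'b::euclidean_space) \<Rightarrow> bool" where
  "loc_integrable f \<longleftrightarrow> (\<forall>K. compact K \<longrightarrow> f absolutely_integrable_on K)"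

definition has_weak_gradient ::
    "('a::euclidean_space \<Rightarrow> real) \<Rightarrow> ('a \<Rightarrow> 'a) \<Rightarrow> bool" where
  "has_weak_gradient u g \<longleftrightarrow> loc_integrable u \<and> loc_integrable g \<and>
     (\<forall>\<phi>. test_fun \<phi> \<longrightarrow> (\<forall>i\<in>Basis.
        (LINT x|lebesgue. u x * frechet_derivative \<phi> (at x) i)
          = - (LINT x|lebesgue. (g x \<bullet> i) * \<phi> x)))"

definition weakly_differentiable :: "('a::euclidean_space \<Rightarrow> real) \<Rightarrow> bool" where
  "weakly_differentiable u \<longleftrightarrow> (\<exists>g. has_weak_gradient u g)"

text \<open>The weak gradient is determined up to a null set; one representative is chosen.\<close>

definition weak_gradient :: "('a::euclidean_space \<Rightarrow> real) \<Rightarrow> 'a \<Rightarrow> 'a" where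
  "weak_gradient u = (SOME g. has_weak_gradient u g)"

definition Lnorm ::
    "ennreal \<Rightarrow> ('a::euclidean_space \<Rightarrow> 'b::real_normed_vector) \<Rightarrow> ennreal" where
  "Lnorm s f =
     (if s = \<infinity> then esssup lebesgue (\<lambda>x. ennreal (norm (f x)))
      else ennpow (\<integral>\<^sup>+x. ennreal (norm (f x) powr enn2real s) \<partial>lebesgue) (1 / enn2real s))"

definition h_fun :: "real \<Rightarrow> ('a::euclidean_space \<Rightarrow> real) \<Rightarrow> real \<Rightarrow> ennreal" where
  "h_fun p u \<rho> = (\<integral>\<^sup>+y\<in>ball 0 \<rho>. ennreal (\<bar>u y\<bar> powr p) \<partial>lebesgue)"

definition Lpqb_norm :: "real \<Rightarrow> real \<Rightarrow> real \<Rightarrow> ('a::euclidean_space \<Rightarrow> real) \<Rightarrow> ennreal" where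
  "Lpqb_norm p q b u =
     ennpow (\<integral>\<^sup>+\<rho>\<in>{0<..}. ennreal (\<rho> powr (- b)) * ennpow (h_fun p u \<rho>) q \<partial>lborel)
       (1 / (p * q))"

definition E_norm :: "real \<Rightarrow> real \<Rightarrow> real \<Rightarrow> ('a::euclidean_space \<Rightarrow> real) \<Rightarrow> ennreal" where
  "E_norm p q b u =
     ennpow (ennpow (Lnorm 2 (weak_gradient u)) (2 * p * q)
             + ennpow (Lpqb_norm p q b u) (2 * p * q))
       (1 / (2 * p * q))"

definition E_space :: "real \<Rightarrow> real \<Rightarrow> real \<Rightarrow> ('a::euclidean_space \<Rightarrow> real) set" where
  "E_space p q b =
     {u. weakly_differentiable u \<and> Lnorm 2 (weak_gradient u) + Lpqb_norm p q b u < \<infinity>}"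

definition continuously_embedded ::
    "('a::euclidean_space \<Rightarrow> real) set \<Rightarrow> (('a \<Rightarrow> real) \<Rightarrow> ennreal) \<Rightarrow> ennreal \<Rightarrow> bool" where
  "continuously_embedded X nrm s \<longleftrightarrow>
     (\<exists>C::real. C > 0 \<and> (\<forall>u\<in>X. Lnorm s u \<le> ennreal C * nrm u))"

text \<open>Compactness of the inclusion map: every bounded sequence has a subsequence that converges
  in \<open>L\<^sup>s\<close>. Continuity is deliberately not part of this definition, so that its negation asserts
  the failure of compactness proper.\<close>

definition compactly_embedded ::
    "('a::euclidean_space \<Rightarrow> real) set \<Rightarrow> (('a \<Rightarrow> real) \<Rightarrow> ennreal) \<Rightarrow> ennreal \<Rightarrow> bool" where
  "compactly_embedded X nrm s \<longleftrightarrow>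
     (\<forall>u::nat \<Rightarrow> 'a \<Rightarrow> real. (\<forall>k. u k \<in> X) \<and> (\<exists>M::real. \<forall>k. nrm (u k) \<le> ennreal M) \<longrightarrow>
        (\<exists>r v. strict_mono (r::nat \<Rightarrow> nat) \<and>
           v \<in> borel_measurable lebesgue \<and> Lnorm s v < \<infinity> \<and>
           (\<lambda>k. Lnorm s (\<lambda>x. u (r k) x - v x)) \<longlonglongrightarrow> 0))"

end

theory Submission
  imports Defs "HOL-Computational_Algebra.Polynomial"
begin

text \<open>
  Write \<open>N\<close> for the dimension. Three facts make up the theorem.

  \<^item> \<^bold>\<open>Embedding for \<open>s = 2\<^sup>*\<close>.\<close> A finite \<open>L\<^bsup>p,q\<^esup>\<^bsub>b\<^esub>\<close> norm forces \<open>h\<^sub>u(\<rho>) = O(\<rho>\<^bsup>(b-1)/q\<^esup>)\<close>,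
    and \<open>(b - 1)/q < N\<close>, so truncations of \<open>u\<close> have averages over cubes of side \<open>R\<close> that tend to
    zero as \<open>R \<rightarrow> \<infinity>\<close>. This excludes an additive constant, and the Sobolev inequality
    \<open>\<parallel>u\<parallel> \<le> C \<parallel>\<nabla>u\<parallel>\<close> between \<open>L\<^bsup>2*\<^esup>\<close> and \<open>L\<^sup>2\<close> holds (\<open>sobolev\<close>).

  \<^item> \<^bold>\<open>No other exponent.\<close> Translating a fixed function to infinity makes its
    \<open>L\<^bsup>p,q\<^esup>\<^bsub>b\<^esub>\<close> norm arbitrarily small because \<open>b > 1\<close>, so a continuous embedding would be an
    inequality against the gradient alone (\<open>embedding_necessary\<close>). Dilating a cutoff function shows
    that this is possible only if \<open>N/s = (N - 2)/2\<close> (\<open>embedding_exponent\<close>). For \<open>N = 2\<close> that leaves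
    \<open>s = \<infinity>\<close>, which is excluded by a sum of \<open>n\<close> dyadic dilates of the cutoff: its height is \<open>n\<close>
    and its Dirichlet energy is only proportional to \<open>n\<close> (\<open>energy_tower\<close>).

  \<^item> \<^bold>\<open>No compactness.\<close> Translates of a cutoff with disjoint supports are bounded in the space
    and have pairwise distances bounded below in \<open>L\<^bsup>2*\<^esup>\<close>.

  The Sobolev inequality is proved without approximation by smooth functions. By the fundamental
  lemma of the calculus of variations, \<open>u(x + y) - u(x) = \<integral>\<^sub>0\<^sup>1 \<nabla>u(x + t y) \<bullet> y dt\<close> for almost
  every \<open>x\<close> (\<open>weak_gradient_segment\<close>). From then on only the increments of \<open>u\<close> are used: the
  quantity \<open>osc r u\<close> is the integral of \<open>\<parallel>u(\<cdot> + r h) - u\<parallel>\<^sup>2 / r\<^sup>2\<close> over vectors \<open>h\<close> in a cube, it does not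
  increase when \<open>r\<close> is doubled, and it is at most a constant times \<open>\<parallel>\<nabla>u\<parallel>\<^sup>2\<close>. It controls the
  \<open>L\<^sup>2\<close> distance of a function from its averages over cubes of side \<open>r\<close> (\<open>cube_average_error\<close>)
  and, by telescoping over dyadic scales, the averages themselves (\<open>cube_average_bound\<close>). A suitable
  choice of \<open>r\<close> gives a weak type estimate (\<open>weak_type\<close>). It is applied to the slices of \<open>\<bar>u\<bar>\<close>
  between consecutive dyadic levels. The increments of the slices are square summable against
  those of \<open>u\<close>, at every scale (\<open>suminf_osc_slice_le\<close>), hence the weak estimates for the slices add
  up to the strong one.
\<close>

section \<open>Smooth bump functions\<close>

text \<open>The functions \<open>t \<mapsto> P(1/t) exp(-c/t)\<close> for \<open>t > 0\<close>, extended by zero. They are closed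
  under differentiation, which makes them a convenient source of smooth functions.\<close>

definition flat :: "real \<Rightarrow> real poly \<Rightarrow> real \<Rightarrow> real" where
  "flat c P t = (if t > 0 then poly P (1 / t) * exp (- (c / t)) else 0)"

text \<open>The polynomial that represents the derivative of \<open>flat c P\<close>.\<close>

definition flat_deriv :: "real \<Rightarrow> real poly \<Rightarrow> real poly" where
  "flat_deriv c P = [:0, 0, 1:] * (smult c P - pderiv P)"

lemma poly_exp_tendsto_0:
  fixes c :: real assumes "c > 0"
  shows "((\<lambda>s. poly P s * exp (- (c * s))) \<longlongrightarrow> 0) at_top"
proof (induction P)
  case 0
  then show ?case by simp
next
  case (pCons a P)
  have mono: "((\<lambda>s. s ^ k * exp (- (c * s))) \<longlongrightarrow> 0) at_top" for k
  proof -
    have "((\<lambda>s. (1 / c ^ k) * ((c * s) ^ k / exp (c * s))) \<longlongrightarrow> (1 / c ^ k) * 0) at_top"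
      by (intro tendsto_intros filterlim_compose[OF tendsto_power_div_exp_0]
            filterlim_tendsto_pos_mult_at_top[OF tendsto_const assms filterlim_ident])
    then show ?thesis using assms by (simp add: power_mult_distrib exp_minus field_simps)
  qed
  have "((\<lambda>s. \<Sum>i\<le>degree (pCons a P). coeff (pCons a P) i * (s ^ i * exp (- (c * s)))) \<longlongrightarrow>
     (\<Sum>i\<le>degree (pCons a P). coeff (pCons a P) i * 0)) at_top"
    by (intro tendsto_intros mono)
  then show ?case by (simp only: poly_altdef sum_distrib_right mult.assoc) simp
qed

lemma flat_has_derivative:
  assumes "c > 0"
  shows "(flat c P has_real_derivative flat c (flat_deriv c P) t) (at t)"
proof -
  consider "t > 0" | "t < 0" | "t = 0" by linarith
  then show ?thesis
  proof cases
    case 1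
    have "((\<lambda>t. poly P (1 / t) * exp (- (c / t))) has_real_derivative flat c (flat_deriv c P) t) (at t)"
      using 1 unfolding flat_def flat_deriv_def
      by (auto intro!: derivative_eq_intros poly_DERIV simp: field_simps power2_eq_square)
    then show ?thesis
      by (rule has_field_derivative_transform_within_open[of _ _ _ "{0<..}"])
         (use 1 in \<open>auto simp: flat_def\<close>)
  next
    case 2
    have "((\<lambda>_. 0) has_real_derivative flat c (flat_deriv c P) t) (at t)"
      using 2 unfolding flat_def by simp
    then show ?thesis
      by (rule has_field_derivative_transform_within_open[of _ _ _ "{..<0}"])
         (use 2 in \<open>auto simp: flat_def\<close>)
  next
    case 3
    have "((\<lambda>h. flat c P h / h) \<longlongrightarrow> 0) (at_right 0)"
    proof -
      have "((\<lambda>h. poly (pCons 0 P) (inverse h) * exp (- (c * inverse h))) \<longlongrightarrow> 0) (at_right 0)"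
        by (rule filterlim_compose[OF poly_exp_tendsto_0[OF assms] filterlim_inverse_at_top_right])
      then show ?thesis
        by (rule Lim_transform_eventually)
           (auto simp: flat_def field_simps eventually_at_right_less intro!: eventually_at_rightI[of 0 1])
    qed
    moreover have "((\<lambda>h. flat c P h / h) \<longlongrightarrow> 0) (at_left 0)"
      by (rule Lim_transform_eventually[OF tendsto_const])
         (auto simp: flat_def intro!: eventually_at_leftI[of "-1"])
    ultimately have "((\<lambda>h. flat c P h / h) \<longlongrightarrow> 0) (at 0)"
      using filterlim_split_at by blast
    then show ?thesis using 3 by (simp add: has_field_derivative_iff flat_def)
  qed
qed

lemma Ck_continuous: "Ck k f \<Longrightarrow> continuous_on UNIV f"
  by (cases k) (auto intro!: continuous_at_imp_continuous_on differentiable_imp_continuous_within)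

lemma Ck_SucI:
  assumes "\<And>x. (f has_derivative f' x) (at x)"
    and "\<And>i. i \<in> Basis \<Longrightarrow> Ck k (\<lambda>x. f' x i)"
  shows "Ck (Suc k) f"
proof -
  have "frechet_derivative f (at x) = f' x" for x
    using frechet_derivative_at[OF assms(1)] by simp
  then show ?thesis using assms by (auto simp: differentiable_def)
qed

lemma Ck_const: "Ck k (\<lambda>_::'a::euclidean_space. c)"
proof (induction k arbitrary: c)
  case (Suc k)
  show ?case by (rule Ck_SucI[of _ "\<lambda>_ _. 0"]) (use Suc in \<open>auto intro: derivative_eq_intros\<close>)
qed simp

lemma Ck_add:
  fixes f g :: "'a::euclidean_space \<Rightarrow> real"
  shows "Ck k f \<Longrightarrow> Ck k g \<Longrightarrow> Ck k (\<lambda>x. f x + g x)"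
proof (induction k arbitrary: f g)
  case (Suc k)
  show ?case
  proof (rule Ck_SucI)
    fix x
    show "((\<lambda>x. f x + g x) has_derivative
        (\<lambda>i. frechet_derivative f (at x) i + frechet_derivative g (at x) i)) (at x)"
      using Suc.prems by (auto intro!: has_derivative_add simp: frechet_derivative_works)
  qed (use Suc in auto)
qed (auto intro: continuous_intros)

lemma Ck_pred: "Ck (Suc k) f \<Longrightarrow> Ck k f"
proof (induction k arbitrary: f)
  case 0
  then show ?case using Ck_continuous[of 1 f] by simp
next
  case (Suc k)
  then show ?case by (metis Ck.simps(2))
qed

lemma Ck_mult:
  fixes f g :: "'a::euclidean_space \<Rightarrow> real"
  shows "Ck k f \<Longrightarrow> Ck k g \<Longrightarrow> Ck k (\<lambda>x. f x * g x)"
proof (induction k arbitrary: f g)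
  case (Suc k)
  show ?case
  proof (rule Ck_SucI)
    fix x
    show "((\<lambda>x. f x * g x) has_derivative
        (\<lambda>i. f x * frechet_derivative g (at x) i + frechet_derivative f (at x) i * g x)) (at x)"
      using Suc.prems by (auto intro!: has_derivative_mult simp: frechet_derivative_works)
  next
    fix i :: 'a assume "i \<in> Basis"
    then show "Ck k (\<lambda>x. f x * frechet_derivative g (at x) i + frechet_derivative f (at x) i * g x)"
      using Suc.prems Ck_pred[OF Suc.prems(1)] Ck_pred[OF Suc.prems(2)]
      by (intro Ck_add Suc.IH) auto
  qed
qed (auto intro: continuous_intros)

lemma Ck_prod:
  fixes f :: "'b \<Rightarrow> 'a::euclidean_space \<Rightarrow> real"
  assumes "\<And>i. i \<in> I \<Longrightarrow> Ck k (f i)"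
  shows "Ck k (\<lambda>x. \<Prod>i\<in>I. f i x)"
  using assms by (induction I rule: infinite_finite_induct) (auto intro: Ck_mult Ck_const)

lemma Ck_shift:
  fixes f :: "'a::euclidean_space \<Rightarrow> real"
  shows "Ck k f \<Longrightarrow> Ck k (\<lambda>x. f (x - y))"
proof (induction k arbitrary: f)
  case 0
  have "continuous_on UNIV (\<lambda>x. x - y)" by (intro continuous_intros)
  with 0 show ?case by (auto intro: continuous_on_compose2)
next
  case (Suc k)
  have *: "((\<lambda>x. x - y) has_derivative (\<lambda>v. v)) (at x)" for x :: 'a
    by (auto intro: derivative_eq_intros)
  show ?case
  proof (rule Ck_SucI)
    fix x
    show "((\<lambda>x. f (x - y)) has_derivative frechet_derivative f (at (x - y))) (at x)"
      using Suc.prems by (intro has_derivative_compose[OF *])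
         (auto simp: frechet_derivative_works)
  qed (use Suc in auto)
qed

text \<open>Quantifying over the polynomial and the factor \<open>d\<close> makes the family closed under partial
  derivatives, which is what the induction needs.\<close>

lemma Ck_flat_linear:
  assumes "c > 0"
  shows "Ck k (\<lambda>x::'a::euclidean_space. d * flat c P (s * (x \<bullet> j) + t))"
proof (induction k arbitrary: P d)
  case 0
  have "continuous_on UNIV (flat c P)"
    using flat_has_derivative[OF assms]
    by (meson DERIV_isCont continuous_at_imp_continuous_on)
  then show ?case by (auto intro!: continuous_intros continuous_on_compose2[of UNIV "flat c P"])
next
  case (Suc k)
  show ?case
  proof (rule Ck_SucI)
    fix x :: 'a
    have "((\<lambda>x. s * (x \<bullet> j) + t) has_derivative (\<lambda>v. s * (v \<bullet> j))) (at x)"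
      by (auto intro!: derivative_eq_intros)
    from has_derivative_mult_right[OF has_derivative_compose[OF this
        flat_has_derivative[OF assms, unfolded has_field_derivative_def]]]
    show "((\<lambda>x. d * flat c P (s * (x \<bullet> j) + t)) has_derivative
       (\<lambda>v. d * (flat c (flat_deriv c P) (s * (x \<bullet> j) + t) * (s * (v \<bullet> j))))) (at x)" .
  next
    fix i :: 'a
    show "Ck k (\<lambda>x. d * (flat c (flat_deriv c P) (s * (x \<bullet> j) + t) * (s * (i \<bullet> j))))"
      using Suc.IH[of "d * (s * (i \<bullet> j))"] by (simp add: mult_ac)
  qed
qed

text \<open>A smooth function that is positive on the open box from \<open>a\<close> to \<open>b\<close>, vanishes outside, and
  increases to the indicator function of the open box as \<open>c\<close> decreases to zero.\<close>

definition box_bump :: "real \<Rightarrow> 'a::euclidean_space \<Rightarrow> 'a \<Rightarrow> 'a \<Rightarrow> real" where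
  "box_bump c a b x = (\<Prod>j\<in>Basis. flat c 1 (x \<bullet> j - a \<bullet> j) * flat c 1 (b \<bullet> j - x \<bullet> j))"

lemma box_bump_outside: "x \<notin> box a b \<Longrightarrow> box_bump c a b x = 0"
  by (auto simp: box_bump_def mem_box flat_def intro!: prod_zero)

lemma test_fun_box_bump:
  fixes a b :: "'a::euclidean_space"
  assumes "c > 0"
  shows "test_fun (box_bump c a b)"
  unfolding test_fun_def
proof (intro conjI allI)
  fix k
  have "Ck k (\<lambda>x::'a. flat c 1 (x \<bullet> j - a \<bullet> j))" for j
    using Ck_flat_linear[OF assms, of k 1 1 1 j "- (a \<bullet> j)"] by simp
  moreover have "Ck k (\<lambda>x::'a. flat c 1 (b \<bullet> j - x \<bullet> j))" for j
    using Ck_flat_linear[OF assms, of k 1 1 "-1" j "b \<bullet> j"] by simp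
  ultimately show "Ck k (box_bump c a b)"
    unfolding box_bump_def[abs_def] by (intro Ck_prod Ck_mult)
next
  have "{x. box_bump c a b x \<noteq> 0} \<subseteq> box a b"
    using box_bump_outside by blast
  then have "bounded {x. box_bump c a b x \<noteq> 0}"
    by (rule bounded_subset[OF bounded_box])
  then show "compact (closure {x. box_bump c a b x \<noteq> 0})"
    by simp
qed

lemma box_bump_bounds: "c > 0 \<Longrightarrow> \<bar>box_bump c a b x\<bar> \<le> 1"
proof -
  assume "c > 0"
  then have "0 \<le> flat c 1 t \<and> flat c 1 t \<le> 1" for t by (auto simp: flat_def)
  then have "0 \<le> box_bump c a b x \<and> box_bump c a b x \<le> 1"
    unfolding box_bump_def by (auto intro!: prod_nonneg prod_le_1 mult_le_one)
  then show ?thesis by simp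
qed

lemma box_bump_tendsto:
  "(\<lambda>n. box_bump (inverse (real (Suc n))) a b x) \<longlonglongrightarrow> indicator (box a b) x"
proof (cases "x \<in> box a b")
  case False
  then show ?thesis by (simp add: box_bump_outside)
next
  case True
  have *: "(\<lambda>n. flat (inverse (real (Suc n))) 1 t) \<longlonglongrightarrow> 1" if "t > 0" for t
  proof -
    have "(\<lambda>n. exp (- (inverse (real (Suc n)) / t))) \<longlonglongrightarrow> exp (- (0 / t))"
      using that by (intro tendsto_intros LIMSEQ_inverse_real_of_nat) auto
    then show ?thesis using that by (simp add: flat_def)
  qed
  have "(\<lambda>n. box_bump (inverse (real (Suc n))) a b x) \<longlonglongrightarrow> (\<Prod>j\<in>(Basis::'a set). 1 * 1)"
    unfolding box_bump_def using True by (intro tendsto_prod tendsto_mult *) (auto simp: mem_box)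
  then show ?thesis using True by simp
qed

section \<open>Locally integrable functions and the fundamental lemma\<close>

lemma loc_integrable_measurable:
  assumes "loc_integrable f"
  shows "f \<in> borel_measurable lebesgue"
proof -
  have "(\<lambda>x. indicator (cball 0 (real n)) x *\<^sub>R f x) \<in> borel_measurable lebesgue" for n
  proof -
    have "set_integrable lebesgue (cball 0 (real n)) f"
      using assms by (simp add: loc_integrable_def)
    then show ?thesis unfolding set_integrable_def by (rule borel_measurable_integrable)
  qed
  moreover have "(\<lambda>n. indicator (cball 0 (real n)) x *\<^sub>R f x) \<longlonglongrightarrow> f x" for x
  proof (rule tendsto_eventually)
    obtain m where "norm x \<le> real m" using real_arch_simple by blast
    then show "\<forall>\<^sub>F n in sequentially. indicator (cball 0 (real n)) x *\<^sub>R f x = f x"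
      by (auto simp: eventually_sequentially intro!: exI[of _ m])
  qed
  ultimately show ?thesis by (rule borel_measurable_LIMSEQ_metric)
qed

lemma loc_integrable_mult:
  fixes f :: "'a::euclidean_space \<Rightarrow> 'b::euclidean_space"
  assumes "loc_integrable f" "\<psi> \<in> borel_measurable borel"
    and "\<And>x. \<bar>\<psi> x\<bar> \<le> M" "\<And>x. norm x > R \<Longrightarrow> \<psi> x = 0"
  shows "integrable lebesgue (\<lambda>x. \<psi> x *\<^sub>R f x)"
proof -
  have "integrable lebesgue (\<lambda>x. indicator (cball 0 R) x *\<^sub>R f x)"
    using assms(1) by (auto simp: loc_integrable_def set_integrable_def)
  then have "integrable lebesgue (\<lambda>x. M *\<^sub>R (indicator (cball 0 R) x *\<^sub>R f x))"
    by (rule integrable_scaleR_right)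
  moreover have "\<psi> \<in> borel_measurable lebesgue"
    using assms(2) by (simp add: measurable_completion)
  then have "(\<lambda>x. \<psi> x *\<^sub>R f x) \<in> borel_measurable lebesgue"
    using loc_integrable_measurable[OF assms(1)] by measurable
  moreover have "norm (\<psi> x *\<^sub>R f x) \<le> norm (M *\<^sub>R (indicator (cball 0 R) x *\<^sub>R f x))" for x
  proof (cases "norm x > R")
    case False
    have "0 \<le> M" using assms(3)[of x] by linarith
    with False assms(3)[of x] show ?thesis by (auto intro!: mult_right_mono)
  qed (use assms(4) in auto)
  ultimately show ?thesis by (auto intro: Bochner_Integration.integrable_bound)
qed

lemma loc_integrable_cong_AE:
  fixes f g :: "'a::euclidean_space \<Rightarrow> 'b::euclidean_space"
  assumes "loc_integrable f" "g \<in> borel_measurable lebesgue" "AE x in lebesgue. f x = g x"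
  shows "loc_integrable g"
  unfolding loc_integrable_def set_integrable_def
proof (intro allI impI)
  fix K :: "'a set" assume K: "compact K"
  have [measurable]: "K \<in> sets lebesgue" using K by (simp add: lmeasurable_compact fmeasurableD)
  have "integrable lebesgue (\<lambda>x. indicator K x *\<^sub>R f x)"
    using assms(1) K by (simp add: loc_integrable_def set_integrable_def)
  then show "integrable lebesgue (\<lambda>x. indicator K x *\<^sub>R g x)"
  proof (rule integrable_cong_AE_imp)
    show "(\<lambda>x. indicator K x *\<^sub>R g x) \<in> borel_measurable lebesgue"
      using assms(2) by measurable
    show "AE x in lebesgue. indicator K x *\<^sub>R f x = indicator K x *\<^sub>R g x"
      using assms(3) by auto
  qed
qed

lemma test_fun_support:
  assumes "test_fun \<phi>"
  obtains R where "\<And>x. norm x \<ge> R \<Longrightarrow> \<phi> x = 0 \<and> (\<forall>i. frechet_derivative \<phi> (at x) i = 0)"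
proof -
  let ?K = "closure {x. \<phi> x \<noteq> 0}"
  have "bounded ?K" using assms by (simp add: test_fun_def compact_imp_bounded)
  then obtain R where R: "\<And>x. x \<in> ?K \<Longrightarrow> norm x < R"
    using bounded_pos_less by metis
  show ?thesis
  proof (rule that)
    fix x :: 'a assume x: "norm x \<ge> R"
    then have "x \<notin> ?K" using R by force
    then have "\<phi> x = 0" using closure_subset[of "{x. \<phi> x \<noteq> 0}"] by blast
    moreover have "(\<phi> has_derivative (\<lambda>_. 0)) (at x)"
    proof (rule has_derivative_transform_within_open[of "\<lambda>_. 0" _ _ _ "- ?K"])
      show "x \<in> - ?K" using \<open>x \<notin> ?K\<close> by simp
      show "0 = \<phi> y" if "y \<in> - ?K" for y
        using that closure_subset[of "{x. \<phi> x \<noteq> 0}"] by auto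
    qed (auto simp: open_Compl)
    then have "frechet_derivative \<phi> (at x) = (\<lambda>_. 0)" by (metis frechet_derivative_at)
    ultimately show "\<phi> x = 0 \<and> (\<forall>i. frechet_derivative \<phi> (at x) i = 0)" by simp
  qed
qed

text \<open>The fundamental lemma of the calculus of variations. Testing against bumps that converge to
  the indicator function of a box shows that \<open>w\<close> has integral zero over every box; Lebesgue
  differentiation along cubes then gives the claim.\<close>

lemma fundamental_lemma:
  fixes w :: "'a::euclidean_space \<Rightarrow> real"
  assumes w: "loc_integrable w"
    and orth: "\<And>\<phi>. test_fun \<phi> \<Longrightarrow> (LINT x|lebesgue. w x * \<phi> x) = 0"
  shows "AE x in lebesgue. w x = 0"
proof -
  have meas: "w \<in> borel_measurable lebesgue" by (rule loc_integrable_measurable[OF w])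
  have int: "w absolutely_integrable_on cbox a b" for a b
    using w by (simp add: loc_integrable_def)
  have zero: "integral (cbox a b) w = 0" for a b
  proof -
    let ?f = "\<lambda>n x. box_bump (inverse (real (Suc n))) a b x"
    have m: "?f n \<in> borel_measurable lebesgue" for n
    proof -
      have "continuous_on UNIV (?f n)"
        using test_fun_box_bump[of "inverse (real (Suc n))" a b]
        by (auto simp: test_fun_def intro: Ck_continuous[of 0])
      then have "?f n \<in> borel_measurable lborel"
        using borel_measurable_continuous_onI by simp
      then show ?thesis by (rule measurable_completion)
    qed
    have "(\<lambda>n. LINT x|lebesgue. w x * ?f n x) \<longlonglongrightarrow> (LINT x|lebesgue. w x * indicator (box a b) x)"
    proof (rule integral_dominated_convergence)
      show "integrable lebesgue (\<lambda>x. \<bar>indicator (cbox a b) x *\<^sub>R w x\<bar>)"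
        using int[of a b] by (intro integrable_abs) (simp add: set_integrable_def)
      show "AE x in lebesgue. (\<lambda>n. w x * ?f n x) \<longlonglongrightarrow> w x * indicator (box a b) x"
        by (intro AE_I2 tendsto_mult tendsto_const box_bump_tendsto)
      show "AE x in lebesgue. norm (w x * ?f n x) \<le> \<bar>indicator (cbox a b) x *\<^sub>R w x\<bar>" for n
      proof (rule AE_I2)
        fix x
        show "norm (w x * ?f n x) \<le> \<bar>indicator (cbox a b) x *\<^sub>R w x\<bar>"
        proof (cases "x \<in> box a b")
          case True
          then have "x \<in> cbox a b" using box_subset_cbox by blast
          have "\<bar>?f n x\<bar> \<le> 1" by (rule box_bump_bounds) simp
          from mult_left_mono[OF this, of "\<bar>w x\<bar>"] show ?thesis
            using \<open>x \<in> cbox a b\<close> by (simp add: abs_mult)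
        qed (simp add: box_bump_outside)
      qed
      have "box a b \<in> sets lebesgue" by simp
      with meas show "(\<lambda>x. w x * indicator (box a b) x) \<in> borel_measurable lebesgue"
        by (intro borel_measurable_times borel_measurable_indicator)
      show "(\<lambda>x. w x * ?f n x) \<in> borel_measurable lebesgue" for n
        using meas m by (rule borel_measurable_times)
    qed
    moreover have "(LINT x|lebesgue. w x * ?f n x) = 0" for n
      by (rule orth[OF test_fun_box_bump]) simp
    ultimately have "(LINT x|lebesgue. w x * indicator (box a b) x) = 0"
      by (simp add: LIMSEQ_const_iff)
    moreover have "w absolutely_integrable_on box a b"
      using int[of a b] by (rule set_integrable_subset) (auto simp: box_subset_cbox)
    ultimately have "integral (box a b) w = 0"
      by (simp add: set_lebesgue_integral_eq_integral(2)[symmetric] set_lebesgue_integral_def mult.commute)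
    then show ?thesis by (simp add: integral_open_interval)
  qed
  obtain N where N: "negligible N" "\<And>x e. \<lbrakk>x \<notin> N; 0 < e\<rbrakk> \<Longrightarrow> \<exists>d>0. \<forall>h. 0 < h \<and> h < d \<longrightarrow>
       norm (integral (cbox x (x + h *\<^sub>R One)) w /\<^sub>R h ^ DIM('a) - w x) < e"
  proof (rule integrable_ccontinuous_explicit)
    show "w integrable_on cbox a b" for a b
      using int by (rule set_lebesgue_integral_eq_integral(1))
  qed (rule that)
  have "w x = 0" if "x \<notin> N" for x
  proof (rule ccontr)
    assume "w x \<noteq> 0"
    then have "\<exists>d>0. \<forall>h. 0 < h \<and> h < d \<longrightarrow>
         norm (integral (cbox x (x + h *\<^sub>R One)) w /\<^sub>R h ^ DIM('a) - w x) < \<bar>w x\<bar>"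
      by (intro N(2)[OF that]) simp
    then obtain d where
      "d > 0" and d: "\<forall>h. 0 < h \<and> h < d \<longrightarrow>
         norm (integral (cbox x (x + h *\<^sub>R One)) w /\<^sub>R h ^ DIM('a) - w x) < \<bar>w x\<bar>"
      by (elim exE conjE)
    from d[rule_format, of "d / 2"] \<open>d > 0\<close> show False by (simp add: zero)
  qed
  then show ?thesis
    using N(1) by (intro AE_I'[of N]) (auto simp: negligible_iff_null_sets)
qed

lemma weak_gradient_unique:
  fixes u :: "'a::euclidean_space \<Rightarrow> real"
  assumes "has_weak_gradient u g" "has_weak_gradient u g'"
  shows "AE x in lebesgue. g x = g' x"
proof -
  have g: "loc_integrable g" "loc_integrable g'"
    using assms by (auto simp: has_weak_gradient_def)
  have "AE x in lebesgue. g x \<bullet> i - g' x \<bullet> i = 0" if i: "i \<in> Basis" for i :: 'a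
  proof (rule fundamental_lemma)
    show "loc_integrable (\<lambda>x. g x \<bullet> i - g' x \<bullet> i)"
      unfolding loc_integrable_def
    proof (intro allI impI)
      fix K :: "'a set" assume "compact K"
      then have "g absolutely_integrable_on K" "g' absolutely_integrable_on K"
        using g by (auto simp: loc_integrable_def)
      then show "(\<lambda>x. g x \<bullet> i - g' x \<bullet> i) absolutely_integrable_on K"
        by (intro set_integral_diff absolutely_integrable_component)
    qed
    fix \<phi> :: "'a \<Rightarrow> real" assume t: "test_fun \<phi>"
    have c: "continuous_on UNIV \<phi>" using t by (auto simp: test_fun_def intro: Ck_continuous[of 0])
    obtain R where R: "\<And>x. norm x \<ge> R \<Longrightarrow> \<phi> x = 0" using test_fun_support[OF t] by metis
    have "bounded (\<phi> ` cball 0 R)"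
      by (intro compact_imp_bounded compact_continuous_image continuous_on_subset[OF c]) auto
    then obtain M where M: "\<forall>x\<in>cball 0 R. \<bar>\<phi> x\<bar> \<le> M" "M > 0"
      by (auto simp: bounded_pos)
    have M: "\<bar>\<phi> x\<bar> \<le> M" for x using M R[of x] by (cases "norm x \<le> R") auto
    have "integrable lebesgue (\<lambda>x. (\<phi> x *\<^sub>R h x) \<bullet> i)" if "loc_integrable h" for h
      using loc_integrable_mult[OF that borel_measurable_continuous_onI[OF c] M, of R] R
      by (intro integrable_inner_left) auto
    from this[OF g(1)] this[OF g(2)]
    have "(LINT x|lebesgue. (g x \<bullet> i - g' x \<bullet> i) * \<phi> x) =
      (LINT x|lebesgue. (g x \<bullet> i) * \<phi> x) - (LINT x|lebesgue. (g' x \<bullet> i) * \<phi> x)"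
      by (simp add: right_diff_distrib mult.commute[of _ "\<phi> _"])
    also have "\<dots> = 0"
    proof -
      have "(LINT x|lebesgue. u x * frechet_derivative \<phi> (at x) i) = - (LINT x|lebesgue. (h x \<bullet> i) * \<phi> x)"
        if "has_weak_gradient u h" for h
        using that t i unfolding has_weak_gradient_def by blast
      from this[OF assms(1)] this[OF assms(2)] show ?thesis by linarith
    qed
    finally show "(LINT x|lebesgue. (g x \<bullet> i - g' x \<bullet> i) * \<phi> x) = 0" .
  qed
  then have "AE x in lebesgue. \<forall>i\<in>Basis. g x \<bullet> i - g' x \<bullet> i = 0"
    by (simp add: AE_finite_all)
  then show ?thesis by eventually_elim (auto intro: euclidean_eqI)
qed

section \<open>Translations and integration over segments\<close>

lemma nn_integral_lborel_shift:
  fixes f :: "'a::euclidean_space \<Rightarrow> ennreal"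
  assumes [measurable]: "f \<in> borel_measurable borel"
  shows "(\<integral>\<^sup>+x. f (x + y) \<partial>lborel) = (\<integral>\<^sup>+x. f x \<partial>lborel)"
proof -
  have "(\<integral>\<^sup>+x. f x \<partial>lborel) = (\<integral>\<^sup>+x. f x \<partial>distr lborel borel ((+) y))"
    by (simp add: lborel_distr_plus)
  also have "\<dots> = (\<integral>\<^sup>+x. f (x + y) \<partial>lborel)"
    by (subst nn_integral_distr) (auto simp: add.commute)
  finally show ?thesis by simp
qed

lemma integral_lborel_shift:
  fixes f :: "'a::euclidean_space \<Rightarrow> 'b::{banach, second_countable_topology}"
  assumes [measurable]: "f \<in> borel_measurable borel"
  shows "(LINT x|lborel. f (x + y)) = (LINT x|lborel. f x)"
proof -
  have "(LINT x|lborel. f x) = (LINT x|distr lborel borel ((+) y). f x)"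
    by (simp add: lborel_distr_plus)
  also have "\<dots> = (LINT x|lborel. f (x + y))"
    by (subst integral_distr) (auto simp: add.commute)
  finally show ?thesis by simp
qed

lemma integrable_lborel_shift:
  fixes f :: "'a::euclidean_space \<Rightarrow> 'b::{banach, second_countable_topology}"
  assumes "integrable lborel f"
  shows "integrable lborel (\<lambda>x. f (x + y))"
proof -
  have "integrable (distr lborel borel ((+) y)) f"
    using assms by (simp add: lborel_distr_plus)
  then have "integrable lborel (\<lambda>x. f (y + x))"
    by (subst (asm) integrable_distr_eq) (use borel_measurable_integrable[OF assms] in auto)
  then show ?thesis by (simp add: add.commute)
qed

lemma integrable_segment_pairI:
  fixes f :: "real \<times> 'a::euclidean_space \<Rightarrow> real"
  assumes [measurable]: "f \<in> borel_measurable (lborel \<Otimes>\<^sub>M lborel)"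
    and out: "\<And>t x. t \<notin> {0..1} \<Longrightarrow> f (t, x) = 0"
    and bnd: "\<And>t. t \<in> {0..1} \<Longrightarrow> (\<integral>\<^sup>+x. ennreal \<bar>f (t, x)\<bar> \<partial>lborel) \<le> ennreal C"
  shows "integrable (lborel \<Otimes>\<^sub>M lborel) f"
proof (rule integrableI_bounded)
  have "(\<integral>\<^sup>+z. ennreal (norm (f z)) \<partial>(lborel \<Otimes>\<^sub>M lborel)) = (\<integral>\<^sup>+t. \<integral>\<^sup>+x. ennreal \<bar>f (t, x)\<bar> \<partial>lborel \<partial>lborel)"
    by (subst lborel.nn_integral_fst[symmetric]) auto
  also have "\<dots> \<le> (\<integral>\<^sup>+t. ennreal C * indicator {0..1::real} t \<partial>lborel)"
    by (intro nn_integral_mono) (use bnd out in \<open>auto split: split_indicator\<close>)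
  also have "\<dots> < \<infinity>" by (simp add: nn_integral_cmult_indicator)
  finally show "(\<integral>\<^sup>+z. ennreal (norm (f z)) \<partial>(lborel \<Otimes>\<^sub>M lborel)) < \<infinity>" .
qed fact

section \<open>Continuously differentiable functions of compact support\<close>

text \<open>\<open>v\<close> is continuously differentiable with gradient \<open>G\<close>, and both vanish at distance at
  least \<open>R\<close> from the origin.\<close>

definition C1_supp :: "('a::euclidean_space \<Rightarrow> real) \<Rightarrow> ('a \<Rightarrow> 'a) \<Rightarrow> real \<Rightarrow> bool" where
  "C1_supp v G R \<longleftrightarrow> (\<forall>x. (v has_derivative (\<lambda>h. G x \<bullet> h)) (at x)) \<and> continuous_on UNIV G \<and>
     (\<forall>x. norm x \<ge> R \<longrightarrow> v x = 0 \<and> G x = 0)"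

lemma C1_suppD:
  assumes "C1_supp v G R"
  shows "(v has_derivative (\<lambda>h. G x \<bullet> h)) (at x)" "continuous_on UNIV G" "continuous_on UNIV v"
    "norm x \<ge> R \<Longrightarrow> v x = 0" "norm x \<ge> R \<Longrightarrow> G x = 0"
    "v \<in> borel_measurable borel" "G \<in> borel_measurable borel"
proof -
  show "continuous_on UNIV v"
    using assms by (auto simp: C1_supp_def intro!: continuous_at_imp_continuous_on has_derivative_continuous)
  then show "v \<in> borel_measurable borel" by (rule borel_measurable_continuous_onI)
  show "G \<in> borel_measurable borel"
    using assms by (auto simp: C1_supp_def intro!: borel_measurable_continuous_onI)
qed (use assms in \<open>auto simp: C1_supp_def\<close>)

lemma continuous_compact_support_bounded:
  fixes f :: "'a::euclidean_space \<Rightarrow> 'b::real_normed_vector"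
  assumes c: "continuous_on UNIV f" and R: "\<And>x. norm x \<ge> R \<Longrightarrow> f x = 0"
  obtains M where "M > 0" "\<And>x. norm (f x) \<le> M"
proof -
  have "bounded (f ` cball 0 R)"
    by (intro compact_imp_bounded compact_continuous_image continuous_on_subset[OF c]) auto
  then obtain M where M: "\<forall>x\<in>cball 0 R. norm (f x) \<le> M" "M > 0"
    by (auto simp: bounded_pos)
  have "norm (f x) \<le> M" for x using M R[of x] by (cases "norm x \<le> R") auto
  with M(2) show ?thesis by (rule that)
qed

lemma continuous_compact_support_integrable:
  fixes f :: "'a::euclidean_space \<Rightarrow> 'b::{banach, second_countable_topology}"
  assumes c: "continuous_on UNIV f" and R: "\<And>x. norm x \<ge> R \<Longrightarrow> f x = 0"
  shows "integrable lborel f"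
proof -
  have "integrable lborel (\<lambda>x. indicator (cball 0 R) x *\<^sub>R f x)"
    by (rule borel_integrable_compact) (auto intro: continuous_on_subset[OF c])
  moreover have "(\<lambda>x. indicator (cball 0 R) x *\<^sub>R f x) = f"
    using R by (auto simp: indicator_def not_le intro!: ext less_imp_le)
  ultimately show ?thesis by simp
qed

lemma C1_supp_segment:
  assumes "C1_supp v G R"
  shows "v (x + y) - v x = (LINT t|lborel. indicator {0..1} t * (G (x + t *\<^sub>R y) \<bullet> y))"
proof -
  note D = C1_suppD[OF assms]
  have "((\<lambda>t. v (x + t *\<^sub>R y)) has_vector_derivative G (x + t *\<^sub>R y) \<bullet> y) (at t within {0..1})" for t
  proof -
    have "((\<lambda>t. x + t *\<^sub>R y) has_derivative (\<lambda>h. h *\<^sub>R y)) (at t within {0..1})"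
      by (auto intro!: derivative_eq_intros)
    from has_derivative_compose[OF this D(1)] show ?thesis
      by (simp add: has_vector_derivative_def)
  qed
  then have "((\<lambda>t. G (x + t *\<^sub>R y) \<bullet> y) has_integral v (x + 1 *\<^sub>R y) - v (x + 0 *\<^sub>R y)) {0..1}"
    by (intro fundamental_theorem_of_calculus) auto
  moreover have "continuous_on {0..1} (\<lambda>t. G (x + t *\<^sub>R y) \<bullet> y)"
    by (intro continuous_intros continuous_on_compose2[OF D(2)]) auto
  then have "(\<lambda>t. G (x + t *\<^sub>R y) \<bullet> y) absolutely_integrable_on {0..1}"
    by (rule absolutely_integrable_continuous_real)
  then have "(LINT t:{0..1}|lebesgue. G (x + t *\<^sub>R y) \<bullet> y) = integral {0..1} (\<lambda>t. G (x + t *\<^sub>R y) \<bullet> y)"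
    by (rule set_lebesgue_integral_eq_integral)
  moreover have "(LINT t:{0..1}|lebesgue. G (x + t *\<^sub>R y) \<bullet> y) =
     (LINT t|lborel. indicator {0..1} t * (G (x + t *\<^sub>R y) \<bullet> y))"
  proof -
    have "(\<lambda>t. G (x + t *\<^sub>R y) \<bullet> y) \<in> borel_measurable borel"
      by (intro borel_measurable_continuous_onI continuous_intros continuous_on_compose2[OF D(2)]) auto
    then have "(\<lambda>t. indicator {0..1} t * (G (x + t *\<^sub>R y) \<bullet> y)) \<in> borel_measurable lborel"
      by auto
    then show ?thesis
      unfolding set_lebesgue_integral_def by (simp add: integral_completion)
  qed
  ultimately show ?thesis by (simp add: integral_unique)
qed

text \<open>Integrate \<open>v (x + y) - v x\<close>, written as an integral over a segment, with respect to \<open>x\<close>: by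
  translation invariance the result is both zero and the integral of \<open>G x \<bullet> y\<close>.\<close>

lemma C1_supp_integral_gradient:
  assumes "C1_supp v G R"
  shows "(LINT x|lborel. G x \<bullet> y) = 0"
proof -
  note D = C1_suppD[OF assms]
  note [measurable] = D(6,7)
  have iv: "integrable lborel v"
    using D(3,4) by (rule continuous_compact_support_integrable)
  have cG: "continuous_on UNIV (\<lambda>x. G x \<bullet> y)" using D(2) by (intro continuous_intros)
  have iG: "integrable lborel (\<lambda>x. G x \<bullet> y)"
    using cG D(5) by (intro continuous_compact_support_integrable[of _ R]) auto
  let ?f = "\<lambda>(t, x). indicator {0..1} t * (G (x + t *\<^sub>R y) \<bullet> y)"
  have int: "integrable (lborel \<Otimes>\<^sub>M lborel) ?f"
  proof (rule integrable_segment_pairI)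
    fix t :: real assume "t \<in> {0..1}"
    have "(\<integral>\<^sup>+x. ennreal \<bar>?f (t, x)\<bar> \<partial>lborel) \<le> (\<integral>\<^sup>+x. ennreal \<bar>G (x + t *\<^sub>R y) \<bullet> y\<bar> \<partial>lborel)"
      by (intro nn_integral_mono) (auto simp: indicator_def)
    also have "\<dots> = (\<integral>\<^sup>+x. ennreal \<bar>G x \<bullet> y\<bar> \<partial>lborel)"
      by (rule nn_integral_lborel_shift) measurable
    also have "\<dots> = ennreal (LINT x|lborel. \<bar>G x \<bullet> y\<bar>)"
      using iG by (intro nn_integral_eq_integral) auto
    finally show "(\<integral>\<^sup>+x. ennreal \<bar>?f (t, x)\<bar> \<partial>lborel) \<le> ennreal (LINT x|lborel. \<bar>G x \<bullet> y\<bar>)" .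
  qed auto
  have "0 = (LINT x|lborel. v (x + y) - v x)"
    using integrable_lborel_shift[OF iv] iv by (simp add: integral_lborel_shift)
  also have "\<dots> = (LINT x|lborel. LINT t|lborel. ?f (t, x))"
    by (simp add: C1_supp_segment[OF assms])
  also have "\<dots> = (LINT t|lborel. LINT x|lborel. ?f (t, x))"
    using int by (intro lborel_pair.Fubini_integral) (simp add: case_prod_unfold)
  also have "\<dots> = (LINT t::real|lborel. indicator {0..1} t * (LINT x|lborel. G x \<bullet> y))"
    by (simp add: integral_lborel_shift[of "\<lambda>x. G x \<bullet> y"])
  also have "\<dots> = (LINT x|lborel. G x \<bullet> y)"
    by (simp add: content_real)
  finally show ?thesis by simp
qed

lemma C1_supp_mult:
  assumes "C1_supp v G R" "C1_supp w H S"
  shows "C1_supp (\<lambda>x. v x * w x) (\<lambda>x. v x *\<^sub>R H x + w x *\<^sub>R G x) R"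
  unfolding C1_supp_def
proof (intro conjI allI impI)
  note D = C1_suppD[OF assms(1)] and E = C1_suppD[OF assms(2)]
  show "continuous_on UNIV (\<lambda>x. v x *\<^sub>R H x + w x *\<^sub>R G x)"
    using D E by (intro continuous_intros)
  show "((\<lambda>x. v x * w x) has_derivative (\<lambda>h. (v x *\<^sub>R H x + w x *\<^sub>R G x) \<bullet> h)) (at x)" for x
    using has_derivative_mult[OF D(1)[of x] E(1)[of x]]
    by (simp add: inner_add_left mult.commute[of _ "w _"])
qed (use C1_suppD(4,5)[OF assms(1)] in auto)

lemma test_fun_C1_supp:
  assumes "test_fun \<phi>"
  obtains G R where "C1_supp \<phi> G R" "\<And>x y. frechet_derivative \<phi> (at x) y = G x \<bullet> y"
proof -
  obtain R where R: "\<And>x. norm x \<ge> R \<Longrightarrow> \<phi> x = 0 \<and> (\<forall>i. frechet_derivative \<phi> (at x) i = 0)"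
    using test_fun_support[OF assms] by metis
  define G where "G x = (\<Sum>i\<in>Basis. frechet_derivative \<phi> (at x) i *\<^sub>R i)" for x
  have C2: "Ck (Suc 0) \<phi>" using assms unfolding test_fun_def by blast
  then have d: "(\<phi> has_derivative frechet_derivative \<phi> (at x)) (at x)" for x
    by (auto simp: frechet_derivative_works)
  have G: "frechet_derivative \<phi> (at x) y = G x \<bullet> y" for x y
  proof -
    interpret linear "frechet_derivative \<phi> (at x)" using d by (rule has_derivative_linear)
    have "frechet_derivative \<phi> (at x) y = frechet_derivative \<phi> (at x) (\<Sum>i\<in>Basis. (y \<bullet> i) *\<^sub>R i)"
      by (simp add: euclidean_representation)
    also have "\<dots> = (\<Sum>i\<in>Basis. (y \<bullet> i) * frechet_derivative \<phi> (at x) i)"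
      by (simp add: sum scale)
    also have "\<dots> = G x \<bullet> y"
      by (simp add: G_def inner_sum_right inner_commute[of _ y] mult.commute)
    finally show ?thesis .
  qed
  have "C1_supp \<phi> G R"
    unfolding C1_supp_def
  proof (intro conjI allI impI)
    show "(\<phi> has_derivative (\<lambda>h. G x \<bullet> h)) (at x)" for x using d[of x] G[of x] by (metis (no_types, lifting) ext)
    show "continuous_on UNIV G" unfolding G_def using C2 by (auto intro!: continuous_intros)
  qed (use R in \<open>auto simp: G_def\<close>)
  then show ?thesis using G by (rule that)
qed

lemma continuous_loc_integrable:
  fixes f :: "'a::euclidean_space \<Rightarrow> 'b::euclidean_space"
  assumes "continuous_on UNIV f" shows "loc_integrable f"
  unfolding loc_integrable_def set_integrable_def
proof (intro allI impI)
  fix K :: "'a set" assume K: "compact K"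
  then have "integrable lborel (\<lambda>x. indicator K x *\<^sub>R f x)"
    by (rule borel_integrable_compact) (rule continuous_on_subset[OF assms], simp)
  then show "integrable lebesgue (\<lambda>x. indicator K x *\<^sub>R f x)"
    using borel_measurable_integrable integrable_completion by blast
qed

lemma C1_supp_has_weak_gradient:
  assumes "C1_supp v G R"
  shows "has_weak_gradient v G"
  unfolding has_weak_gradient_def
proof (intro conjI allI impI ballI)
  note D = C1_suppD[OF assms]
  show "loc_integrable v" "loc_integrable G" using D by (auto intro: continuous_loc_integrable)
  fix \<phi> :: "'a \<Rightarrow> real" and i :: 'a
  assume "test_fun \<phi>" "i \<in> Basis"
  then obtain H S where H: "C1_supp \<phi> H S" "\<And>x. frechet_derivative \<phi> (at x) i = H x \<bullet> i"
    using test_fun_C1_supp by metis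
  note E = C1_suppD[OF H(1)]
  note [measurable] = D(6,7) E(6,7)
  have 1: "integrable lborel (\<lambda>x. v x * (H x \<bullet> i))"
    by (rule continuous_compact_support_integrable[where R=R])
       (use D E in \<open>auto intro!: continuous_intros\<close>)
  have 2: "integrable lborel (\<lambda>x. (G x \<bullet> i) * \<phi> x)"
    by (rule continuous_compact_support_integrable[where R=R])
       (use D E in \<open>auto intro!: continuous_intros\<close>)
  have "(LINT x|lborel. v x * (H x \<bullet> i)) + (LINT x|lborel. (G x \<bullet> i) * \<phi> x)
      = (LINT x|lborel. (v x *\<^sub>R H x + \<phi> x *\<^sub>R G x) \<bullet> i)"
    using 1 2 by (simp add: inner_add_left mult.commute[of "\<phi> _"])
  also have "\<dots> = 0" by (rule C1_supp_integral_gradient[OF C1_supp_mult[OF assms H(1)]])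
  finally show "(LINT x|lebesgue. v x * frechet_derivative \<phi> (at x) i) = - (LINT x|lebesgue. (G x \<bullet> i) * \<phi> x)"
    using 1 2 by (simp add: H(2) integral_completion borel_measurable_integrable)
qed

lemma C1_supp_weak_gradient:
  assumes "C1_supp v G R"
  shows "weakly_differentiable v" "AE x in lebesgue. weak_gradient v x = G x"
proof -
  have *: "has_weak_gradient v G" by (rule C1_supp_has_weak_gradient[OF assms])
  then show "weakly_differentiable v" by (auto simp: weakly_differentiable_def)
  have "has_weak_gradient v (weak_gradient v)"
    unfolding weak_gradient_def using * someI by metis
  then show "AE x in lebesgue. weak_gradient v x = G x" using * by (rule weak_gradient_unique)
qed

section \<open>Increments of weakly differentiable functions\<close>

lemma ex_borel_representative:
  fixes g :: "'a::euclidean_space \<Rightarrow> 'b::euclidean_space"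
  assumes [measurable]: "g \<in> borel_measurable lebesgue"
  obtains g' where "g' \<in> borel_measurable borel" "AE x in lebesgue. g x = g' x"
proof -
  have "\<exists>h. h \<in> borel_measurable borel \<and> (AE x in lborel. g x \<bullet> i = h x)" for i
    using completion_ex_borel_measurable_real[of "\<lambda>x. g x \<bullet> i" lborel] by auto
  then obtain h where h: "\<And>i. h i \<in> borel_measurable borel" "\<And>i. AE x in lborel. g x \<bullet> i = h i x"
    by metis
  show ?thesis
  proof (rule that)
    show "(\<lambda>x. \<Sum>i\<in>Basis. h i x *\<^sub>R i) \<in> borel_measurable borel" using h(1) by measurable
    have "AE x in lborel. \<forall>i\<in>Basis. g x \<bullet> i = h i x"
      using h(2) by (simp add: AE_finite_all)
    then have "AE x in lborel. g x = (\<Sum>i\<in>Basis. h i x *\<^sub>R i)"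
    proof eventually_elim
      case (elim x)
      then have "(\<Sum>i\<in>Basis. h i x *\<^sub>R i) = (\<Sum>i\<in>Basis. (g x \<bullet> i) *\<^sub>R i)" by simp
      then show ?case by (simp add: euclidean_representation)
    qed
    then show "AE x in lebesgue. g x = (\<Sum>i\<in>Basis. h i x *\<^sub>R i)" by (rule AE_completion)
  qed
qed

lemma has_weak_gradient_cong_AE:
  fixes u :: "'a::euclidean_space \<Rightarrow> real"
  assumes "has_weak_gradient u g"
    and m: "u' \<in> borel_measurable lebesgue" "g' \<in> borel_measurable lebesgue"
    and ae: "AE x in lebesgue. u x = u' x" "AE x in lebesgue. g x = g' x"
  shows "has_weak_gradient u' g'"
  unfolding has_weak_gradient_def
proof (intro conjI allI impI ballI)
  have l: "loc_integrable u" "loc_integrable g" using assms(1) by (auto simp: has_weak_gradient_def)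
  show "loc_integrable u'" "loc_integrable g'"
    using loc_integrable_cong_AE[OF l(1) m(1) ae(1)] loc_integrable_cong_AE[OF l(2) m(2) ae(2)] by auto
  note [measurable] = m loc_integrable_measurable[OF l(1)] loc_integrable_measurable[OF l(2)]
  fix \<phi> :: "'a \<Rightarrow> real" and i :: 'a
  assume \<phi>: "test_fun \<phi>" "i \<in> Basis"
  then obtain H S where H: "C1_supp \<phi> H S" "\<And>x. frechet_derivative \<phi> (at x) i = H x \<bullet> i"
    using test_fun_C1_supp by metis
  have [measurable]: "\<phi> \<in> borel_measurable lebesgue" "H \<in> borel_measurable lebesgue"
    using C1_suppD[OF H(1)] by (auto intro: measurable_completion)
  have "(LINT x|lebesgue. u' x * frechet_derivative \<phi> (at x) i) = (LINT x|lebesgue. u x * frechet_derivative \<phi> (at x) i)"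
    unfolding H(2)
  proof (rule integral_cong_AE)
    show "AE x in lebesgue. u' x * (H x \<bullet> i) = u x * (H x \<bullet> i)"
      using ae(1) by eventually_elim simp
  qed measurable
  also have "\<dots> = - (LINT x|lebesgue. (g x \<bullet> i) * \<phi> x)"
    using assms(1) \<phi> by (auto simp: has_weak_gradient_def)
  also have "(LINT x|lebesgue. (g x \<bullet> i) * \<phi> x) = (LINT x|lebesgue. (g' x \<bullet> i) * \<phi> x)"
  proof (rule integral_cong_AE)
    show "AE x in lebesgue. (g x \<bullet> i) * \<phi> x = (g' x \<bullet> i) * \<phi> x"
      using ae(2) by eventually_elim simp
  qed measurable
  finally show "(LINT x|lebesgue. u' x * frechet_derivative \<phi> (at x) i) = - (LINT x|lebesgue. (g' x \<bullet> i) * \<phi> x)" .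
qed

lemma C1_supp_shift:
  fixes v :: "'a::euclidean_space \<Rightarrow> real" and z :: 'a
  assumes "C1_supp v G R"
  shows "C1_supp (\<lambda>x. v (x - z)) (\<lambda>x. G (x - z)) (R + norm z)"
  unfolding C1_supp_def
proof (intro conjI allI impI)
  note D = C1_suppD[OF assms]
  show "((\<lambda>x. v (x - z)) has_derivative (\<lambda>h. G (x - z) \<bullet> h)) (at x)" for x :: 'a
  proof -
    have "((\<lambda>x. x - z) has_derivative (\<lambda>v. v)) (at x)"
      by (auto intro: derivative_eq_intros)
    from has_derivative_compose[OF this D(1)] show ?thesis .
  qed
  show "continuous_on UNIV (\<lambda>x. G (x - z))"
    by (rule continuous_on_compose2[OF D(2)]) (auto intro!: continuous_intros)
  fix x :: 'a assume "norm x \<ge> R + norm z"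
  then have "norm (x - z) \<ge> R" using norm_triangle_ineq2[of x z] by linarith
  then show "v (x - z) = 0" "G (x - z) = 0" using D(4,5) by auto
qed

lemma test_fun_shift:
  fixes \<phi> :: "'a::euclidean_space \<Rightarrow> real" and z :: 'a
  assumes "test_fun \<phi>" shows "test_fun (\<lambda>x. \<phi> (x - z))"
  unfolding test_fun_def
proof (intro conjI allI)
  show "Ck k (\<lambda>x. \<phi> (x - z))" for k using assms by (auto simp: test_fun_def intro: Ck_shift)
  obtain G R where "C1_supp \<phi> G R" using test_fun_C1_supp[OF assms] by metis
  have "norm x \<le> R + norm z" if "\<phi> (x - z) \<noteq> 0" for x
    using C1_suppD(4)[OF C1_supp_shift[OF \<open>C1_supp \<phi> G R\<close>], of z x] that by linarith
  then have "{x. \<phi> (x - z) \<noteq> 0} \<subseteq> cball 0 (R + norm z)" by auto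
  then have "bounded {x. \<phi> (x - z) \<noteq> 0}" by (rule bounded_subset[OF bounded_cball])
  then show "compact (closure {x. \<phi> (x - z) \<noteq> 0})" by simp
qed

lemma weak_gradient_directional:
  fixes u :: "'a::euclidean_space \<Rightarrow> real"
  assumes w: "has_weak_gradient u g" and t: "test_fun \<phi>" and C: "C1_supp \<phi> G R"
    and [measurable]: "u \<in> borel_measurable borel" "g \<in> borel_measurable borel"
  shows "(LINT x|lborel. u x * (G x \<bullet> y)) = - (LINT x|lborel. (g x \<bullet> y) * \<phi> x)"
proof -
  note D = C1_suppD[OF C]
  note [measurable] = D(6,7)
  have l: "loc_integrable u" "loc_integrable g" using w by (auto simp: has_weak_gradient_def)
  have fd: "frechet_derivative \<phi> (at x) i = G x \<bullet> i" for x i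
    using frechet_derivative_at[OF D(1)[of x]] by metis
  have 1: "(LINT x|lborel. u x * (G x \<bullet> i)) = - (LINT x|lborel. (g x \<bullet> i) * \<phi> x)" if "i \<in> Basis" for i
  proof -
    have "(LINT x|lebesgue. u x * (G x \<bullet> i)) = - (LINT x|lebesgue. (g x \<bullet> i) * \<phi> x)"
      using w t that unfolding has_weak_gradient_def fd[symmetric] by blast
    then show ?thesis by (simp add: integral_completion)
  qed
  have 2: "integrable lborel (\<lambda>x. u x * (G x \<bullet> i))" for i
  proof -
    obtain M where M: "\<And>x. norm (G x \<bullet> i) \<le> M"
      by (rule continuous_compact_support_bounded[of "\<lambda>x. G x \<bullet> i" R])
         (use D in \<open>auto intro!: continuous_intros\<close>)
    have "integrable lebesgue (\<lambda>x. (G x \<bullet> i) *\<^sub>R u x)"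
      using M D by (intro loc_integrable_mult[OF l(1), of _ M R]) auto
    then show ?thesis by (simp add: integrable_completion mult.commute)
  qed
  have 3: "integrable lborel (\<lambda>x. (g x \<bullet> i) * \<phi> x)" for i
  proof -
    obtain M where M: "\<And>x. norm (\<phi> x) \<le> M"
      by (rule continuous_compact_support_bounded[of "\<phi>" R]) (use D in auto)
    have "integrable lebesgue (\<lambda>x. (\<phi> x *\<^sub>R g x) \<bullet> i)"
      using M D by (intro integrable_inner_left loc_integrable_mult[OF l(2), of _ M R]) auto
    then show ?thesis by (simp add: integrable_completion mult.commute)
  qed
  have e: "a \<bullet> y = (\<Sum>i\<in>Basis. (y \<bullet> i) * (a \<bullet> i))" for a
    by (subst euclidean_inner) (simp add: mult.commute)
  have "(LINT x|lborel. u x * (G x \<bullet> y)) = (LINT x|lborel. (\<Sum>i\<in>Basis. (y \<bullet> i) * (u x * (G x \<bullet> i))))"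
    by (subst e) (simp add: sum_distrib_left mult_ac)
  also have "\<dots> = (\<Sum>i\<in>Basis. (y \<bullet> i) * (LINT x|lborel. u x * (G x \<bullet> i)))"
    using 2 by (subst Bochner_Integration.integral_sum) auto
  also have "\<dots> = - (\<Sum>i\<in>Basis. (y \<bullet> i) * (LINT x|lborel. (g x \<bullet> i) * \<phi> x))"
    by (simp add: 1 sum_negf)
  also have "(\<Sum>i\<in>Basis. (y \<bullet> i) * (LINT x|lborel. (g x \<bullet> i) * \<phi> x))
      = (LINT x|lborel. (\<Sum>i\<in>Basis. (y \<bullet> i) * ((g x \<bullet> i) * \<phi> x)))"
    using 3 by (subst Bochner_Integration.integral_sum) auto
  also have "\<dots> = (LINT x|lborel. (g x \<bullet> y) * \<phi> x)"
    by (subst e[of "g _"]) (simp add: sum_distrib_left sum_distrib_right mult_ac)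
  finally show ?thesis .
qed

lemma cball_borel_measurable [measurable]: "cball a r \<in> sets borel"
  by simp

lemma loc_integrable_borelI:
  fixes f :: "'a::euclidean_space \<Rightarrow> 'b::euclidean_space"
  assumes [measurable]: "f \<in> borel_measurable borel"
    and "\<And>R. integrable lborel (\<lambda>x. indicator (cball 0 R) x *\<^sub>R f x)"
  shows "loc_integrable f"
  unfolding loc_integrable_def
proof (intro allI impI)
  fix K :: "'a set" assume K: "compact K"
  then obtain R where "\<forall>x\<in>K. norm x \<le> R"
    using compact_imp_bounded bounded_iff by metis
  then have "K \<subseteq> cball 0 R" by auto
  moreover have "f absolutely_integrable_on cball 0 R"
    using assms by (simp add: set_integrable_def integrable_completion)
  ultimately show "f absolutely_integrable_on K"
    using K by (intro set_integrable_subset[of lebesgue "cball 0 R" f K])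
       (auto simp: lmeasurable_compact fmeasurableD)
qed

lemma loc_integrable_borelD:
  fixes f :: "'a::euclidean_space \<Rightarrow> 'b::euclidean_space"
  assumes "loc_integrable f" "f \<in> borel_measurable borel"
  shows "integrable lborel (\<lambda>x. indicator (cball 0 R) x *\<^sub>R f x)"
proof -
  note [measurable] = assms(2)
  have "integrable lebesgue (\<lambda>x. indicator (cball 0 R) x *\<^sub>R f x)"
    using assms(1) by (auto simp: loc_integrable_def set_integrable_def)
  then show ?thesis by (subst (asm) integrable_completion) auto
qed

lemma integrable_segment_average:
  fixes g :: "'a::euclidean_space \<Rightarrow> 'a"
  assumes l: "loc_integrable g" and [measurable]: "g \<in> borel_measurable borel" "\<psi> \<in> borel_measurable borel"
    and M: "\<And>x. \<bar>\<psi> x\<bar> \<le> M" and R: "\<And>x. norm x > R \<Longrightarrow> \<psi> x = 0"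
  shows "integrable (lborel \<Otimes>\<^sub>M lborel)
    (\<lambda>(t, x). indicator {0..1} t * (g (x + t *\<^sub>R y) \<bullet> y) * \<psi> x)" (is "integrable _ ?f")
proof (rule integrable_segment_pairI)
  define h where "h x = M * norm y * norm (indicator (cball 0 (R + norm y)) x *\<^sub>R g x)" for x
  have [measurable]: "h \<in> borel_measurable borel" unfolding h_def by measurable
  have ih: "integrable lborel h"
    unfolding h_def by (intro integrable_mult_right integrable_norm loc_integrable_borelD l)
       (use assms in auto)
  have M0: "M \<ge> 0" using M[of 0] by linarith
  then have h0: "h x \<ge> 0" for x by (simp add: h_def)
  fix t :: real assume t: "t \<in> {0..1}"
  have "(\<integral>\<^sup>+x. ennreal \<bar>?f (t, x)\<bar> \<partial>lborel) \<le> (\<integral>\<^sup>+x. ennreal (h (x + t *\<^sub>R y)) \<partial>lborel)"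
  proof (intro nn_integral_mono ennreal_leI)
    fix x
    show "\<bar>?f (t, x)\<bar> \<le> h (x + t *\<^sub>R y)"
    proof (cases "norm x > R")
      case True
      then show ?thesis using R h0 by simp
    next
      case False
      have "norm (t *\<^sub>R y) \<le> norm y" using t by (simp add: mult_left_le_one_le)
      then have "norm (x + t *\<^sub>R y) \<le> R + norm y"
        using False norm_triangle_ineq[of x "t *\<^sub>R y"] by linarith
      then have "h (x + t *\<^sub>R y) = (norm (g (x + t *\<^sub>R y)) * norm y) * M"
        by (simp add: h_def)
      moreover have "\<bar>g (x + t *\<^sub>R y) \<bullet> y\<bar> * \<bar>\<psi> x\<bar> \<le> (norm (g (x + t *\<^sub>R y)) * norm y) * M"
        by (intro mult_mono Cauchy_Schwarz_ineq2 M) auto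
      ultimately show ?thesis using t by (simp add: abs_mult)
    qed
  qed
  also have "\<dots> = (\<integral>\<^sup>+x. ennreal (h x) \<partial>lborel)"
    by (rule nn_integral_lborel_shift) measurable
  also have "\<dots> = ennreal (LINT x|lborel. h x)"
    using ih h0 by (intro nn_integral_eq_integral) auto
  finally show "(\<integral>\<^sup>+x. ennreal \<bar>?f (t, x)\<bar> \<partial>lborel) \<le> ennreal (LINT x|lborel. h x)" .
qed auto

text \<open>The fundamental theorem of calculus on almost every segment parallel to \<open>y\<close>. Tested against
  \<open>\<phi>\<close>, the left-hand side becomes the integral of \<open>u x * (\<phi> (x - y) - \<phi> x)\<close>; here the increment of \<open>\<phi>\<close>
  is an integral of its derivative over a segment, and the definition of the weak gradient moves
  that derivative onto \<open>u\<close>.\<close>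

lemma weak_gradient_segment:
  fixes u :: "'a::euclidean_space \<Rightarrow> real"
  assumes w: "has_weak_gradient u g"
    and [measurable]: "u \<in> borel_measurable borel" "g \<in> borel_measurable borel"
  shows "AE x in lborel. u (x + y) - u x = (LINT t|lborel. indicator {0..1} t * (g (x + t *\<^sub>R y) \<bullet> y))"
proof -
  define W where "W x = (LINT t|lborel. indicator {0..1} t * (g (x + t *\<^sub>R y) \<bullet> y))" for x
  have [measurable]: "W \<in> borel_measurable borel" unfolding W_def by measurable
  have l: "loc_integrable u" "loc_integrable g" using w by (auto simp: has_weak_gradient_def)
  have W\<psi>: "integrable lborel (\<lambda>x. W x * \<psi> x)"
       "(LINT x|lborel. W x * \<psi> x) = (LINT t|lborel. indicator {0..1} t * (LINT x|lborel. (g (x + t *\<^sub>R y) \<bullet> y) * \<psi> x))"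
    if [measurable]: "\<psi> \<in> borel_measurable borel"
      and "\<And>x. \<bar>\<psi> x\<bar> \<le> M" "\<And>x. norm x > R \<Longrightarrow> \<psi> x = 0" for \<psi> M R
  proof -
    have i: "integrable (lborel \<Otimes>\<^sub>M lborel)
        (\<lambda>(t, x). indicator {0..1} t * (g (x + t *\<^sub>R y) \<bullet> y) * \<psi> x)"
      by (rule integrable_segment_average[OF l(2) _ that]) measurable
    have W: "W x * \<psi> x = (LINT t|lborel. indicator {0..1} t * (g (x + t *\<^sub>R y) \<bullet> y) * \<psi> x)" for x
      by (simp add: W_def)
    show "integrable lborel (\<lambda>x. W x * \<psi> x)"
      unfolding W by (rule lborel_pair.integrable_snd[OF i])
    have "(LINT x|lborel. W x * \<psi> x) =
        (LINT t|lborel. LINT x|lborel. indicator {0..1} t * (g (x + t *\<^sub>R y) \<bullet> y) * \<psi> x)"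
      unfolding W by (rule lborel_pair.Fubini_integral[OF i])
    then show "(LINT x|lborel. W x * \<psi> x) = (LINT t|lborel. indicator {0..1} t * (LINT x|lborel. (g (x + t *\<^sub>R y) \<bullet> y) * \<psi> x))"
      by (simp add: mult.assoc)
  qed
  have shiftu: "loc_integrable (\<lambda>x. u (x + y))"
  proof (rule loc_integrable_borelI)
    fix R
    have "integrable lborel (\<lambda>x. indicator (cball 0 (R + norm y)) (x + y) *\<^sub>R u (x + y))"
      by (rule integrable_lborel_shift[OF loc_integrable_borelD[OF l(1)]]) fact
    then show "integrable lborel (\<lambda>x. indicator (cball 0 R) x *\<^sub>R u (x + y))"
    proof (rule Bochner_Integration.integrable_bound)
      have "norm (x + y) \<le> R + norm y" if "norm x \<le> R" for x
        using norm_triangle_ineq[of x y] that by linarith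
      then show "AE x in lborel. norm (indicator (cball 0 R) x *\<^sub>R u (x + y))
          \<le> norm (indicator (cball 0 (R + norm y)) (x + y) *\<^sub>R u (x + y))"
        by (auto simp: indicator_def)
    qed measurable
  qed measurable
  have d: "loc_integrable (\<lambda>x. u (x + y) - u x - W x)"
  proof (rule loc_integrable_borelI)
    fix R
    have "integrable lborel (\<lambda>x. W x * indicator (cball 0 R) x)"
      by (rule W\<psi>(1)[of _ 1 R]) (auto simp: indicator_def)
    then show "integrable lborel (\<lambda>x. indicator (cball 0 R) x *\<^sub>R (u (x + y) - u x - W x))"
      using loc_integrable_borelD[OF l(1), of R] loc_integrable_borelD[OF shiftu, of R]
      by (simp add: right_diff_distrib mult.commute)
  qed measurable
  have "AE x in lebesgue. u (x + y) - u x - W x = 0"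
  proof (rule fundamental_lemma[OF d])
    fix \<phi> :: "'a \<Rightarrow> real" assume t: "test_fun \<phi>"
    obtain G R where C: "C1_supp \<phi> G R" using test_fun_C1_supp[OF t] by metis
    note D = C1_suppD[OF C]
    note [measurable] = D(6,7)
    obtain M where M: "\<And>x. norm (\<phi> x) \<le> M"
      by (rule continuous_compact_support_bounded[of "\<phi>" R]) (use D in auto)
    have iW: "integrable lborel (\<lambda>x. W x * \<phi> x)"
      by (rule W\<psi>(1)[of _ M R]) (use M D in auto)
    have i\<phi>: "integrable lborel (\<lambda>x. f x * \<phi> x)"
      if "loc_integrable f" "f \<in> borel_measurable borel" for f :: "'a \<Rightarrow> real"
      using loc_integrable_mult[OF that(1) D(6), of M R] M D that(2)
      by (simp add: integrable_completion mult.commute)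
    note i1 = i\<phi>[OF l(1)] and i2 = i\<phi>[OF shiftu]
    have i3: "integrable lborel (\<lambda>x. u x * \<phi> (x - y))"
      using integrable_lborel_shift[OF i2, of "- y"] by simp
    have G1: "\<phi> (x - y) - \<phi> x = (LINT t|lborel. indicator {0..1} t * (G (x - t *\<^sub>R y) \<bullet> (- y)))" for x
      using C1_supp_segment[OF C, of x "- y"] by simp
    obtain M' where M': "M' > 0" "\<And>x. norm (G x \<bullet> y) \<le> M'"
      by (rule continuous_compact_support_bounded[of "\<lambda>x. G x \<bullet> y" R])
         (use D in \<open>auto intro!: continuous_intros\<close>)
    let ?f = "\<lambda>(t, x). indicator {0..1} t * (u x * (G (x - t *\<^sub>R y) \<bullet> (- y)))"
    have int: "integrable (lborel \<Otimes>\<^sub>M lborel) ?f"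
    proof (rule integrable_segment_pairI)
      define h where "h x = M' * norm (indicator (cball 0 (R + norm y)) x *\<^sub>R u x)" for x
      have ih: "integrable lborel h"
        unfolding h_def by (intro integrable_mult_right integrable_norm loc_integrable_borelD l)
           (use assms in auto)
      fix t :: real assume t: "t \<in> {0..1}"
      have "(\<integral>\<^sup>+x. ennreal \<bar>?f (t, x)\<bar> \<partial>lborel) \<le> (\<integral>\<^sup>+x. ennreal (h x) \<partial>lborel)"
      proof (intro nn_integral_mono ennreal_leI)
        fix x
        show "\<bar>?f (t, x)\<bar> \<le> h x"
        proof (cases "norm x > R + norm y")
          case True
          have "norm (t *\<^sub>R y) \<le> norm y" using t by (simp add: mult_left_le_one_le)
          then have "norm (x - t *\<^sub>R y) \<ge> R"
            using True norm_triangle_ineq2[of x "t *\<^sub>R y"] by linarith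
          then show ?thesis using D(5) M'(1) by (simp add: h_def)
        next
          case False
          have "\<bar>u x\<bar> * \<bar>G (x - t *\<^sub>R y) \<bullet> y\<bar> \<le> \<bar>u x\<bar> * M'"
            using M'(2) by (intro mult_left_mono) auto
          then show ?thesis using t False by (simp add: abs_mult h_def mult.commute)
        qed
      qed
      also have "\<dots> = ennreal (LINT x|lborel. h x)"
      proof (intro nn_integral_eq_integral ih AE_I2)
        show "0 \<le> h x" for x using M'(1) by (simp add: h_def)
      qed
      finally show "(\<integral>\<^sup>+x. ennreal \<bar>?f (t, x)\<bar> \<partial>lborel) \<le> ennreal (LINT x|lborel. h x)" .
    qed auto
    have "(LINT x|lborel. (u (x + y) - u x) * \<phi> x) = (LINT x|lborel. u (x + y) * \<phi> x) - (LINT x|lborel. u x * \<phi> x)"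
      using i1 i2 by (simp add: left_diff_distrib)
    also have "(LINT x|lborel. u (x + y) * \<phi> x) = (LINT x|lborel. u x * \<phi> (x - y))"
      using integral_lborel_shift[of "\<lambda>x. u x * \<phi> (x - y)" y] by simp
    also have "(LINT x|lborel. u x * \<phi> (x - y)) - (LINT x|lborel. u x * \<phi> x) = (LINT x|lborel. u x * (\<phi> (x - y) - \<phi> x))"
      using i1 i3 by (simp add: right_diff_distrib)
    also have "\<dots> = (LINT x|lborel. LINT t|lborel. ?f (t, x))"
      unfolding G1 by (simp flip: integral_mult_right_zero) (simp add: mult_ac)
    also have "\<dots> = (LINT t|lborel. LINT x|lborel. ?f (t, x))"
      using int by (intro lborel_pair.Fubini_integral) (simp add: case_prod_unfold)
    also have "\<dots> = (LINT t|lborel. indicator {0..1} t * (LINT x|lborel. (g (x + t *\<^sub>R y) \<bullet> y) * \<phi> x))"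
    proof (rule Bochner_Integration.integral_cong[OF refl])
      fix s :: real
      have "(LINT x|lborel. u x * (G (x - s *\<^sub>R y) \<bullet> (- y))) = - (LINT x|lborel. (g x \<bullet> (- y)) * \<phi> (x - s *\<^sub>R y))"
        by (rule weak_gradient_directional[OF w test_fun_shift[OF t] C1_supp_shift[OF C]]) measurable
      also have "\<dots> = (LINT x|lborel. (g x \<bullet> y) * \<phi> (x - s *\<^sub>R y))" by simp
      also have "\<dots> = (LINT x|lborel. (g (x + s *\<^sub>R y) \<bullet> y) * \<phi> x)"
        using integral_lborel_shift[of "\<lambda>x. (g x \<bullet> y) * \<phi> (x - s *\<^sub>R y)" "s *\<^sub>R y"] by simp
      finally show "(LINT x|lborel. ?f (s, x)) = indicator {0..1} s * (LINT x|lborel. (g (x + s *\<^sub>R y) \<bullet> y) * \<phi> x)"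
        by (cases "s \<in> {0..1}") simp_all
    qed
    also have "\<dots> = (LINT x|lborel. W x * \<phi> x)"
      by (rule W\<psi>(2)[symmetric, of _ M R]) (use M D in auto)
    finally have eq: "(LINT x|lborel. (u (x + y) - u x) * \<phi> x) = (LINT x|lborel. W x * \<phi> x)" .
    have "integrable lborel (\<lambda>x. (u (x + y) - u x) * \<phi> x)"
      using i1 i2 by (simp add: left_diff_distrib)
    then have "(LINT x|lborel. (u (x + y) - u x - W x) * \<phi> x) = 0"
      using iW eq by (simp add: left_diff_distrib[of "u _ - u _"])
    then show "(LINT x|lebesgue. (u (x + y) - u x - W x) * \<phi> x) = 0"
      by (simp add: integral_completion)
  qed
  then have "AE x in lborel. u (x + y) - u x - W x = 0"
    by (simp add: AE_completion_iff)
  then show ?thesis by eventually_elim (simp add: W_def)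
qed

section \<open>Cube averages and mean increments\<close>

lemma square_integral_le:
  fixes f :: "'a::euclidean_space \<Rightarrow> real"
  assumes [measurable]: "f \<in> borel_measurable borel" "B \<in> sets borel" and B: "emeasure lborel B = 1"
  shows "ennreal ((LINT x|lborel. indicator B x * f x)\<^sup>2) \<le> (\<integral>\<^sup>+x. indicator B x * ennreal ((f x)\<^sup>2) \<partial>lborel)"
proof (cases "(\<integral>\<^sup>+x. indicator B x * ennreal ((f x)\<^sup>2) \<partial>lborel) = \<infinity>")
  case False
  define c where "c = (LINT x|lborel. indicator B x * f x)"
  have 1: "integrable lborel (\<lambda>x. indicator B x * (f x)\<^sup>2)"
  proof (rule integrableI_nonneg)
    show "(\<integral>\<^sup>+x. ennreal (indicator B x * (f x)\<^sup>2) \<partial>lborel) < \<infinity>"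
      using False by (simp add: ennreal_mult' top.not_eq_extremum ennreal_indicator[symmetric])
  qed auto
  have 2: "integrable lborel (indicator B :: 'a \<Rightarrow> real)"
    using B by (intro integrable_real_indicator) auto
  have 3: "integrable lborel (\<lambda>x. indicator B x * f x)"
  proof (rule Bochner_Integration.integrable_bound)
    show "integrable lborel (\<lambda>x. indicator B x + indicator B x * (f x)\<^sup>2)" using 1 2 by simp
    have "\<bar>f x\<bar> \<le> 1 + (f x)\<^sup>2" for x
    proof -
      have "0 \<le> (\<bar>f x\<bar> - 1)\<^sup>2 + \<bar>f x\<bar>" by simp
      then show ?thesis by (simp add: power2_diff)
    qed
    then show "AE x in lborel. norm (indicator B x * f x) \<le> norm (indicator B x + indicator B x * (f x)\<^sup>2)"
      by (auto simp: indicator_def abs_of_nonneg)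
  qed measurable
  have "0 \<le> (LINT x|lborel. indicator B x * (f x - c)\<^sup>2)"
    by (intro Bochner_Integration.integral_nonneg) auto
  also have "\<dots> = (LINT x|lborel. indicator B x * (f x)\<^sup>2 - (2 * c) * (indicator B x * f x) + c\<^sup>2 * indicator B x)"
    by (intro Bochner_Integration.integral_cong) (auto simp: power2_eq_square algebra_simps)
  also have "\<dots> = (LINT x|lborel. indicator B x * (f x)\<^sup>2) - (2 * c) * c + c\<^sup>2 * (LINT x|lborel. indicator B x)"
    using 1 2 3 by (simp add: c_def)
  also have "(LINT x|lborel. indicator B x) = (1::real)"
    using B by (simp add: measure_def)
  finally have "c\<^sup>2 \<le> (LINT x|lborel. indicator B x * (f x)\<^sup>2)"
    by (simp add: power2_eq_square)
  then have "ennreal (c\<^sup>2) \<le> ennreal (LINT x|lborel. indicator B x * (f x)\<^sup>2)" by (rule ennreal_leI)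
  also have "\<dots> = (\<integral>\<^sup>+x. ennreal (indicator B x * (f x)\<^sup>2) \<partial>lborel)"
    using 1 by (intro nn_integral_eq_integral[symmetric]) auto
  finally show ?thesis by (simp add: ennreal_mult' c_def ennreal_indicator[symmetric])
qed simp

lemma nn_integral_lborel_affine:
  fixes f :: "'a::euclidean_space \<Rightarrow> ennreal"
  assumes [measurable]: "f \<in> borel_measurable borel" and c: "c > 0"
  shows "(\<integral>\<^sup>+x. f (t + c *\<^sub>R x) \<partial>lborel) = ennreal (1 / c ^ DIM('a)) * (\<integral>\<^sup>+x. f x \<partial>lborel)"
proof -
  have "(\<integral>\<^sup>+x. f x \<partial>lborel) = ennreal (c ^ DIM('a)) * (\<integral>\<^sup>+x. f (t + c *\<^sub>R x) \<partial>lborel)"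
    using c by (subst lborel_affine[of c t]) (simp_all add: nn_integral_density nn_integral_distr nn_integral_cmult)
  then have "ennreal (1 / c ^ DIM('a)) * (\<integral>\<^sup>+x. f x \<partial>lborel) =
      (ennreal (1 / c ^ DIM('a)) * ennreal (c ^ DIM('a))) * (\<integral>\<^sup>+x. f (t + c *\<^sub>R x) \<partial>lborel)"
    by (simp add: mult.assoc)
  also have "ennreal (1 / c ^ DIM('a)) * ennreal (c ^ DIM('a)) = 1"
    using c by (subst ennreal_mult[symmetric]) auto
  finally show ?thesis by simp
qed

text \<open>The squared \<open>L\<^sup>2\<close> norm of the increment of \<open>w\<close> by the vector \<open>y\<close>.\<close>

definition incr :: "('a::euclidean_space \<Rightarrow> real) \<Rightarrow> 'a \<Rightarrow> ennreal" where
  "incr w y = (\<integral>\<^sup>+x. ennreal ((w (x + y) - w x)\<^sup>2) \<partial>lborel)"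

text \<open>Averages are taken over the unit cube, which has measure one. Increments range over the big
  cube, which contains \<open>2 y' - y\<close> for all \<open>y\<close> and \<open>y'\<close> in the unit cube.\<close>

abbreviation "unit_cube \<equiv> cbox 0 One"
abbreviation "big_cube \<equiv> cbox (- (2 *\<^sub>R One)) (2 *\<^sub>R One)"

text \<open>The squared \<open>L\<^sup>2\<close> norm of the increments of \<open>w\<close> by \<open>r h\<close>, integrated over \<open>h\<close> in the big cube
  and normalised by \<open>r\<^sup>2\<close>.\<close>

definition osc :: "real \<Rightarrow> ('a::euclidean_space \<Rightarrow> real) \<Rightarrow> ennreal" where
  "osc r w = ennreal (1 / r\<^sup>2) * (\<integral>\<^sup>+h. indicator big_cube h * incr w (r *\<^sub>R h) \<partial>lborel)"

text \<open>The average of \<open>w\<close> over the cube of side \<open>r\<close> with lower corner \<open>x\<close>.\<close>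

definition cube_average :: "real \<Rightarrow> ('a::euclidean_space \<Rightarrow> real) \<Rightarrow> 'a \<Rightarrow> real" where
  "cube_average r w x = (LINT y|lborel. indicator unit_cube y * w (x + r *\<^sub>R y))"

lemma incr_measurable [measurable]:
  assumes [measurable]: "w \<in> borel_measurable borel"
  shows "incr w \<in> borel_measurable borel"
  unfolding incr_def[abs_def] by measurable

lemma cube_average_measurable [measurable]:
  assumes [measurable]: "w \<in> borel_measurable borel"
  shows "cube_average r w \<in> borel_measurable borel"
  unfolding cube_average_def[abs_def] by measurable

lemma emeasure_unit_cube: "emeasure lborel (unit_cube :: 'a::euclidean_space set) = 1"
  by (subst emeasure_lborel_cbox) auto

lemma integrable_unit_cube:
  fixes f :: "'a::euclidean_space \<Rightarrow> real"
  assumes [measurable]: "f \<in> borel_measurable borel" and bnd: "\<And>y. \<bar>f y\<bar> \<le> K"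
  shows "integrable lborel (\<lambda>y. indicator unit_cube y * f y)"
proof (rule Bochner_Integration.integrable_bound)
  show "integrable lborel (\<lambda>y::'a. K * indicator unit_cube y)"
    by (intro integrable_mult_right integrable_real_indicator) (auto simp: emeasure_unit_cube)
  have "K \<ge> 0" using bnd[of 0] by linarith
  then show "AE y in lborel. norm (indicator unit_cube y * f y) \<le> norm (K * indicator unit_cube y)"
    using bnd by (auto simp: indicator_def)
qed measurable

text \<open>An increment by \<open>2 y\<close> is the sum of two increments by \<open>y\<close>, and \<open>incr\<close> is quadratic.\<close>

lemma incr_double:
  assumes [measurable]: "w \<in> borel_measurable borel"
  shows "incr w (2 *\<^sub>R y) \<le> 4 * incr w y"
proof -
  have p: "ennreal ((w (x + 2 *\<^sub>R y) - w x)\<^sup>2) \<le>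
      2 * ennreal ((w (x + y + y) - w (x + y))\<^sup>2) + 2 * ennreal ((w (x + y) - w x)\<^sup>2)" for x
  proof -
    have "(w (x + 2 *\<^sub>R y) - w x)\<^sup>2 \<le> 2 * (w (x + y + y) - w (x + y))\<^sup>2 + 2 * (w (x + y) - w x)\<^sup>2"
    proof -
      have "(s + t)\<^sup>2 \<le> 2 * s\<^sup>2 + 2 * t\<^sup>2" for s t :: real
        using sum_squares_bound[of s t] by (simp add: power2_sum)
      from this[of "w (x + y + y) - w (x + y)" "w (x + y) - w x"] show ?thesis
        by (simp add: scaleR_2 add.assoc)
    qed
    then have "ennreal ((w (x + 2 *\<^sub>R y) - w x)\<^sup>2) \<le>
        ennreal (2 * (w (x + y + y) - w (x + y))\<^sup>2 + 2 * (w (x + y) - w x)\<^sup>2)"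
      by (rule ennreal_leI)
    then show ?thesis by (simp add: ennreal_mult')
  qed
  have "incr w (2 *\<^sub>R y) \<le> (\<integral>\<^sup>+x. 2 * ennreal ((w (x + y + y) - w (x + y))\<^sup>2) + 2 * ennreal ((w (x + y) - w x)\<^sup>2) \<partial>lborel)"
    unfolding incr_def by (intro nn_integral_mono p)
  also have "\<dots> = 2 * (\<integral>\<^sup>+x. ennreal ((w (x + y + y) - w (x + y))\<^sup>2) \<partial>lborel) + 2 * incr w y"
    unfolding incr_def by (simp add: nn_integral_add nn_integral_cmult)
  also have "(\<integral>\<^sup>+x. ennreal ((w (x + y + y) - w (x + y))\<^sup>2) \<partial>lborel) = incr w y"
    unfolding incr_def
    by (rule nn_integral_lborel_shift[of "\<lambda>x. ennreal ((w (x + y) - w x)\<^sup>2)"]) measurable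
  also have "2 * incr w y + 2 * incr w y = 4 * incr w y"
    by (simp flip: distrib_right)
  finally show ?thesis .
qed

lemma osc_double:
  assumes [measurable]: "w \<in> borel_measurable borel" and r: "r > 0"
  shows "osc (2 * r) w \<le> osc r w"
proof -
  have "osc (2 * r) w \<le> ennreal (1 / (2 * r)\<^sup>2) * (\<integral>\<^sup>+h. 4 * (indicator big_cube h * incr w (r *\<^sub>R h)) \<partial>lborel)"
    unfolding osc_def
  proof (intro mult_left_mono nn_integral_mono)
    fix h
    show "indicator big_cube h * incr w ((2 * r) *\<^sub>R h) \<le> 4 * (indicator big_cube h * incr w (r *\<^sub>R h))"
      using incr_double[of w "r *\<^sub>R h"] by (auto simp: indicator_def)
  qed auto
  also have "\<dots> = (ennreal (1 / (2 * r)\<^sup>2) * ennreal 4) * (\<integral>\<^sup>+h. indicator big_cube h * incr w (r *\<^sub>R h) \<partial>lborel)"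
    by (simp add: nn_integral_cmult mult.assoc)
  also have "ennreal (1 / (2 * r)\<^sup>2) * ennreal 4 = ennreal (1 / r\<^sup>2)"
    using r by (subst ennreal_mult[symmetric]) (auto simp: power2_eq_square)
  finally show ?thesis by (simp add: osc_def)
qed

lemma osc_times_square: "r > 0 \<Longrightarrow>
  (\<integral>\<^sup>+h. indicator big_cube h * incr w (r *\<^sub>R h) \<partial>lborel) = ennreal (r\<^sup>2) * osc r w"
  unfolding osc_def by (subst mult.assoc[symmetric], subst ennreal_mult[symmetric]) auto

lemma cube_average_error:
  fixes w :: "'a::euclidean_space \<Rightarrow> real"
  assumes [measurable]: "w \<in> borel_measurable borel" and bnd: "\<And>x. \<bar>w x\<bar> \<le> M" and r: "r > 0"
  shows "(\<integral>\<^sup>+x. ennreal ((cube_average r w x - w x)\<^sup>2) \<partial>lborel) \<le> ennreal (r\<^sup>2) * osc r w"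
proof -
  have i: "integrable lborel (\<lambda>y. indicator unit_cube y * w (x + r *\<^sub>R y))" for x
    by (rule integrable_unit_cube[OF _ bnd]) measurable
  have e: "cube_average r w x - w x = (LINT y|lborel. indicator unit_cube y * (w (x + r *\<^sub>R y) - w x))" for x
  proof -
    have "(LINT y|lborel. indicator unit_cube y * (w (x + r *\<^sub>R y) - w x))
      = cube_average r w x - w x * (LINT y|lborel. indicator (unit_cube :: 'a set) y)"
      using i by (simp add: cube_average_def right_diff_distrib mult.commute[of _ "w x"] emeasure_unit_cube)
    also have "(LINT y|lborel. indicator (unit_cube :: 'a set) y) = (1::real)"
      by (simp add: measure_def emeasure_unit_cube)
    finally show ?thesis by simp
  qed
  have "(\<integral>\<^sup>+x. ennreal ((cube_average r w x - w x)\<^sup>2) \<partial>lborel) \<le>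
      (\<integral>\<^sup>+x. \<integral>\<^sup>+y. indicator unit_cube y * ennreal ((w (x + r *\<^sub>R y) - w x)\<^sup>2) \<partial>lborel \<partial>lborel)"
    unfolding e by (intro nn_integral_mono square_integral_le) (auto simp: emeasure_unit_cube)
  also have "\<dots> = (\<integral>\<^sup>+y. \<integral>\<^sup>+x. indicator unit_cube y * ennreal ((w (x + r *\<^sub>R y) - w x)\<^sup>2) \<partial>lborel \<partial>lborel)"
    by (rule lborel_pair.Fubini') measurable
  also have "\<dots> = (\<integral>\<^sup>+y. indicator unit_cube y * incr w (r *\<^sub>R y) \<partial>lborel)"
    by (simp add: incr_def nn_integral_cmult)
  also have "\<dots> \<le> (\<integral>\<^sup>+y. indicator big_cube y * incr w (r *\<^sub>R y) \<partial>lborel)"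
    by (intro nn_integral_mono) (auto simp: indicator_def mem_box intro: order_trans[of _ 0] order_trans[of _ 1])
  finally show ?thesis unfolding osc_times_square[OF r] .
qed

text \<open>Averages at the scales \<open>r\<close> and \<open>2 r\<close> are compared through all pairs of points of the two
  cubes.\<close>

lemma cube_average_double:
  fixes w :: "'a::euclidean_space \<Rightarrow> real"
  assumes [measurable]: "w \<in> borel_measurable borel" and bnd: "\<And>x. \<bar>w x\<bar> \<le> M" and r: "r > 0"
  shows "ennreal ((cube_average r w x - cube_average (2 * r) w x)\<^sup>2) \<le> ennreal (r\<^sup>2 / r ^ DIM('a)) * osc r w"
proof -
  have one: "(LINT y|lborel. indicator (unit_cube :: 'a set) y) = (1::real)"
    by (simp add: measure_def emeasure_unit_cube)
  let ?F = "\<lambda>y y'. w (x + r *\<^sub>R y) - w (x + (2 * r) *\<^sub>R y')"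
  have inner: "(LINT y'|lborel. indicator unit_cube y' * ?F y y') = w (x + r *\<^sub>R y) - cube_average (2 * r) w x" for y
    using integrable_unit_cube[of "\<lambda>y. w (x + (2 * r) *\<^sub>R y)" M] bnd one
    by (simp add: cube_average_def right_diff_distrib mult.commute[of _ "w (x + r *\<^sub>R y)"] emeasure_unit_cube)
  have outer: "(LINT y|lborel. indicator unit_cube y * (w (x + r *\<^sub>R y) - cube_average (2 * r) w x))
     = cube_average r w x - cube_average (2 * r) w x"
    using integrable_unit_cube[of "\<lambda>y. w (x + r *\<^sub>R y)" M] bnd one
    by (simp add: cube_average_def[of r] right_diff_distrib mult.commute[of _ "cube_average (2 * r) w x"] emeasure_unit_cube)
  have "ennreal ((cube_average r w x - cube_average (2 * r) w x)\<^sup>2) \<le>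
      (\<integral>\<^sup>+y. indicator unit_cube y * ennreal ((w (x + r *\<^sub>R y) - cube_average (2 * r) w x)\<^sup>2) \<partial>lborel)"
    unfolding outer[symmetric] by (rule square_integral_le) (auto simp: emeasure_unit_cube)
  also have "\<dots> \<le> (\<integral>\<^sup>+y. indicator unit_cube y *
       (\<integral>\<^sup>+y'. indicator unit_cube y' * ennreal ((?F y y')\<^sup>2) \<partial>lborel) \<partial>lborel)"
    unfolding inner[symmetric]
    by (intro nn_integral_mono mult_left_mono square_integral_le) (auto simp: emeasure_unit_cube)
  also have "\<dots> \<le> (\<integral>\<^sup>+y. \<integral>\<^sup>+h. indicator big_cube h * ennreal ((w (x + r *\<^sub>R y) - w (x + r *\<^sub>R y + r *\<^sub>R h))\<^sup>2) \<partial>lborel \<partial>lborel)"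
  proof (rule nn_integral_mono)
    fix y :: 'a
    show "indicator unit_cube y * (\<integral>\<^sup>+y'. indicator unit_cube y' * ennreal ((?F y y')\<^sup>2) \<partial>lborel)
      \<le> (\<integral>\<^sup>+h. indicator big_cube h * ennreal ((w (x + r *\<^sub>R y) - w (x + r *\<^sub>R y + r *\<^sub>R h))\<^sup>2) \<partial>lborel)" (is "_ \<le> ?R")
    proof (cases "y \<in> unit_cube")
      case True
      \<comment> \<open>Substitute \<open>h = 2 y' - y\<close>.\<close>
      let ?H = "\<lambda>h. indicator big_cube h * ennreal ((w (x + r *\<^sub>R y) - w (x + r *\<^sub>R y + r *\<^sub>R h))\<^sup>2)"
      have "(\<integral>\<^sup>+y'. indicator unit_cube y' * ennreal ((?F y y')\<^sup>2) \<partial>lborel) \<le> (\<integral>\<^sup>+y'. ?H (- y + 2 *\<^sub>R y') \<partial>lborel)"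
      proof (rule nn_integral_mono)
        fix y' :: 'a
        have "x + r *\<^sub>R y + r *\<^sub>R (- y + 2 *\<^sub>R y') = x + (2 * r) *\<^sub>R y'" by (simp add: algebra_simps)
        then have "?H (- y + 2 *\<^sub>R y') = indicator big_cube (- y + 2 *\<^sub>R y') * ennreal ((?F y y')\<^sup>2)"
          by (simp only:)
        moreover have "- y + 2 *\<^sub>R y' \<in> big_cube" if "y' \<in> unit_cube"
          unfolding mem_box
        proof
          fix j :: 'a assume j: "j \<in> Basis"
          have "0 \<le> y \<bullet> j" "y \<bullet> j \<le> 1" "0 \<le> y' \<bullet> j" "y' \<bullet> j \<le> 1"
            using True that j by (auto simp: mem_box)
          then show "(- (2 *\<^sub>R One)) \<bullet> j \<le> (- y + 2 *\<^sub>R y') \<bullet> j \<and> (- y + 2 *\<^sub>R y') \<bullet> j \<le> (2 *\<^sub>R One) \<bullet> j"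
            using j by (simp add: inner_add_left inner_diff_left)
        qed
        ultimately show "indicator unit_cube y' * ennreal ((?F y y')\<^sup>2) \<le> ?H (- y + 2 *\<^sub>R y')"
          by (cases "y' \<in> unit_cube") simp_all
      qed
      also have "\<dots> = ennreal (1 / 2 ^ DIM('a)) * ?R"
        by (rule nn_integral_lborel_affine) simp_all
      also have "\<dots> \<le> 1 * ?R"
        by (intro mult_right_mono) auto
      finally show ?thesis using True by simp
    qed simp
  qed
  also have "\<dots> = (\<integral>\<^sup>+h. \<integral>\<^sup>+y. indicator big_cube h * ennreal ((w (x + r *\<^sub>R y) - w (x + r *\<^sub>R y + r *\<^sub>R h))\<^sup>2) \<partial>lborel \<partial>lborel)"
    by (rule lborel_pair.Fubini') measurable
  also have "\<dots> = (\<integral>\<^sup>+h. ennreal (1 / r ^ DIM('a)) * (indicator big_cube h * incr w (r *\<^sub>R h)) \<partial>lborel)"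
  proof (rule nn_integral_cong)
    fix h :: 'a
    have "(\<integral>\<^sup>+y. ennreal ((w (x + r *\<^sub>R y) - w (x + r *\<^sub>R y + r *\<^sub>R h))\<^sup>2) \<partial>lborel) =
      ennreal (1 / r ^ DIM('a)) * (\<integral>\<^sup>+z. ennreal ((w z - w (z + r *\<^sub>R h))\<^sup>2) \<partial>lborel)"
      by (rule nn_integral_lborel_affine[of "\<lambda>z. ennreal ((w z - w (z + r *\<^sub>R h))\<^sup>2)"]) (measurable, rule r)
    then show "(\<integral>\<^sup>+y. indicator big_cube h * ennreal ((w (x + r *\<^sub>R y) - w (x + r *\<^sub>R y + r *\<^sub>R h))\<^sup>2) \<partial>lborel)
      = ennreal (1 / r ^ DIM('a)) * (indicator big_cube h * incr w (r *\<^sub>R h))"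
      by (simp add: nn_integral_cmult incr_def power2_commute mult_ac)
  qed
  also have "\<dots> = ennreal (1 / r ^ DIM('a)) * (ennreal (r\<^sup>2) * osc r w)"
    by (simp add: nn_integral_cmult osc_times_square[OF r])
  also have "\<dots> = ennreal (r\<^sup>2 / r ^ DIM('a)) * osc r w"
    using r by (subst mult.assoc[symmetric], subst ennreal_mult[symmetric]) auto
  finally show ?thesis .
qed

section \<open>A weak type estimate\<close>

text \<open>The radii \<open>2\<^sup>k\<close> with \<open>k\<close> an integer. Along these \<open>osc\<close> is monotone, so its supremum over
  all of them is a limit and commutes with sums.\<close>

definition dyadic :: "real \<Rightarrow> bool" where
  "dyadic r \<longleftrightarrow> (\<exists>m n. r = 2 ^ m / 2 ^ n)"

lemma dyadic_pos: "dyadic r \<Longrightarrow> r > 0"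
  by (auto simp: dyadic_def)

lemma dyadic_power: "dyadic r \<Longrightarrow> dyadic (2 ^ k * r)"
  unfolding dyadic_def by (metis power_add times_divide_eq_right)

lemma dyadic_between:
  assumes "\<rho> > 0" obtains r where "dyadic r" "\<rho> \<le> r" "r \<le> 2 * \<rho>"
proof -
  define k where "k = \<lceil>log 2 \<rho>\<rceil>"
  have p: "dyadic (2 powr real_of_int k)"
  proof (cases "k \<ge> 0")
    case True
    then have "2 powr real_of_int k = 2 ^ nat k / 2 ^ 0" by (simp flip: powr_realpow)
    then show ?thesis unfolding dyadic_def by blast
  next
    case False
    then have "2 powr real_of_int k = 2 ^ 0 / 2 ^ nat (- k)"
      by (simp flip: powr_realpow add: powr_minus_divide[symmetric])
    then show ?thesis unfolding dyadic_def by blast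
  qed
  have \<rho>: "\<rho> = 2 powr log 2 \<rho>" using assms by simp
  have "\<rho> \<le> 2 powr real_of_int k"
    by (subst \<rho>) (auto simp: k_def)
  moreover have "2 powr real_of_int k \<le> 2 powr (1 + log 2 \<rho>)"
    unfolding k_def by (intro powr_mono) linarith+
  then have "2 powr real_of_int k \<le> 2 * \<rho>"
    using assms by (simp add: powr_add)
  ultimately show ?thesis using p that by blast
qed

lemma osc_dyadic_le:
  assumes [measurable]: "w \<in> borel_measurable borel" and "dyadic r"
  shows "osc r w \<le> (SUP n. osc (1 / 2 ^ n) w)"
proof -
  obtain m n where r: "r = 2 ^ m / 2 ^ n" using assms(2) by (auto simp: dyadic_def)
  have "osc (2 ^ m / 2 ^ n) w \<le> osc (1 / 2 ^ n) w"
  proof (induction m)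
    case (Suc m)
    have "osc (2 * (2 ^ m / 2 ^ n)) w \<le> osc (2 ^ m / 2 ^ n) w" by (rule osc_double) auto
    with Suc show ?case by simp
  qed simp
  also have "\<dots> \<le> (SUP n. osc (1 / 2 ^ n) w)" by (rule SUP_upper) simp
  finally show ?thesis by (simp add: r)
qed

text \<open>Telescoping over the radii \<open>2\<^sup>m r\<close>. In dimension at least three the \<open>m\<close>-th difference is at most
  \<open>2\<^bsup>-m/2\<^esup>\<close> times the bound for \<open>m = 0\<close>, so the series converges; its sum is at most four times that
  bound.\<close>

lemma cube_average_bound:
  fixes w :: "'a::euclidean_space \<Rightarrow> real"
  assumes N: "DIM('a) \<ge> 3"
    and [measurable]: "w \<in> borel_measurable borel" and bnd: "\<And>x. \<bar>w x\<bar> \<le> M"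
    and osc: "\<And>r. dyadic r \<Longrightarrow> osc r w \<le> ennreal E" and E: "E \<ge> 0"
    and lim: "\<And>r. r > 0 \<Longrightarrow> (\<lambda>m. cube_average (2 ^ m * r) w x) \<longlonglongrightarrow> 0"
    and r: "dyadic r"
  shows "\<bar>cube_average r w x\<bar> \<le> 4 * sqrt (r\<^sup>2 / r ^ DIM('a) * E)"
proof -
  \<comment> \<open>\<open>q\<close> is the ratio and \<open>s\<close> the first term of the dominating geometric series.\<close>
  define q where "q = 1 / sqrt 2"
  define s where "s = sqrt (r\<^sup>2 / r ^ DIM('a) * E)"
  let ?A = "\<lambda>m. cube_average (2 ^ m * r) w x"
  have r0: "r > 0" by (rule dyadic_pos[OF r])
  have q: "0 < q" "q < 1" "1 / (1 - q) \<le> 4"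
  proof -
    have "sqrt 2 * 3 \<ge> (4::real)"
      by (rule power2_le_imp_le) (auto simp: power_mult_distrib)
    then have "q \<le> 3 / 4" unfolding q_def by (simp add: field_simps)
    then show "q < 1" "1 / (1 - q) \<le> 4" by (auto simp: field_simps)
  qed (simp add: q_def)
  have s0: "s \<ge> 0" unfolding s_def using r0 E by auto
  have step: "\<bar>?A m - ?A (Suc m)\<bar> \<le> s * q ^ m" for m
  proof -
    let ?r = "2 ^ m * r"
    have d: "dyadic ?r" by (rule dyadic_power[OF r])
    have "ennreal ((?A m - ?A (Suc m))\<^sup>2) \<le> ennreal (?r\<^sup>2 / ?r ^ DIM('a)) * osc ?r w"
      using cube_average_double[OF assms(2) bnd dyadic_pos[OF d], of x] by (simp add: mult_ac)
    also have "\<dots> \<le> ennreal (?r\<^sup>2 / ?r ^ DIM('a)) * ennreal E"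
      by (intro mult_left_mono osc d) auto
    also have "\<dots> = ennreal (?r\<^sup>2 / ?r ^ DIM('a) * E)"
      using r0 E by (intro ennreal_mult[symmetric]) auto
    finally have "(?A m - ?A (Suc m))\<^sup>2 \<le> ?r\<^sup>2 / ?r ^ DIM('a) * E"
      using r0 E by (subst (asm) ennreal_le_iff) auto
    also have "\<dots> \<le> r\<^sup>2 / r ^ DIM('a) * E * (1 / 2) ^ m"
    proof -
      obtain k where k: "DIM('a) = k + 3" using N by (metis add.commute le_Suc_ex)
      have "?r\<^sup>2 / ?r ^ DIM('a) = r\<^sup>2 / r ^ DIM('a) * (1 / 2 ^ m) ^ (k + 1)"
        using r0 unfolding k by (simp add: power_mult_distrib power_add field_simps power2_eq_square power3_eq_cube)
      also have "\<dots> \<le> r\<^sup>2 / r ^ DIM('a) * (1 / 2 ^ m) ^ 1"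
        using r0 by (intro mult_left_mono power_decreasing) auto
      finally have "?r\<^sup>2 / ?r ^ DIM('a) \<le> r\<^sup>2 / r ^ DIM('a) * (1 / 2 ^ m)"
        by (simp only: power_one_right)
      then have "?r\<^sup>2 / ?r ^ DIM('a) * E \<le> r\<^sup>2 / r ^ DIM('a) * (1 / 2 ^ m) * E"
        using E by (rule mult_right_mono)
      then show ?thesis by (simp add: power_one_over mult_ac)
    qed
    also have "\<dots> = (s * q ^ m)\<^sup>2"
    proof -
      have "(q ^ m)\<^sup>2 = (1 / 2) ^ m"
        by (simp add: q_def power_mult[symmetric] mult.commute[of m] power_mult power_one_over)
      moreover have "s\<^sup>2 = r\<^sup>2 / r ^ DIM('a) * E" unfolding s_def using r0 E by simp
      ultimately show ?thesis by (simp only: power_mult_distrib)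
    qed
    finally have "\<bar>?A m - ?A (Suc m)\<bar>\<^sup>2 \<le> (s * q ^ m)\<^sup>2" by (simp only: power2_abs)
    moreover have "0 \<le> s * q ^ m" using s0 q by simp
    ultimately show ?thesis by (rule power2_le_imp_le)
  qed
  have "\<bar>?A 0\<bar> \<le> s * (\<Sum>m<n. q ^ m) + \<bar>?A n\<bar>" for n
  proof (induction n)
    case (Suc n)
    have "\<bar>?A n\<bar> \<le> s * q ^ n + \<bar>?A (Suc n)\<bar>" using step[of n] by linarith
    with Suc show ?case by (simp add: distrib_left)
  qed simp
  moreover have "s * (\<Sum>m<n. q ^ m) \<le> s * 4" for n
  proof (intro mult_left_mono s0)
    have "(\<Sum>m<n. q ^ m) = (1 - q ^ n) / (1 - q)"
      using q by (simp add: sum_gp_strict)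
    also have "\<dots> \<le> 1 / (1 - q)" using q by (intro divide_right_mono) auto
    finally show "(\<Sum>m<n. q ^ m) \<le> 4" using q by linarith
  qed
  ultimately have *: "\<bar>?A 0\<bar> \<le> s * 4 + \<bar>?A n\<bar>" for n
    by (meson add_right_mono order_trans)
  have "(\<lambda>n. s * 4 + \<bar>?A n\<bar>) \<longlonglongrightarrow> s * 4 + \<bar>0\<bar>"
    by (intro tendsto_intros lim r0)
  then have "\<bar>?A 0\<bar> \<le> s * 4 + \<bar>0\<bar>"
    by (rule LIMSEQ_le_const) (use * in blast)
  then show ?thesis by (simp add: s_def)
qed

text \<open>The radius is chosen so that the averages are at most \<open>t / 2\<close>; the set where \<open>\<bar>w\<bar> \<ge> t\<close> is
  then controlled by the \<open>L\<^sup>2\<close> distance between \<open>w\<close> and its averages.\<close>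

lemma weak_type:
  fixes w :: "'a::euclidean_space \<Rightarrow> real"
  assumes N: "DIM('a) \<ge> 3"
    and [measurable]: "w \<in> borel_measurable borel" and bnd: "\<And>x. \<bar>w x\<bar> \<le> M"
    and osc: "\<And>r. dyadic r \<Longrightarrow> osc r w \<le> ennreal E" and E: "E \<ge> 0"
    and lim: "\<And>r x. r > 0 \<Longrightarrow> (\<lambda>m. cube_average (2 ^ m * r) w x) \<longlonglongrightarrow> 0"
    and t: "t > 0"
  defines "\<kappa> \<equiv> 2 / (real DIM('a) - 2)"
  shows "emeasure lborel {x. \<bar>w x\<bar> \<ge> t} \<le> ennreal (16 * 64 powr \<kappa> * (E / t\<^sup>2) powr (1 + \<kappa>))"
proof -
  have N2: "real DIM('a) - 2 > 0" using N by linarith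
  have \<kappa>: "\<kappa> > 0" unfolding \<kappa>_def using N2 by simp
  have main: "emeasure lborel {x. \<bar>w x\<bar> \<ge> t} \<le> ennreal (4 * r\<^sup>2 * (E / t\<^sup>2))"
    if r: "dyadic r" and h: "64 * (r\<^sup>2 / r ^ DIM('a) * E) \<le> t\<^sup>2" for r
  proof -
    have r0: "r > 0" by (rule dyadic_pos[OF r])
    have "\<bar>cube_average r w x\<bar> \<le> t / 2" for x
    proof -
      have "8 * sqrt (r\<^sup>2 / r ^ DIM('a) * E) \<le> t"
      proof (rule power2_le_imp_le)
        have "0 \<le> r\<^sup>2 / r ^ DIM('a) * E" using r0 E by simp
        then have "(8 * sqrt (r\<^sup>2 / r ^ DIM('a) * E))\<^sup>2 = 64 * (r\<^sup>2 / r ^ DIM('a) * E)"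
          by (simp only: power_mult_distrib real_sqrt_pow2) simp
        with h show "(8 * sqrt (r\<^sup>2 / r ^ DIM('a) * E))\<^sup>2 \<le> t\<^sup>2" by simp
      qed (use t in simp)
      then show ?thesis using cube_average_bound[OF N assms(2) bnd osc E lim r, of x] by linarith
    qed
    then have sub: "{x. \<bar>w x\<bar> \<ge> t} \<subseteq> {x\<in>space lborel. 1 \<le> ennreal (4 / t\<^sup>2) * ennreal ((cube_average r w x - w x)\<^sup>2)}"
    proof (intro subsetI CollectI conjI)
      fix x assume a: "\<And>x. \<bar>cube_average r w x\<bar> \<le> t / 2" "x \<in> {x. \<bar>w x\<bar> \<ge> t}"
      have "\<bar>w x\<bar> \<ge> t" using a(2) by simp
      then have "t / 2 \<le> \<bar>cube_average r w x - w x\<bar>" using a(1)[of x] by linarith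
      then have "(t / 2)\<^sup>2 \<le> (cube_average r w x - w x)\<^sup>2"
        using t power_mono[of "t / 2" "\<bar>cube_average r w x - w x\<bar>" 2] by simp
      then have "1 \<le> 4 / t\<^sup>2 * (cube_average r w x - w x)\<^sup>2"
        using t by (simp add: field_simps power2_eq_square)
      then show "1 \<le> ennreal (4 / t\<^sup>2) * ennreal ((cube_average r w x - w x)\<^sup>2)"
        by (subst ennreal_mult[symmetric]) (auto simp: ennreal_1[symmetric] simp del: ennreal_1 intro: ennreal_leI)
    qed auto
    have "emeasure lborel {x. \<bar>w x\<bar> \<ge> t} \<le>
        emeasure lborel {x\<in>space lborel. 1 \<le> ennreal (4 / t\<^sup>2) * ennreal ((cube_average r w x - w x)\<^sup>2)}"
      by (rule emeasure_mono[OF sub]) measurable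
    also have "\<dots> \<le> ennreal (4 / t\<^sup>2) * (\<integral>\<^sup>+x. ennreal ((cube_average r w x - w x)\<^sup>2) * indicator (space lborel) x \<partial>lborel)"
      using nn_integral_Markov_inequality[where M = lborel and A = "space lborel"
            and u = "\<lambda>x. ennreal ((cube_average r w x - w x)\<^sup>2)" and c = "ennreal (4 / t\<^sup>2)"]
      by simp
    also have "\<dots> \<le> ennreal (4 / t\<^sup>2) * (ennreal (r\<^sup>2) * ennreal E)"
      using order_trans[OF cube_average_error[OF assms(2) bnd r0] mult_left_mono[OF osc[OF r]]]
      by (intro mult_left_mono) auto
    also have "\<dots> = ennreal (4 * r\<^sup>2 * (E / t\<^sup>2))"
      using E by (simp flip: ennreal_mult'' add: mult_ac)
    finally show ?thesis .
  qed
  show ?thesis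
  proof (cases "E = 0")
    case True
    have "dyadic 1" unfolding dyadic_def by (intro exI[of _ 0]) simp
    from main[OF this] True show ?thesis using t by simp
  next
    case False
    with E have E0: "E > 0" by simp
    \<comment> \<open>\<open>\<rho>\<close> is the radius at which the bound of \<open>cube_average_bound\<close> equals \<open>t / 2\<close>.\<close>
    define z where "z = 64 * (E / t\<^sup>2)"
    have z0: "z > 0" using E0 t by (simp add: z_def)
    define \<rho> where "\<rho> = z powr (1 / (real DIM('a) - 2))"
    have \<rho>0: "\<rho> > 0" using z0 by (simp add: \<rho>_def)
    obtain r where r: "dyadic r" "\<rho> \<le> r" "r \<le> 2 * \<rho>" using dyadic_between[OF \<rho>0] .
    have r0: "r > 0" by (rule dyadic_pos[OF r(1)])
    have "r\<^sup>2 / r ^ DIM('a) * z \<le> 1"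
    proof -
      have "z = \<rho> powr (real DIM('a) - 2)"
        unfolding \<rho>_def using z0 N2 by (simp add: powr_powr)
      also have "\<dots> \<le> r powr (real DIM('a) - 2)"
        using r \<rho>0 N2 by (intro powr_mono2) auto
      also have "\<dots> = r ^ DIM('a) / r\<^sup>2"
        using r0 by (simp add: powr_diff powr_realpow)
      finally have "z * r\<^sup>2 \<le> r ^ DIM('a)" using r0 by (simp add: pos_le_divide_eq)
      then show ?thesis using r0 by (simp add: pos_divide_le_eq mult.commute)
    qed
    then have "r\<^sup>2 / r ^ DIM('a) * z * t\<^sup>2 \<le> 1 * t\<^sup>2" by (rule mult_right_mono) simp
    then have "64 * (r\<^sup>2 / r ^ DIM('a) * E) \<le> t\<^sup>2"
      using t unfolding z_def by (simp add: mult_ac)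
    from main[OF r(1) this] have "emeasure lborel {x. \<bar>w x\<bar> \<ge> t} \<le> ennreal (4 * r\<^sup>2 * (E / t\<^sup>2))" .
    also have "\<dots> \<le> ennreal (16 * 64 powr \<kappa> * (E / t\<^sup>2) powr (1 + \<kappa>))"
    proof (rule ennreal_leI)
      have "r\<^sup>2 \<le> (2 * \<rho>)\<^sup>2" using r r0 by (intro power_mono) auto
      also have "\<dots> = 4 * z powr \<kappa>"
        by (simp add: \<rho>_def \<kappa>_def power2_eq_square flip: powr_add)
      also have "\<dots> = 4 * (64 powr \<kappa> * (E / t\<^sup>2) powr \<kappa>)"
        unfolding z_def using E0 t by (subst powr_mult) auto
      finally have "4 * r\<^sup>2 * (E / t\<^sup>2) \<le> 4 * (4 * (64 powr \<kappa> * (E / t\<^sup>2) powr \<kappa>)) * (E / t\<^sup>2)"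
        using E0 t by (intro mult_mono) auto
      also have "\<dots> = 16 * 64 powr \<kappa> * (E / t\<^sup>2) powr (1 + \<kappa>)"
        using E0 t by (simp add: powr_add mult_ac)
      finally show "4 * r\<^sup>2 * (E / t\<^sup>2) \<le> 16 * 64 powr \<kappa> * (E / t\<^sup>2) powr (1 + \<kappa>)" .
    qed
    finally show ?thesis .
  qed
qed

section \<open>The Sobolev inequality\<close>

lemma incr_le_gradient:
  fixes u :: "'a::euclidean_space \<Rightarrow> real"
  assumes w: "has_weak_gradient u g"
    and [measurable]: "u \<in> borel_measurable borel" "g \<in> borel_measurable borel"
  shows "incr u y \<le> ennreal ((norm y)\<^sup>2) * (\<integral>\<^sup>+x. ennreal ((norm (g x))\<^sup>2) \<partial>lborel)"
proof -
  have "incr u y \<le> (\<integral>\<^sup>+x. \<integral>\<^sup>+t. indicator {0..1::real} t * (ennreal ((norm y)\<^sup>2) * ennreal ((norm (g (x + t *\<^sub>R y)))\<^sup>2)) \<partial>lborel \<partial>lborel)"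
    unfolding incr_def
  proof (rule nn_integral_mono_AE)
    show "AE x in lborel. ennreal ((u (x + y) - u x)\<^sup>2) \<le>
       (\<integral>\<^sup>+t. indicator {0..1::real} t * (ennreal ((norm y)\<^sup>2) * ennreal ((norm (g (x + t *\<^sub>R y)))\<^sup>2)) \<partial>lborel)"
      using weak_gradient_segment[OF assms, of y]
    proof eventually_elim
      case (elim x)
      have "ennreal ((u (x + y) - u x)\<^sup>2) \<le> (\<integral>\<^sup>+t. indicator {0..1} t * ennreal ((g (x + t *\<^sub>R y) \<bullet> y)\<^sup>2) \<partial>lborel)"
        unfolding elim by (rule square_integral_le) auto
      also have "\<dots> \<le> (\<integral>\<^sup>+t. indicator {0..1::real} t * (ennreal ((norm y)\<^sup>2) * ennreal ((norm (g (x + t *\<^sub>R y)))\<^sup>2)) \<partial>lborel)"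
      proof (intro nn_integral_mono mult_left_mono)
        fix t
        have "\<bar>g (x + t *\<^sub>R y) \<bullet> y\<bar> \<le> norm (g (x + t *\<^sub>R y)) * norm y" by (rule Cauchy_Schwarz_ineq2)
        then have "\<bar>g (x + t *\<^sub>R y) \<bullet> y\<bar>\<^sup>2 \<le> (norm (g (x + t *\<^sub>R y)) * norm y)\<^sup>2"
          by (rule power_mono) simp
        then have "(g (x + t *\<^sub>R y) \<bullet> y)\<^sup>2 \<le> (norm y)\<^sup>2 * (norm (g (x + t *\<^sub>R y)))\<^sup>2"
          by (simp add: power_mult_distrib mult.commute)
        then show "ennreal ((g (x + t *\<^sub>R y) \<bullet> y)\<^sup>2) \<le> ennreal ((norm y)\<^sup>2) * ennreal ((norm (g (x + t *\<^sub>R y)))\<^sup>2)"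
          by (subst ennreal_mult[symmetric]) (auto intro: ennreal_leI)
      qed auto
      finally show ?case .
    qed
  qed
  also have "\<dots> = (\<integral>\<^sup>+t. \<integral>\<^sup>+x. indicator {0..1::real} t * (ennreal ((norm y)\<^sup>2) * ennreal ((norm (g (x + t *\<^sub>R y)))\<^sup>2)) \<partial>lborel \<partial>lborel)"
    by (rule lborel_pair.Fubini') measurable
  also have "\<dots> = (\<integral>\<^sup>+t. (ennreal ((norm y)\<^sup>2) * (\<integral>\<^sup>+x. ennreal ((norm (g x))\<^sup>2) \<partial>lborel)) * indicator {0..1::real} t \<partial>lborel)"
  proof (rule nn_integral_cong)
    fix t :: real
    have "(\<integral>\<^sup>+x. ennreal ((norm (g (x + t *\<^sub>R y)))\<^sup>2) \<partial>lborel) = (\<integral>\<^sup>+x. ennreal ((norm (g x))\<^sup>2) \<partial>lborel)"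
      by (rule nn_integral_lborel_shift[of "\<lambda>x. ennreal ((norm (g x))\<^sup>2)"]) measurable
    then show "(\<integral>\<^sup>+x. indicator {0..1} t * (ennreal ((norm y)\<^sup>2) * ennreal ((norm (g (x + t *\<^sub>R y)))\<^sup>2)) \<partial>lborel)
       = (ennreal ((norm y)\<^sup>2) * (\<integral>\<^sup>+x. ennreal ((norm (g x))\<^sup>2) \<partial>lborel)) * indicator {0..1} t"
      by (simp add: nn_integral_cmult mult_ac)
  qed
  also have "\<dots> = ennreal ((norm y)\<^sup>2) * (\<integral>\<^sup>+x. ennreal ((norm (g x))\<^sup>2) \<partial>lborel)"
    by (subst nn_integral_cmult_indicator) auto
  finally show ?thesis .
qed

lemma norm_big_cube: "h \<in> big_cube \<Longrightarrow> norm (h::'a::euclidean_space) \<le> 2 * real DIM('a)"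
proof -
  assume "h \<in> big_cube"
  then have "\<bar>h \<bullet> j\<bar> \<le> 2" if "j \<in> Basis" for j
    using that by (auto simp: mem_box abs_le_iff)
  then have "(\<Sum>j\<in>Basis. \<bar>h \<bullet> j\<bar>) \<le> (\<Sum>j\<in>(Basis::'a set). 2)" by (rule sum_mono)
  with norm_le_l1[of h] show ?thesis by simp
qed

lemma emeasure_big_cube: "emeasure lborel (big_cube :: 'a::euclidean_space set) = ennreal (4 ^ DIM('a))"
proof -
  have "(\<Prod>j\<in>Basis. (2 *\<^sub>R One - - (2 *\<^sub>R One) :: 'a) \<bullet> j) = (\<Prod>j\<in>(Basis::'a set). 4)"
    by (intro prod.cong) (auto simp: inner_add_left)
  then show ?thesis by (subst emeasure_lborel_cbox) auto
qed

text \<open>The measure \<open>4\<^sup>N\<close> of the big cube times the square of the bound \<open>2 N\<close> on the norm of its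
  points.\<close>

definition osc_const :: "nat \<Rightarrow> real" where
  "osc_const N = 4 * (real N)\<^sup>2 * 4 ^ N"

lemma osc_le_gradient:
  fixes u :: "'a::euclidean_space \<Rightarrow> real"
  assumes w: "has_weak_gradient u g"
    and [measurable]: "u \<in> borel_measurable borel" "g \<in> borel_measurable borel"
    and G: "(\<integral>\<^sup>+x. ennreal ((norm (g x))\<^sup>2) \<partial>lborel) \<le> ennreal G" "G \<ge> 0" and r: "r > 0"
  shows "osc r u \<le> ennreal (osc_const DIM('a) * G)"
proof -
  let ?c = "r\<^sup>2 * (4 * (real DIM('a))\<^sup>2) * G"
  have "osc r u \<le> ennreal (1 / r\<^sup>2) * (\<integral>\<^sup>+h. ennreal ?c * indicator (big_cube::'a set) h \<partial>lborel)"
    unfolding osc_def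
  proof (intro mult_left_mono nn_integral_mono)
    fix h :: 'a
    show "indicator big_cube h * incr u (r *\<^sub>R h) \<le> ennreal ?c * indicator big_cube h"
    proof (cases "h \<in> big_cube")
      case True
      have "incr u (r *\<^sub>R h) \<le> ennreal ((norm (r *\<^sub>R h))\<^sup>2) * ennreal G"
        using incr_le_gradient[OF assms(1-3), of "r *\<^sub>R h"] G(1)
        by (meson mult_left_mono order_trans zero_le)
      also have "\<dots> = ennreal (r\<^sup>2 * (norm h)\<^sup>2 * G)"
        using G(2) by (simp add: ennreal_mult power_mult_distrib)
      also have "\<dots> \<le> ennreal ?c"
      proof (intro ennreal_leI mult_right_mono mult_left_mono G)
        have "(norm h)\<^sup>2 \<le> (2 * real DIM('a))\<^sup>2"
          by (intro power_mono norm_big_cube True) auto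
        then show "(norm h)\<^sup>2 \<le> 4 * (real DIM('a))\<^sup>2" by (simp add: power_mult_distrib)
      qed auto
      finally show ?thesis using True by simp
    qed simp
  qed auto
  also have "\<dots> = ennreal (1 / r\<^sup>2) * (ennreal ?c * ennreal (4 ^ DIM('a)))"
    by (simp add: nn_integral_cmult_indicator emeasure_big_cube)
  also have "ennreal ?c * ennreal (4 ^ DIM('a)) = ennreal (?c * 4 ^ DIM('a))"
    using G by (intro ennreal_mult[symmetric]) auto
  also have "ennreal (1 / r\<^sup>2) * \<dots> = ennreal (1 / r\<^sup>2 * (?c * 4 ^ DIM('a)))"
    using G by (intro ennreal_mult[symmetric]) auto
  also have "1 / r\<^sup>2 * (?c * 4 ^ DIM('a)) = osc_const DIM('a) * G"
    using r by (simp add: osc_const_def)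
  finally show ?thesis .
qed

text \<open>The part of \<open>s\<close> between the levels \<open>a 2\<^sup>i\<close> and \<open>a 2\<^bsup>i+1\<^esup>\<close>.\<close>

definition slice :: "real \<Rightarrow> nat \<Rightarrow> real \<Rightarrow> real" where
  "slice a i s = min s (a * 2 ^ Suc i) - min s (a * 2 ^ i)"

lemma slice_bounds: "a > 0 \<Longrightarrow> 0 \<le> slice a i s \<and> slice a i s \<le> a * 2 ^ i"
proof -
  assume "a > 0"
  then have "a * 2 ^ i > 0" "a * 2 ^ Suc i = 2 * (a * 2 ^ i)" by auto
  then show ?thesis unfolding slice_def by (auto simp: min_def)
qed

lemma slice_mono: "a > 0 \<Longrightarrow> t \<le> s \<Longrightarrow> slice a i t \<le> slice a i s"
proof -
  assume "a > 0" "t \<le> s"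
  then have "a * 2 ^ i > 0" "a * 2 ^ Suc i = 2 * (a * 2 ^ i)" by auto
  then show ?thesis unfolding slice_def using \<open>t \<le> s\<close> by (auto simp: min_def)
qed

lemma slice_measurable [measurable]: "slice a i \<in> borel_measurable borel"
  unfolding slice_def[abs_def] by measurable

lemma sum_slice: "(\<Sum>i<n. slice a i s) = min s (a * 2 ^ n) - min s a"
  by (induction n) (auto simp: slice_def)

lemma sum_squares_le_square_sum:
  fixes d :: "nat \<Rightarrow> real"
  assumes "\<And>i. d i \<ge> 0"
  shows "(\<Sum>i<n. (d i)\<^sup>2) \<le> (\<Sum>i<n. d i)\<^sup>2"
proof (induction n)
  case (Suc n)
  have "0 \<le> (\<Sum>i<n. d i) * d n" using assms by (intro mult_nonneg_nonneg sum_nonneg) auto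
  then have "(\<Sum>i<n. d i)\<^sup>2 + (d n)\<^sup>2 \<le> ((\<Sum>i<n. d i) + d n)\<^sup>2" by (simp add: power2_sum mult.commute)
  with Suc show ?case by simp
qed simp

lemma slice_sum_squares:
  assumes a: "a > 0"
  shows "(\<Sum>i<n. (slice a i s - slice a i t)\<^sup>2) \<le> (s - t)\<^sup>2"
proof -
  have *: "(\<Sum>i<n. (slice a i s - slice a i t)\<^sup>2) \<le> (s - t)\<^sup>2" if "t \<le> s" for s t
  proof -
    have "(\<Sum>i<n. (slice a i s - slice a i t)\<^sup>2) \<le> (\<Sum>i<n. slice a i s - slice a i t)\<^sup>2"
      using slice_mono[OF a that] by (intro sum_squares_le_square_sum) simp
    also have "\<dots> \<le> (s - t)\<^sup>2"
    proof (rule power_mono)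
      have "a * 1 \<le> a * 2 ^ n" using a by (intro mult_left_mono) auto
      then show "(\<Sum>i<n. slice a i s - slice a i t) \<le> s - t"
        using that by (auto simp: sum_subtractf sum_slice min_def)
      show "0 \<le> (\<Sum>i<n. slice a i s - slice a i t)"
        using slice_mono[OF a that] by (intro sum_nonneg) simp
    qed
    finally show ?thesis .
  qed
  show ?thesis
    using *[of t s] *[of s t] by (cases "t \<le> s") (auto simp: power2_commute)
qed

text \<open>For fixed arguments all slices change in the same direction and their changes add up to at
  most the change of \<open>\<bar>u\<bar>\<close>; hence their squares are summable too.\<close>

lemma suminf_osc_slice_le:
  fixes u :: "'a::euclidean_space \<Rightarrow> real"
  assumes [measurable]: "u \<in> borel_measurable borel" and a: "a > 0"
  shows "(\<Sum>i. osc r (\<lambda>x. slice a i \<bar>u x\<bar>)) \<le> osc r u"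
proof -
  have p: "(\<Sum>i. ennreal ((slice a i \<bar>s\<bar> - slice a i \<bar>t\<bar>)\<^sup>2)) \<le> ennreal ((s - t)\<^sup>2)" for s t
  proof (rule suminf_le_const)
    fix n
    have "(\<Sum>i<n. ennreal ((slice a i \<bar>s\<bar> - slice a i \<bar>t\<bar>)\<^sup>2)) = ennreal (\<Sum>i<n. (slice a i \<bar>s\<bar> - slice a i \<bar>t\<bar>)\<^sup>2)"
      by (rule sum_ennreal) auto
    also have "\<dots> \<le> ennreal ((\<bar>s\<bar> - \<bar>t\<bar>)\<^sup>2)" by (intro ennreal_leI slice_sum_squares a)
    also have "\<dots> \<le> ennreal ((s - t)\<^sup>2)"
      by (intro ennreal_leI) (simp flip: abs_le_square_iff)
    finally show "(\<Sum>i<n. ennreal ((slice a i \<bar>s\<bar> - slice a i \<bar>t\<bar>)\<^sup>2)) \<le> ennreal ((s - t)\<^sup>2)" .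
  qed auto
  have q: "(\<Sum>i. incr (\<lambda>x. slice a i \<bar>u x\<bar>) y) \<le> incr u y" for y
  proof -
    have "(\<Sum>i. incr (\<lambda>x. slice a i \<bar>u x\<bar>) y) =
        (\<integral>\<^sup>+x. (\<Sum>i. ennreal ((slice a i \<bar>u (x + y)\<bar> - slice a i \<bar>u x\<bar>)\<^sup>2)) \<partial>lborel)"
      unfolding incr_def by (rule nn_integral_suminf[symmetric]) measurable
    also have "\<dots> \<le> incr u y" unfolding incr_def by (intro nn_integral_mono p)
    finally show ?thesis .
  qed
  have "(\<Sum>i. osc r (\<lambda>x. slice a i \<bar>u x\<bar>)) =
      ennreal (1 / r\<^sup>2) * (\<Sum>i. \<integral>\<^sup>+h. indicator big_cube h * incr (\<lambda>x. slice a i \<bar>u x\<bar>) (r *\<^sub>R h) \<partial>lborel)"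
    by (simp add: osc_def)
  also have "(\<Sum>i. \<integral>\<^sup>+h. indicator big_cube h * incr (\<lambda>x. slice a i \<bar>u x\<bar>) (r *\<^sub>R h) \<partial>lborel) =
      (\<integral>\<^sup>+h. (\<Sum>i. indicator big_cube h * incr (\<lambda>x. slice a i \<bar>u x\<bar>) (r *\<^sub>R h)) \<partial>lborel)"
    by (rule nn_integral_suminf[symmetric]) measurable
  also have "ennreal (1 / r\<^sup>2) * \<dots> \<le> osc r u"
    unfolding osc_def using q by (intro mult_left_mono nn_integral_mono) (auto simp: ennreal_suminf_cmult intro: mult_left_mono)
  finally show ?thesis .
qed

lemma norm_unit_cube: "y \<in> unit_cube \<Longrightarrow> norm (y::'a::euclidean_space) \<le> real DIM('a)"
proof -
  assume "y \<in> unit_cube"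
  then have "\<bar>y \<bullet> j\<bar> \<le> 1" if "j \<in> Basis" for j using that by (auto simp: mem_box abs_le_iff intro: order_trans[of _ 0])
  then have "(\<Sum>j\<in>Basis. \<bar>y \<bullet> j\<bar>) \<le> (\<Sum>j\<in>(Basis::'a set). 1)" by (rule sum_mono)
  with norm_le_l1[of y] show ?thesis by simp
qed

text \<open>If \<open>h\<^sub>u(\<rho>)\<close> grows at most like \<open>\<rho>\<^sup>\<theta>\<close> with \<open>\<theta>\<close> less than the dimension, then averages of a function
  dominated by \<open>\<bar>u\<bar>\<^sup>p\<close> over large cubes vanish in the limit.\<close>

lemma cube_average_tendsto_0:
  fixes u w :: "'a::euclidean_space \<Rightarrow> real"
  assumes [measurable]: "u \<in> borel_measurable borel" "w \<in> borel_measurable borel"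
    and wb: "\<And>x. \<bar>w x\<bar> \<le> c * \<bar>u x\<bar> powr p" "\<And>x. \<bar>w x\<bar> \<le> M" and c: "c \<ge> 0"
    and h: "\<And>\<rho>. \<rho> > 0 \<Longrightarrow> h_fun p u \<rho> \<le> ennreal (K * \<rho> powr \<theta>)" and K: "K \<ge> 0"
    and \<theta>: "0 \<le> \<theta>" "\<theta> < real DIM('a)" and r: "r > 0"
  shows "(\<lambda>m. cube_average (2 ^ m * r) w x) \<longlonglongrightarrow> 0"
proof -
  let ?N = "real DIM('a)"
  define L where "L = norm x + ?N + 1"
  have L: "L > 0" unfolding L_def by (intro add_nonneg_pos add_nonneg_nonneg) auto
  have bound: "\<bar>cube_average R w x\<bar> \<le> c * K * L powr \<theta> * R powr (\<theta> - ?N)" if R: "R \<ge> 1" for R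
  proof -
    let ?b = "norm x + R * ?N + 1"
    have b0: "?b > 0" using R by (intro add_nonneg_pos add_nonneg_nonneg) auto
    have [measurable]: "ball (0::'a) ?b \<in> sets borel" by simp
    have i: "integrable lborel (\<lambda>y. indicator unit_cube y * w (x + R *\<^sub>R y))"
      by (rule integrable_unit_cube[OF _ wb(2)]) measurable
    have "ennreal \<bar>cube_average R w x\<bar> \<le> (\<integral>\<^sup>+y. ennreal \<bar>indicator unit_cube y * w (x + R *\<^sub>R y)\<bar> \<partial>lborel)"
      unfolding cube_average_def using integral_norm_bound_ennreal[OF i] by simp
    also have "\<dots> \<le> (\<integral>\<^sup>+y. ennreal c * (ennreal (\<bar>u (x + R *\<^sub>R y)\<bar> powr p) * indicator (ball 0 ?b) (x + R *\<^sub>R y)) \<partial>lborel)"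
    proof (rule nn_integral_mono)
      fix y :: 'a
      show "ennreal \<bar>indicator unit_cube y * w (x + R *\<^sub>R y)\<bar> \<le> ennreal c * (ennreal (\<bar>u (x + R *\<^sub>R y)\<bar> powr p) * indicator (ball 0 ?b) (x + R *\<^sub>R y))"
      proof (cases "y \<in> unit_cube")
        case True
        have "norm (R *\<^sub>R y) \<le> R * ?N" using norm_unit_cube[OF True] R by (simp add: mult_left_mono)
        then have "norm (x + R *\<^sub>R y) < ?b" using norm_triangle_ineq[of x "R *\<^sub>R y"] by linarith
        then show ?thesis using True wb(1)[of "x + R *\<^sub>R y"] c
          by (simp flip: ennreal_mult)
      qed simp
    qed
    also have "\<dots> = ennreal (1 / R ^ DIM('a)) * (\<integral>\<^sup>+z. ennreal c * (ennreal (\<bar>u z\<bar> powr p) * indicator (ball 0 ?b) z) \<partial>lborel)"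
      by (rule nn_integral_lborel_affine) (measurable, use R in simp)
    also have "(\<integral>\<^sup>+z. ennreal c * (ennreal (\<bar>u z\<bar> powr p) * indicator (ball 0 ?b) z) \<partial>lborel) = ennreal c * h_fun p u ?b"
      by (simp add: h_fun_def nn_integral_cmult nn_integral_completion)
    also have "ennreal (1 / R ^ DIM('a)) * (ennreal c * h_fun p u ?b) \<le> ennreal (1 / R ^ DIM('a)) * (ennreal c * ennreal (K * ?b powr \<theta>))"
      by (intro mult_left_mono h b0) auto
    also have "ennreal c * ennreal (K * ?b powr \<theta>) = ennreal (c * (K * ?b powr \<theta>))"
      using c K by (intro ennreal_mult[symmetric]) auto
    also have "ennreal (1 / R ^ DIM('a)) * \<dots> = ennreal (1 / R ^ DIM('a) * (c * (K * ?b powr \<theta>)))"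
      using R c K by (intro ennreal_mult[symmetric]) auto
    finally have "\<bar>cube_average R w x\<bar> \<le> 1 / R ^ DIM('a) * (c * (K * ?b powr \<theta>))"
      using R c K by (subst (asm) ennreal_le_iff) auto
    also have "\<dots> \<le> 1 / R ^ DIM('a) * (c * (K * (L * R) powr \<theta>))"
    proof -
      have "norm x * 1 \<le> norm x * R" using R by (intro mult_left_mono) auto
      then have "?b \<le> L * R" using R by (simp add: L_def algebra_simps)
      then have "?b powr \<theta> \<le> (L * R) powr \<theta>" using b0 \<theta> by (intro powr_mono2) auto
      then show ?thesis using R c K by (intro mult_left_mono) auto
    qed
    also have "\<dots> = c * K * L powr \<theta> * R powr (\<theta> - ?N)"
      using R L by (simp add: powr_mult powr_diff powr_realpow)
    finally show ?thesis .
  qed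
  have top: "filterlim (\<lambda>m. 2 ^ m * r) at_top sequentially"
  proof -
    have "filterlim (\<lambda>m. 2 ^ m :: real) at_top sequentially"
      by (rule filterlim_at_top_mono[OF filterlim_real_sequentially])
         (auto intro: less_imp_le of_nat_less_two_power)
    then have "filterlim (\<lambda>m. r * 2 ^ m) at_top sequentially"
      by (rule filterlim_tendsto_pos_mult_at_top[OF tendsto_const r])
    then show ?thesis by (simp add: mult.commute)
  qed
  have "(\<lambda>m. c * K * L powr \<theta> * (2 ^ m * r) powr (\<theta> - ?N)) \<longlonglongrightarrow> c * K * L powr \<theta> * 0"
    using \<theta> by (intro tendsto_intros tendsto_neg_powr top) auto
  then have "(\<lambda>m. c * K * L powr \<theta> * (2 ^ m * r) powr (\<theta> - ?N)) \<longlonglongrightarrow> 0" by simp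
  then show ?thesis
  proof (rule Lim_null_comparison[rotated])
    show "\<forall>\<^sub>F m in sequentially. norm (cube_average (2 ^ m * r) w x) \<le> c * K * L powr \<theta> * (2 ^ m * r) powr (\<theta> - ?N)"
      using filterlim_at_top[THEN iffD1, OF top, rule_format, of 1]
      by eventually_elim (use bound in simp)
  qed
qed

lemma slice_le_powr:
  assumes a: "a > 0" and p: "p > 0" and s: "s \<ge> 0"
  shows "\<bar>slice a i s\<bar> \<le> a * 2 ^ i / (a * 2 ^ i) powr p * s powr p"
proof (cases "s \<le> a * 2 ^ i")
  case True
  moreover have "a * 2 ^ i > 0" "a * 2 ^ Suc i = 2 * (a * 2 ^ i)" using a by auto
  ultimately have "slice a i s = 0" unfolding slice_def by (auto simp: min_def)
  then show ?thesis using a s by simp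
next
  case False
  have b: "a * 2 ^ i > 0" using a by simp
  have "(a * 2 ^ i) powr p \<le> s powr p" using False b p by (intro powr_mono2) auto
  then have "a * 2 ^ i * 1 \<le> a * 2 ^ i * (s powr p / (a * 2 ^ i) powr p)"
    using a b by (intro mult_left_mono) (auto simp: pos_le_divide_eq)
  then show ?thesis using slice_bounds[OF a, of i s] by simp
qed

text \<open>With \<open>\<kappa> = 2/(N - 2)\<close> the critical exponent is \<open>2\<^sup>* = 2 (1 + \<kappa>)\<close>. The first factor
  arises because \<open>\<bar>u\<bar>\<close> is at most four times the base level of the slice, the second is the constant
  of \<open>weak_type\<close>, and the third bounds the sum of the \<open>osc\<close> of the slices.\<close>

definition sobolev_const :: "nat \<Rightarrow> real" where
  "sobolev_const N = (let \<kappa> = 2 / (real N - 2) in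
     4 powr (2 * (1 + \<kappa>)) * (16 * 64 powr \<kappa>) * osc_const N powr (1 + \<kappa>))"

text \<open>The weak type estimate for the \<open>i\<close>-th slice bounds the measure of the set where
  \<open>\<bar>u\<bar> \<ge> a 2\<^bsup>i+1\<^esup>\<close> by a multiple of the power \<open>1 + \<kappa>\<close> of \<open>E i\<close>, the supremum of \<open>osc\<close> of
  that slice over all dyadic scales. These suprema add up to at most a constant times \<open>G\<close>, and
  \<open>1 + \<kappa> \<ge> 1\<close>, so the sum over the slices converges. The bound does not depend on the lowest
  level \<open>a\<close>.\<close>

lemma sobolev_level:
  fixes u :: "'a::euclidean_space \<Rightarrow> real"
  assumes N: "DIM('a) \<ge> 3" and w: "has_weak_gradient u g"
    and [measurable]: "u \<in> borel_measurable borel" "g \<in> borel_measurable borel"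
    and G: "(\<integral>\<^sup>+x. ennreal ((norm (g x))\<^sup>2) \<partial>lborel) \<le> ennreal G" "G \<ge> 0"
    and h: "\<And>\<rho>. \<rho> > 0 \<Longrightarrow> h_fun p u \<rho> \<le> ennreal (K * \<rho> powr \<theta>)" and K: "K \<ge> 0"
    and \<theta>: "0 \<le> \<theta>" "\<theta> < real DIM('a)" and p: "p > 0" and a: "a > 0"
  defines "\<kappa> \<equiv> 2 / (real DIM('a) - 2)"
  shows "(\<integral>\<^sup>+x. ennreal (\<bar>u x\<bar> powr (2 * (1 + \<kappa>))) * indicator {x. \<bar>u x\<bar> \<ge> 2 * a} x \<partial>lborel)
      \<le> ennreal (sobolev_const DIM('a) * G powr (1 + \<kappa>))"
proof -
  define s where "s = 2 * (1 + \<kappa>)"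
  define w where "w i x = slice a i \<bar>u x\<bar>" for i x
  define E where "E i = (SUP n. osc (1 / 2 ^ n) (w i))" for i
  define S where "S = osc_const DIM('a) * G"
  have [measurable]: "w i \<in> borel_measurable borel" for i unfolding w_def by measurable
  have N2: "real DIM('a) - 2 > 0" using N by linarith
  have \<kappa>: "\<kappa> > 0" unfolding \<kappa>_def using N2 by simp
  have s0: "s > 0" using \<kappa> by (simp add: s_def)
  have S0: "S \<ge> 0" using G by (simp add: S_def osc_const_def)
  have "(\<Sum>i. E i) = (SUP n. \<Sum>i. osc (1 / 2 ^ n) (w i))"
    unfolding E_def
  proof (rule ennreal_suminf_SUP_eq)
    fix i
    have "osc (1 / 2 ^ n) (w i) \<le> osc (1 / 2 ^ Suc n) (w i)" for n
      using osc_double[of "w i" "1 / 2 ^ Suc n"] by simp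
    then show "incseq (\<lambda>n. osc (1 / 2 ^ n) (w i))" by (rule incseq_SucI)
  qed
  also have "\<dots> \<le> ennreal S"
  proof (rule SUP_least)
    fix n
    have "(\<Sum>i. osc (1 / 2 ^ n) (w i)) \<le> osc (1 / 2 ^ n) u"
      unfolding w_def by (rule suminf_osc_slice_le) (use a in auto)
    also have "\<dots> \<le> ennreal S"
      unfolding S_def by (rule osc_le_gradient[OF \<open>has_weak_gradient u g\<close>]) (use G in auto)
    finally show "(\<Sum>i. osc (1 / 2 ^ n) (w i)) \<le> ennreal S" .
  qed
  finally have sumE: "(\<Sum>i. E i) \<le> ennreal S" .
  have ES: "E i \<le> ennreal S" for i
    using sum_le_suminf[of E "{i}"] sumE by auto
  define e where "e i = enn2real (E i)" for i
  have e: "E i = ennreal (e i)" "0 \<le> e i" "e i \<le> S" for i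
  proof -
    show "E i = ennreal (e i)"
      unfolding e_def using ES[of i] by (metis ennreal_enn2real ennreal_less_top le_less_trans)
    show "0 \<le> e i" by (simp add: e_def)
    show "e i \<le> S" unfolding e_def by (rule enn2real_leI[OF S0 ES])
  qed
  have level: "emeasure lborel {x. \<bar>u x\<bar> \<ge> a * 2 ^ Suc i} \<le>
      ennreal (16 * 64 powr \<kappa> * (e i / (a * 2 ^ i)\<^sup>2) powr (1 + \<kappa>))" for i
  proof -
    have "emeasure lborel {x. \<bar>u x\<bar> \<ge> a * 2 ^ Suc i} \<le> emeasure lborel {x. \<bar>w i x\<bar> \<ge> a * 2 ^ i}"
      by (rule emeasure_mono) (auto simp: w_def slice_def min_def)
    also have "\<dots> \<le> ennreal (16 * 64 powr \<kappa> * (e i / (a * 2 ^ i)\<^sup>2) powr (1 + \<kappa>))"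
      unfolding \<kappa>_def
    proof (rule weak_type[OF N, where M = "a * 2 ^ i"])
      show b: "\<bar>w i x\<bar> \<le> a * 2 ^ i" for x using slice_bounds[OF a, of i "\<bar>u x\<bar>"] by (simp add: w_def)
      show "osc r (w i) \<le> ennreal (e i)" if "dyadic r" for r
        using osc_dyadic_le[OF _ that, of "w i"] e(1)[of i] by (simp add: E_def)
      show "(\<lambda>m. cube_average (2 ^ m * r) (w i) x) \<longlonglongrightarrow> 0" if "r > 0" for r x
      proof (rule cube_average_tendsto_0[where u = u and M = "a * 2 ^ i" and K = K and \<theta> = \<theta> and p = p
            and c = "a * 2 ^ i / (a * 2 ^ i) powr p"])
        show "\<bar>w i x\<bar> \<le> a * 2 ^ i / (a * 2 ^ i) powr p * \<bar>u x\<bar> powr p" for x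
          unfolding w_def by (rule slice_le_powr[OF a p]) simp
      qed (use b h K \<theta> that a in auto)
    qed (use e a in auto)
    finally show ?thesis .
  qed
  have pw: "ennreal (\<bar>u x\<bar> powr s) * indicator {x. \<bar>u x\<bar> \<ge> 2 * a} x \<le>
      (\<Sum>i. ennreal ((a * 2 ^ (i + 2)) powr s) * indicator {x. \<bar>u x\<bar> \<ge> a * 2 ^ Suc i} x)" (is "_ \<le> (\<Sum>i. ?f i)") for x
  proof (cases "\<bar>u x\<bar> \<ge> 2 * a")
    case True
    obtain n where n: "\<bar>u x\<bar> / a < 2 ^ n" using real_arch_pow[of 2] by auto
    define i where "i = (LEAST n. \<bar>u x\<bar> < a * 2 ^ (n + 2))"
    have ex: "\<bar>u x\<bar> < a * 2 ^ (n + 2)"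
    proof -
      have "\<bar>u x\<bar> < a * 2 ^ n" using n a by (simp add: pos_divide_less_eq mult.commute)
      also have "\<dots> \<le> a * 2 ^ (n + 2)" using a by (intro mult_left_mono power_increasing) auto
      finally show ?thesis .
    qed
    have i1: "\<bar>u x\<bar> < a * 2 ^ (i + 2)" unfolding i_def by (rule LeastI) (rule ex)
    have i2: "\<bar>u x\<bar> \<ge> a * 2 ^ Suc i"
    proof (cases i)
      case 0
      then show ?thesis using True by simp
    next
      case (Suc k)
      then have "\<not> \<bar>u x\<bar> < a * 2 ^ (k + 2)" using not_less_Least[of k "\<lambda>n. \<bar>u x\<bar> < a * 2 ^ (n + 2)"] by (simp add: i_def)
      then show ?thesis using Suc by simp
    qed
    have "ennreal (\<bar>u x\<bar> powr s) \<le> ennreal ((a * 2 ^ (i + 2)) powr s)"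
      using i1 s0 by (intro ennreal_leI powr_mono2) auto
    also have "\<dots> = sum ?f {i}" using i2 by simp
    also have "\<dots> \<le> (\<Sum>i. ?f i)" by (rule sum_le_suminf) auto
    finally show ?thesis by (simp add: indicator_def)
  qed simp
  let ?c = "4 powr s * (16 * 64 powr \<kappa>)"
  have "(\<integral>\<^sup>+x. ennreal (\<bar>u x\<bar> powr s) * indicator {x. \<bar>u x\<bar> \<ge> 2 * a} x \<partial>lborel) \<le>
      (\<integral>\<^sup>+x. (\<Sum>i. ennreal ((a * 2 ^ (i + 2)) powr s) * indicator {x. \<bar>u x\<bar> \<ge> a * 2 ^ Suc i} x) \<partial>lborel)"
    by (intro nn_integral_mono pw)
  also have "\<dots> = (\<Sum>i. ennreal ((a * 2 ^ (i + 2)) powr s) * emeasure lborel {x. \<bar>u x\<bar> \<ge> a * 2 ^ Suc i})"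
    by (subst nn_integral_suminf) (auto simp: nn_integral_cmult_indicator)
  also have "\<dots> \<le> (\<Sum>i. ennreal (?c * S powr \<kappa>) * E i)"
  proof (rule suminf_le)
    fix i
    let ?b = "a * 2 ^ i"
    have b: "?b > 0" using a by simp
    have "ennreal ((a * 2 ^ (i + 2)) powr s) * emeasure lborel {x. \<bar>u x\<bar> \<ge> a * 2 ^ Suc i} \<le>
      ennreal ((a * 2 ^ (i + 2)) powr s) * ennreal (16 * 64 powr \<kappa> * (e i / ?b\<^sup>2) powr (1 + \<kappa>))"
      by (intro mult_left_mono level) auto
    also have "\<dots> = ennreal ((a * 2 ^ (i + 2)) powr s * (16 * 64 powr \<kappa> * (e i / ?b\<^sup>2) powr (1 + \<kappa>)))"
      by (simp add: ennreal_mult)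
    also have "(a * 2 ^ (i + 2)) powr s * (16 * 64 powr \<kappa> * (e i / ?b\<^sup>2) powr (1 + \<kappa>)) = ?c * e i powr (1 + \<kappa>)"
    proof -
      have 1: "(a * 2 ^ (i + 2)) powr s = 4 powr s * ?b powr s"
        using b by (simp add: mult_ac flip: powr_mult)
      have 2: "(?b\<^sup>2) powr (1 + \<kappa>) = ?b powr s"
        using b by (simp add: s_def powr_powr flip: powr_numeral)
      have 3: "(e i / ?b\<^sup>2) powr (1 + \<kappa>) = e i powr (1 + \<kappa>) / ?b powr s"
        using e(2) b by (subst powr_divide) (auto simp: 2)
      show ?thesis unfolding 1 3 using a by simp
    qed
    also have "ennreal (?c * e i powr (1 + \<kappa>)) \<le> ennreal (?c * S powr \<kappa> * e i)"
    proof (rule ennreal_leI)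
      have "e i powr (1 + \<kappa>) = e i powr \<kappa> * e i" using e(2)[of i] by (cases "e i = 0") (auto simp: powr_add)
      also have "\<dots> \<le> S powr \<kappa> * e i" using e \<kappa> by (intro mult_right_mono powr_mono2) auto
      finally show "?c * e i powr (1 + \<kappa>) \<le> ?c * S powr \<kappa> * e i" by (simp add: mult.assoc)
    qed
    also have "\<dots> = ennreal (?c * S powr \<kappa>) * E i" using e by (simp add: ennreal_mult)
    finally show "ennreal ((a * 2 ^ (i + 2)) powr s) * emeasure lborel {x. \<bar>u x\<bar> \<ge> a * 2 ^ Suc i} \<le> ennreal (?c * S powr \<kappa>) * E i" .
  qed auto
  also have "\<dots> = ennreal (?c * S powr \<kappa>) * (\<Sum>i. E i)" by (rule ennreal_suminf_cmult)
  also have "\<dots> \<le> ennreal (?c * S powr \<kappa>) * ennreal S" by (intro mult_left_mono sumE) auto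
  also have "\<dots> = ennreal (?c * S powr \<kappa> * S)"
    using S0 by (intro ennreal_mult[symmetric]) auto
  also have "?c * S powr \<kappa> * S = ?c * (S powr (1 + \<kappa>))"
  proof -
    have "S powr (1 + \<kappa>) = S powr \<kappa> * S" using S0 by (cases "S = 0") (auto simp: powr_add)
    then show ?thesis by (simp only: mult.assoc)
  qed
  also have "S powr (1 + \<kappa>) = osc_const DIM('a) powr (1 + \<kappa>) * G powr (1 + \<kappa>)"
    unfolding S_def by (rule powr_mult)
  also have "?c * \<dots> = sobolev_const DIM('a) * G powr (1 + \<kappa>)"
    unfolding sobolev_const_def s_def \<kappa>_def Let_def by (simp only: mult.assoc)
  finally show ?thesis unfolding s_def .
qed

lemma sobolev:
  fixes u :: "'a::euclidean_space \<Rightarrow> real"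
  assumes N: "DIM('a) \<ge> 3" and w: "has_weak_gradient u g"
    and [measurable]: "u \<in> borel_measurable borel" "g \<in> borel_measurable borel"
    and G: "(\<integral>\<^sup>+x. ennreal ((norm (g x))\<^sup>2) \<partial>lborel) \<le> ennreal G" "G \<ge> 0"
    and h: "\<And>\<rho>. \<rho> > 0 \<Longrightarrow> h_fun p u \<rho> \<le> ennreal (K * \<rho> powr \<theta>)" and K: "K \<ge> 0"
    and \<theta>: "0 \<le> \<theta>" "\<theta> < real DIM('a)" and p: "p > 0"
  defines "s \<equiv> two_star DIM('a)"
  shows "(\<integral>\<^sup>+x. ennreal (\<bar>u x\<bar> powr s) \<partial>lborel) \<le> ennreal (sobolev_const DIM('a) * G powr (s / 2))"
proof -
  have N2: "real DIM('a) - 2 > 0" using N by linarith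
  have s: "s = 2 * (1 + 2 / (real DIM('a) - 2))" using N2 by (simp add: s_def two_star_def field_simps)
  have s2: "s / 2 = 1 + 2 / (real DIM('a) - 2)" by (simp add: s)
  \<comment> \<open>Let the lowest level \<open>a = 2\<^bsup>-n\<^esup>\<close> of \<open>sobolev_level\<close> tend to zero.\<close>
  let ?f = "\<lambda>n x. ennreal (\<bar>u x\<bar> powr s) * indicator {x. \<bar>u x\<bar> \<ge> 2 * (1 / 2 ^ n)} x"
  have "ennreal (\<bar>u x\<bar> powr s) = (SUP n. ?f n x)" for x
  proof (rule antisym)
    show "ennreal (\<bar>u x\<bar> powr s) \<le> (SUP n. ?f n x)"
    proof (cases "u x = 0")
      case False
      then obtain n where "(1 / 2) ^ n < \<bar>u x\<bar> / 2" using real_arch_pow_inv[of "\<bar>u x\<bar> / 2" "1 / 2"] by auto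
      then have "\<bar>u x\<bar> \<ge> 2 * (1 / 2 ^ n)" by (simp add: power_one_over)
      then have "ennreal (\<bar>u x\<bar> powr s) \<le> ?f n x" by simp
      then show ?thesis by (rule order_trans) (rule SUP_upper, simp)
    qed simp
    show "(SUP n. ?f n x) \<le> ennreal (\<bar>u x\<bar> powr s)"
      by (rule SUP_least) (auto simp: indicator_def)
  qed
  then have "(\<integral>\<^sup>+x. ennreal (\<bar>u x\<bar> powr s) \<partial>lborel) = (\<integral>\<^sup>+x. (SUP n. ?f n x) \<partial>lborel)" by simp
  also have "\<dots> = (SUP n. \<integral>\<^sup>+x. ?f n x \<partial>lborel)"
  proof (rule nn_integral_monotone_convergence_SUP)
    show "incseq ?f"
    proof (rule incseq_SucI, rule le_funI)
      fix n x
      have "2 * (1 / 2 ^ Suc n) \<le> 2 * (1 / 2 ^ n :: real)" by (simp add: field_simps)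
      then show "?f n x \<le> ?f (Suc n) x" by (auto simp: indicator_def simp del: power_Suc)
    qed
  qed measurable
  also have "\<dots> \<le> ennreal (sobolev_const DIM('a) * G powr (s / 2))"
  proof (rule SUP_least)
    fix n
    show "(\<integral>\<^sup>+x. ?f n x \<partial>lborel) \<le> ennreal (sobolev_const DIM('a) * G powr (s / 2))"
      using sobolev_level[OF N w assms(3,4) G h K \<theta> p, of "1 / 2 ^ n"] unfolding s2 unfolding s by simp
  qed
  finally show ?thesis .
qed

section \<open>The continuous embedding\<close>

lemma ennpow_ennreal: "x \<ge> 0 \<Longrightarrow> ennpow (ennreal x) a = ennreal (x powr a)"
  by (simp add: ennpow_def)

lemma ennpow_mono:
  assumes "x \<le> y" "a \<ge> 0"
  shows "ennpow x a \<le> ennpow y a"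
proof (cases "y = \<infinity>")
  case True
  then show ?thesis by (simp add: ennpow_def)
next
  case False
  with assms(1) have "x \<noteq> \<infinity>" by (auto simp: top_unique)
  with False assms show ?thesis
    by (auto simp: ennpow_def less_top intro!: ennreal_leI powr_mono2 enn2real_mono)
qed

lemma ennpow_ennpow: "a * c = 1 \<Longrightarrow> ennpow (ennpow x a) c = x"
  by (cases x) (auto simp: ennpow_def powr_powr)

lemma ennpow_less_top: "ennpow x a < top \<longleftrightarrow> x < top"
  by (simp add: ennpow_def less_top)

lemma Lnorm_2: "Lnorm 2 f = ennpow (\<integral>\<^sup>+x. ennreal ((norm (f x))\<^sup>2) \<partial>lebesgue) (1 / 2)"
proof -
  have "(2::ennreal) \<noteq> \<infinity>" by simp
  then show ?thesis by (simp add: Lnorm_def)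
qed

lemma nn_integral_lebesgue_cong:
  assumes "AE x in lebesgue. f x = f' x" "f' \<in> borel_measurable borel"
  shows "(\<integral>\<^sup>+x. f x \<partial>lebesgue) = (\<integral>\<^sup>+x. f' x \<partial>lborel)"
  using nn_integral_cong_AE[OF assms(1)] assms(2) by (simp add: nn_integral_completion)

lemma h_fun_mono: "\<rho> \<le> \<sigma> \<Longrightarrow> h_fun p u \<rho> \<le> h_fun p u \<sigma>"
  unfolding h_fun_def by (intro nn_integral_mono) (auto simp: indicator_def)

text \<open>Since \<open>h\<^sub>u\<close> is increasing, its value at \<open>\<rho>\<close> is controlled by the part of the defining integral
  between \<open>\<rho>\<close> and \<open>2 \<rho>\<close>.\<close>

lemma h_fun_growth:
  assumes fin: "Lpqb_norm p q b u < \<infinity>" and pq: "p > 0" "q > 0"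
  obtains K where "K \<ge> 0" "\<And>\<rho>. \<rho> > 0 \<Longrightarrow> h_fun p u \<rho> \<le> ennreal (K * \<rho> powr ((b - 1) / q))"
proof -
  define I where "I = (\<integral>\<^sup>+\<rho>\<in>{0<..}. ennreal (\<rho> powr (- b)) * ennpow (h_fun p u \<rho>) q \<partial>lborel)"
  have "I < top" using fin by (simp add: Lpqb_norm_def I_def ennpow_less_top)
  then obtain J where J: "I = ennreal J" "J \<ge> 0" by (cases I) auto
  define K where "K = (J * 2 powr \<bar>b\<bar>) powr (1 / q)"
  have "h_fun p u \<rho> \<le> ennreal (K * \<rho> powr ((b - 1) / q))" if \<rho>: "\<rho> > 0" for \<rho>
  proof -
    let ?c = "\<rho> powr (- b) * 2 powr (- \<bar>b\<bar>)"
    have c: "?c > 0" using \<rho> by simp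
    have "ennreal (?c * \<rho>) * ennpow (h_fun p u \<rho>) q = (\<integral>\<^sup>+\<sigma>. (ennreal ?c * ennpow (h_fun p u \<rho>) q) * indicator {\<rho>..2 * \<rho>} \<sigma> \<partial>lborel)"
    proof -
      have "(\<integral>\<^sup>+\<sigma>. (ennreal ?c * ennpow (h_fun p u \<rho>) q) * indicator {\<rho>..2 * \<rho>} \<sigma> \<partial>lborel) = (ennreal ?c * ennpow (h_fun p u \<rho>) q) * ennreal \<rho>"
        using \<rho> by (subst nn_integral_cmult_indicator) auto
      also have "\<dots> = (ennreal ?c * ennreal \<rho>) * ennpow (h_fun p u \<rho>) q" by (simp only: mult_ac)
      also have "ennreal ?c * ennreal \<rho> = ennreal (?c * \<rho>)"
        using \<rho> by (intro ennreal_mult[symmetric]) auto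
      finally show ?thesis by simp
    qed
    also have "\<dots> \<le> I"
      unfolding I_def
    proof (rule nn_integral_mono)
      fix \<sigma> :: real
      show "(ennreal ?c * ennpow (h_fun p u \<rho>) q) * indicator {\<rho>..2 * \<rho>} \<sigma> \<le> (ennreal (\<sigma> powr (- b)) * ennpow (h_fun p u \<sigma>) q) * indicator {0<..} \<sigma>"
      proof (cases "\<sigma> \<in> {\<rho>..2 * \<rho>}")
        case True
        define t where "t = \<sigma> / \<rho>"
        have t: "1 \<le> t" "t \<le> 2" "\<sigma> = \<rho> * t" using True \<rho> by (auto simp: t_def field_simps)
        have "2 powr (- \<bar>b\<bar>) \<le> t powr (- \<bar>b\<bar>)" using t by (intro powr_mono2') auto
        also have "\<dots> \<le> t powr (- b)" using t by (intro powr_mono) auto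
        finally have "?c \<le> \<sigma> powr (- b)" using \<rho> t by (simp add: powr_mult)
        then have "ennreal ?c * ennpow (h_fun p u \<rho>) q \<le> ennreal (\<sigma> powr (- b)) * ennpow (h_fun p u \<sigma>) q"
          using True pq by (intro mult_mono ennreal_leI ennpow_mono h_fun_mono) auto
        then show ?thesis using True \<rho> by simp
      qed simp
    qed
    finally have le: "ennreal (?c * \<rho>) * ennpow (h_fun p u \<rho>) q \<le> ennreal J" by (simp add: J)
    have c\<rho>: "?c * \<rho> > 0" using c \<rho> by simp
    have "h_fun p u \<rho> \<noteq> \<infinity>"
    proof
      assume "h_fun p u \<rho> = \<infinity>"
      then have "ennpow (h_fun p u \<rho>) q = \<infinity>" by (simp add: ennpow_def)
      moreover have "ennreal d * top = top" if "d > 0" for d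
        using that by (simp add: ennreal_mult_eq_top_iff)
      from this[OF c\<rho>] have "ennreal (?c * \<rho>) * top = top" .
      ultimately show False using le by (simp only: infinity_ennreal_def) (simp add: top_unique)
    qed
    then obtain \<eta> where \<eta>: "h_fun p u \<rho> = ennreal \<eta>" "\<eta> \<ge> 0" by (cases "h_fun p u \<rho>") auto
    have "ennreal (?c * \<rho> * \<eta> powr q) = ennreal (?c * \<rho>) * ennreal (\<eta> powr q)"
      using c\<rho> by (intro ennreal_mult) auto
    also have "\<dots> \<le> ennreal J" using le \<eta> by (simp add: ennpow_ennreal)
    finally have "?c * \<rho> * \<eta> powr q \<le> J" using J by (simp only: ennreal_le_iff)
    then have "\<eta> powr q \<le> J / (?c * \<rho>)" using c\<rho> by (simp only: pos_le_divide_eq mult.commute)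
    also have "\<dots> = (J * 2 powr \<bar>b\<bar>) * \<rho> powr (b - 1)"
      using \<rho> by (simp add: powr_minus powr_diff field_simps)
    finally have "(\<eta> powr q) powr (1 / q) \<le> ((J * 2 powr \<bar>b\<bar>) * \<rho> powr (b - 1)) powr (1 / q)"
      using pq by (intro powr_mono2) auto
    also have "\<dots> = K * \<rho> powr ((b - 1) / q)"
      unfolding K_def by (simp add: powr_mult powr_powr)
    also have "(\<eta> powr q) powr (1 / q) = \<eta>" using \<eta> pq by (simp add: powr_powr)
    finally show ?thesis unfolding \<eta>(1) by (rule ennreal_leI)
  qed
  then show ?thesis by (intro that[of K]) (auto simp: K_def)
qed

lemma Lnorm_weak_gradient_le_E_norm:
  assumes "p > 0" "q > 0"
  shows "Lnorm 2 (weak_gradient u) \<le> E_norm p q b u"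
proof -
  have "Lnorm 2 (weak_gradient u) = ennpow (ennpow (Lnorm 2 (weak_gradient u)) (2 * p * q)) (1 / (2 * p * q))"
    using assms by (intro ennpow_ennpow[symmetric]) simp
  also have "\<dots> \<le> E_norm p q b u"
    unfolding E_norm_def using assms by (intro ennpow_mono) auto
  finally show ?thesis .
qed

lemma continuously_embedded_two_star:
  fixes p q b :: real
  assumes N: "DIM('a::euclidean_space) \<ge> 3" and p: "p > 0" and q: "q > 0" and b: "1 < b" "b < 1 + real DIM('a) * q"
  shows "continuously_embedded (E_space p q b :: ('a \<Rightarrow> real) set) (E_norm p q b) (ennreal (two_star DIM('a)))"
proof -
  define s where "s = two_star DIM('a)"
  have s: "s > 0" using N by (simp add: s_def two_star_def)
  define C where "C = sobolev_const DIM('a) powr (1 / s)"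
  have bound: "Lnorm (ennreal s) u \<le> ennreal (C + 1) * E_norm p q b u" if u: "u \<in> E_space p q b" for u :: "'a \<Rightarrow> real"
  proof -
    define g where "g = weak_gradient u"
    have w: "has_weak_gradient u g"
    proof -
      obtain g0 where "has_weak_gradient u g0"
        using u by (auto simp: E_space_def weakly_differentiable_def)
      then show ?thesis unfolding g_def weak_gradient_def by (rule someI[of "has_weak_gradient u"])
    qed
    then have l: "loc_integrable u" "loc_integrable g" by (auto simp: has_weak_gradient_def)
    obtain u' where [measurable]: "u' \<in> borel_measurable borel" and u': "AE x in lebesgue. u x = u' x"
      using ex_borel_representative[OF loc_integrable_measurable[OF l(1)]] by metis
    obtain g' where [measurable]: "g' \<in> borel_measurable borel" and g': "AE x in lebesgue. g x = g' x"
      using ex_borel_representative[OF loc_integrable_measurable[OF l(2)]] by metis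
    have w': "has_weak_gradient u' g'"
      by (rule has_weak_gradient_cong_AE[OF w _ _ u' g']) (auto intro: measurable_completion)
    have fin: "Lnorm 2 g < \<infinity>" "Lpqb_norm p q b u < \<infinity>"
      using u by (auto simp: E_space_def g_def)
    have gg': "(\<integral>\<^sup>+x. ennreal ((norm (g x))\<^sup>2) \<partial>lebesgue) = (\<integral>\<^sup>+x. ennreal ((norm (g' x))\<^sup>2) \<partial>lborel)"
      by (rule nn_integral_lebesgue_cong) (use g' in \<open>auto elim: eventually_mono\<close>)
    have "(\<integral>\<^sup>+x. ennreal ((norm (g' x))\<^sup>2) \<partial>lborel) < top"
      using fin(1) by (simp add: Lnorm_2 ennpow_less_top flip: gg')
    then obtain G where G: "G \<ge> 0" "(\<integral>\<^sup>+x. ennreal ((norm (g' x))\<^sup>2) \<partial>lborel) = ennreal G"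
      unfolding less_top_ennreal by blast
    then have G3: "Lnorm 2 g = ennreal (G powr (1 / 2))"
      by (simp add: Lnorm_2 gg' ennpow_ennreal)
    obtain K where K: "K \<ge> 0" "\<And>\<rho>. \<rho> > 0 \<Longrightarrow> h_fun p u \<rho> \<le> ennreal (K * \<rho> powr ((b - 1) / q))"
      using h_fun_growth[OF fin(2) p q] by metis
    have "h_fun p u' \<rho> = h_fun p u \<rho>" for \<rho>
      unfolding h_fun_def by (rule nn_integral_cong_AE) (use u' in \<open>auto elim: eventually_mono\<close>)
    with K(2) have h: "h_fun p u' \<rho> \<le> ennreal (K * \<rho> powr ((b - 1) / q))" if "\<rho> > 0" for \<rho>
      using that by simp
    have "(\<integral>\<^sup>+x. ennreal (\<bar>u' x\<bar> powr s) \<partial>lborel) \<le> ennreal (sobolev_const DIM('a) * G powr (s / 2))"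
      unfolding s_def
      by (rule sobolev[OF N w' _ _ _ G(1) h K(1) _ _ p]) (use b q G(2) in \<open>auto simp: field_simps\<close>)
    moreover have "(\<integral>\<^sup>+x. ennreal (\<bar>u x\<bar> powr s) \<partial>lebesgue) = (\<integral>\<^sup>+x. ennreal (\<bar>u' x\<bar> powr s) \<partial>lborel)"
      by (rule nn_integral_lebesgue_cong) (use u' in \<open>auto elim: eventually_mono\<close>)
    ultimately have "Lnorm (ennreal s) u \<le> ennpow (ennreal (sobolev_const DIM('a) * G powr (s / 2))) (1 / s)"
      using s by (auto simp: Lnorm_def intro: ennpow_mono)
    also have "\<dots> = ennreal (C * G powr (1 / 2))"
      using s by (subst ennpow_ennreal) (auto simp: C_def sobolev_const_def Let_def powr_mult powr_powr)
    also have "\<dots> = ennreal C * Lnorm 2 g" using G3 by (simp add: ennreal_mult C_def)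
    also have "\<dots> \<le> ennreal (C + 1) * E_norm p q b u"
      unfolding g_def by (intro mult_mono Lnorm_weak_gradient_le_E_norm p q ennreal_leI) auto
    finally show ?thesis .
  qed
  have "C + 1 > 0" unfolding C_def by (simp add: add_nonneg_pos)
  with bound show ?thesis unfolding continuously_embedded_def s_def by blast
qed

section \<open>Scaled and translated cutoff functions\<close>

text \<open>The case \<open>s = \<infinity>\<close> is included; there \<open>1 / enn2real s = 1 / 0 = 0\<close> and the volume factor is one.\<close>

lemma Lnorm_ge_on_ball:
  fixes f :: "'a::euclidean_space \<Rightarrow> real"
  assumes [measurable]: "f \<in> borel_measurable borel" and f: "\<And>x. x \<in> ball z \<delta> \<Longrightarrow> c \<le> \<bar>f x\<bar>"
    and c: "c > 0" and \<delta>: "\<delta> > 0" and s: "s \<ge> 1"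
  shows "ennreal (c * measure lborel (ball z \<delta>) powr (1 / enn2real s)) \<le> Lnorm s f"
proof -
  let ?m = "measure lborel (ball z \<delta>)"
  have m: "?m > 0" "emeasure lborel (ball z \<delta>) = ennreal ?m"
    using \<delta> emeasure_lborel_ball_finite[of z \<delta>]
    by (auto simp: emeasure_eq_ennreal_measure less_top)
  show ?thesis
  proof (cases "s = \<infinity>")
    case True
    have "ennreal c \<le> esssup lebesgue (\<lambda>x. ennreal (norm (f x)))"
    proof (rule ccontr)
      assume "\<not> ?thesis"
      then have lt: "esssup lebesgue (\<lambda>x. ennreal (norm (f x))) < ennreal c" by simp
      have "AE x in lebesgue. x \<notin> ball z \<delta>"
        using esssup_AE[of "\<lambda>x. ennreal (norm (f x))" lebesgue]
      proof eventually_elim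
        case (elim x)
        then have "ennreal (norm (f x)) < ennreal c" using lt by (rule le_less_trans)
        then have "\<bar>f x\<bar> < c" using c by (simp add: ennreal_less_iff)
        then show ?case using f[of x] by auto
      qed
      then have "emeasure lebesgue (ball z \<delta>) = 0"
        by (subst (asm) AE_iff_measurable[of "ball z \<delta>"]) auto
      then show False using m by simp
    qed
    then show ?thesis using True m by (simp add: Lnorm_def)
  next
    case False
    define t where "t = enn2real s"
    have t: "t > 0" using s False unfolding t_def
      by (metis enn2real_positive_iff ennreal_zero_less_one less_le_trans less_top infinity_ennreal_def)
    have "ennreal (c powr t * ?m) = ennreal (c powr t) * emeasure lborel (ball z \<delta>)"
      unfolding m(2) by (intro ennreal_mult) auto
    also have "\<dots> = (\<integral>\<^sup>+x. ennreal (c powr t) * indicator (ball z \<delta>) x \<partial>lborel)"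
      by (rule nn_integral_cmult_indicator[symmetric]) simp
    also have "\<dots> \<le> (\<integral>\<^sup>+x. ennreal (norm (f x) powr t) \<partial>lborel)"
      using f c t by (intro nn_integral_mono) (auto simp: indicator_def intro!: ennreal_leI powr_mono2)
    also have "\<dots> = (\<integral>\<^sup>+x. ennreal (norm (f x) powr t) \<partial>lebesgue)"
      by (simp add: nn_integral_completion)
    finally have "ennpow (ennreal (c powr t * ?m)) (1 / t) \<le> Lnorm s f"
      using False t by (simp add: Lnorm_def t_def ennpow_mono)
    also have "ennpow (ennreal (c powr t * ?m)) (1 / t) = ennreal (c * ?m powr (1 / t))"
      using t c m(1) by (subst ennpow_ennreal) (auto simp: powr_mult powr_powr)
    finally show ?thesis by (simp add: t_def)
  qed
qed

text \<open>The square of the positive part, which is continuously differentiable.\<close>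

definition pos_sq :: "real \<Rightarrow> real" where
  "pos_sq t = (max 0 t)\<^sup>2"

text \<open>Equal to one where \<open>\<bar>x\<bar>\<^sup>2 \<le> 1\<close> and to zero where \<open>\<bar>x\<bar>\<^sup>2 \<ge> 2\<close>.\<close>

definition cutoff :: "'a::euclidean_space \<Rightarrow> real" where
  "cutoff x = pos_sq (1 - pos_sq (x \<bullet> x - 1))"

text \<open>The gradient of the cutoff function, as given by the chain rule.\<close>

definition cutoff_grad :: "'a::euclidean_space \<Rightarrow> 'a" where
  "cutoff_grad x = (2 * max 0 (1 - pos_sq (x \<bullet> x - 1)) * (- (2 * max 0 (x \<bullet> x - 1)))) *\<^sub>R (2 *\<^sub>R x)"

lemma pos_sq_has_derivative: "(pos_sq has_real_derivative 2 * max 0 t) (at t)"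
proof -
  consider "t > 0" | "t < 0" | "t = 0" by linarith
  then show ?thesis
  proof cases
    case 1
    have "((\<lambda>t. t\<^sup>2) has_real_derivative 2 * max 0 t) (at t)"
      using 1 by (auto intro!: derivative_eq_intros)
    then show ?thesis
      by (rule has_field_derivative_transform_within_open[of _ _ _ "{0<..}"])
         (use 1 in \<open>auto simp: pos_sq_def\<close>)
  next
    case 2
    have "((\<lambda>t. 0) has_real_derivative 2 * max 0 t) (at t)"
      using 2 by (auto intro!: derivative_eq_intros)
    then show ?thesis
      by (rule has_field_derivative_transform_within_open[of _ _ _ "{..<0}"])
         (use 2 in \<open>auto simp: pos_sq_def\<close>)
  next
    case 3
    have "((\<lambda>h. pos_sq h / h) \<longlongrightarrow> 0) (at 0)"
    proof (rule Lim_null_comparison)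
      show "\<forall>\<^sub>F h in at 0. norm (pos_sq h / h) \<le> \<bar>h\<bar>"
        by (auto simp: pos_sq_def max_def power2_eq_square intro!: always_eventually)
      show "((\<lambda>h::real. \<bar>h\<bar>) \<longlongrightarrow> 0) (at 0)" by (auto intro!: tendsto_eq_intros)
    qed
    then show ?thesis using 3 by (simp add: has_field_derivative_iff pos_sq_def)
  qed
qed

lemma pos_sq_mono_1: "t \<ge> 1 \<Longrightarrow> pos_sq t \<ge> 1"
  by (simp add: pos_sq_def)

lemma cutoff_C1: "C1_supp (cutoff :: 'a::euclidean_space \<Rightarrow> real) cutoff_grad 2"
  unfolding C1_supp_def
proof (intro conjI allI impI)
  fix x :: 'a
  have 1: "((\<lambda>x. x \<bullet> x - 1) has_derivative (\<lambda>h. 2 * (x \<bullet> h))) (at x)"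
    by (auto intro!: derivative_eq_intros simp: inner_commute)
  have 2: "((\<lambda>x. 1 - pos_sq (x \<bullet> x - 1)) has_derivative (\<lambda>h. - (2 * max 0 (x \<bullet> x - 1) * (2 * (x \<bullet> h))))) (at x)"
    using has_derivative_diff[OF has_derivative_const[of 1]
        has_derivative_compose[OF 1 pos_sq_has_derivative[unfolded has_field_derivative_def]]] by simp
  show "(cutoff has_derivative (\<lambda>h. cutoff_grad x \<bullet> h)) (at x)"
    using has_derivative_compose[OF 2 pos_sq_has_derivative[unfolded has_field_derivative_def]]
    by (simp add: cutoff_def[abs_def] cutoff_grad_def mult_ac)
next
  show "continuous_on UNIV (cutoff_grad :: 'a \<Rightarrow> 'a)"
    unfolding cutoff_grad_def pos_sq_def by (intro continuous_intros)
next
  fix x :: 'a assume "norm x \<ge> 2"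
  then have "2\<^sup>2 \<le> (norm x)\<^sup>2" by (intro power_mono) auto
  then have "pos_sq (x \<bullet> x - 1) \<ge> 1" by (intro pos_sq_mono_1) (simp add: power2_norm_eq_inner)
  then show "cutoff x = 0" "cutoff_grad x = 0" by (auto simp: cutoff_def cutoff_grad_def pos_sq_def)
qed

lemma cutoff_eq_1: "norm x \<le> 1 \<Longrightarrow> cutoff x = 1"
  using power_mono[of "norm x" 1 2] by (simp add: cutoff_def pos_sq_def power2_norm_eq_inner)

lemma cutoff_grad_nonzero:
  assumes "cutoff_grad x \<noteq> 0"
  shows "1 < (norm x)\<^sup>2" "(norm x)\<^sup>2 < 2"
proof -
  have nz: "max 0 (1 - pos_sq (x \<bullet> x - 1)) \<noteq> 0" "max 0 (x \<bullet> x - 1) \<noteq> 0"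
    using assms by (auto simp: cutoff_grad_def)
  then show "1 < (norm x)\<^sup>2" by (auto simp: max_def power2_norm_eq_inner split: if_splits)
  have "\<not> 1 \<le> x \<bullet> x - 1" using nz(1) pos_sq_mono_1[of "x \<bullet> x - 1"] by auto
  then show "(norm x)\<^sup>2 < 2" by (simp add: power2_norm_eq_inner)
qed

lemma C1_supp_scale:
  fixes v :: "'a::euclidean_space \<Rightarrow> real"
  assumes "C1_supp v G R" and r: "r > 0"
  shows "C1_supp (\<lambda>x. v (x /\<^sub>R r)) (\<lambda>x. G (x /\<^sub>R r) /\<^sub>R r) (r * R)"
  unfolding C1_supp_def
proof (intro conjI allI impI)
  note D = C1_suppD[OF assms(1)]
  show "((\<lambda>x. v (x /\<^sub>R r)) has_derivative (\<lambda>h. (G (x /\<^sub>R r) /\<^sub>R r) \<bullet> h)) (at x)" for x :: 'a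
  proof -
    have "((\<lambda>x. x /\<^sub>R r) has_derivative (\<lambda>h. h /\<^sub>R r)) (at x)"
      by (auto intro!: derivative_eq_intros)
    from has_derivative_compose[OF this D(1)] show ?thesis by simp
  qed
  show "continuous_on UNIV (\<lambda>x. G (x /\<^sub>R r) /\<^sub>R r)"
    by (intro continuous_intros continuous_on_compose2[OF D(2)]) auto
  fix x :: 'a assume "r * R \<le> norm x"
  then have "R \<le> norm (x /\<^sub>R r)" using r by (simp add: field_simps)
  then show "v (x /\<^sub>R r) = 0" "G (x /\<^sub>R r) /\<^sub>R r = 0" using D(4,5) by auto
qed

lemma C1_supp_add:
  assumes "C1_supp v G R" "C1_supp w H R"
  shows "C1_supp (\<lambda>x. v x + w x) (\<lambda>x. G x + H x) R"
  unfolding C1_supp_def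
proof (intro conjI allI impI)
  note D = C1_suppD[OF assms(1)] and E = C1_suppD[OF assms(2)]
  show "((\<lambda>x. v x + w x) has_derivative (\<lambda>h. (G x + H x) \<bullet> h)) (at x)" for x
    unfolding inner_add_left by (rule has_derivative_add[OF D(1) E(1)])
  show "continuous_on UNIV (\<lambda>x. G x + H x)" using D(2) E(2) by (rule continuous_on_add)
qed (use C1_suppD(4,5)[OF assms(1)] C1_suppD(4,5)[OF assms(2)] in auto)

lemma C1_supp_mono: "C1_supp v G R \<Longrightarrow> R \<le> S \<Longrightarrow> C1_supp v G S"
  unfolding C1_supp_def by (meson order_trans)

text \<open>The Dirichlet energy of a function with gradient \<open>G\<close>.\<close>

definition energy :: "('a::euclidean_space \<Rightarrow> 'a) \<Rightarrow> real" where
  "energy G = (LINT x|lborel. (norm (G x))\<^sup>2)"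

lemma energy_nonneg: "energy G \<ge> 0"
  unfolding energy_def by (intro Bochner_Integration.integral_nonneg) simp

lemma energy_integrable:
  assumes "C1_supp v G R"
  shows "integrable lborel (\<lambda>x. (norm (G x))\<^sup>2)"
  by (rule continuous_compact_support_integrable[where R = R])
     (use C1_suppD[OF assms] in \<open>auto intro!: continuous_intros\<close>)

lemma energy_scale:
  fixes v :: "'a::euclidean_space \<Rightarrow> real"
  assumes C: "C1_supp v G R" and r: "r > 0"
  shows "energy (\<lambda>x. G (x /\<^sub>R r) /\<^sub>R r) = r powr (real DIM('a) - 2) * energy G"
proof -
  note D = C1_suppD[OF C] and D' = C1_suppD[OF C1_supp_scale[OF C r]]
  note [measurable] = D(6,7)
  have nn: "(\<integral>\<^sup>+x. ennreal ((norm (G x))\<^sup>2) \<partial>lborel) = ennreal (energy G)"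
    unfolding energy_def by (intro nn_integral_eq_integral energy_integrable[OF C]) auto
  have "ennreal (energy (\<lambda>x. G (x /\<^sub>R r) /\<^sub>R r)) = (\<integral>\<^sup>+x. ennreal ((norm (G (x /\<^sub>R r) /\<^sub>R r))\<^sup>2) \<partial>lborel)"
    unfolding energy_def by (intro nn_integral_eq_integral[symmetric] energy_integrable[OF C1_supp_scale[OF C r]]) auto
  also have "\<dots> = (\<integral>\<^sup>+x. ennreal (1 / r\<^sup>2) * ennreal ((norm (G (0 + (1 / r) *\<^sub>R x)))\<^sup>2) \<partial>lborel)"
    using r by (intro nn_integral_cong) (simp add: power_mult_distrib power_inverse divide_inverse flip: ennreal_mult)
  also have "\<dots> = ennreal (1 / r\<^sup>2) * (\<integral>\<^sup>+x. ennreal ((norm (G (0 + (1 / r) *\<^sub>R x)))\<^sup>2) \<partial>lborel)"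
    by (rule nn_integral_cmult) measurable
  also have "(\<integral>\<^sup>+x. ennreal ((norm (G (0 + (1 / r) *\<^sub>R x)))\<^sup>2) \<partial>lborel) = ennreal (1 / (1 / r) ^ DIM('a)) * ennreal (energy G)"
    unfolding nn[symmetric] by (rule nn_integral_lborel_affine) (use r in auto)
  also have "\<dots> = ennreal (1 / (1 / r) ^ DIM('a) * energy G)"
    using energy_nonneg[of G] r by (intro ennreal_mult[symmetric]) auto
  also have "ennreal (1 / r\<^sup>2) * \<dots> = ennreal (1 / r\<^sup>2 * (1 / (1 / r) ^ DIM('a) * energy G))"
    using energy_nonneg[of G] r by (intro ennreal_mult[symmetric]) auto
  finally have "energy (\<lambda>x. G (x /\<^sub>R r) /\<^sub>R r) = 1 / r\<^sup>2 * (1 / (1 / r) ^ DIM('a) * energy G)"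
    using energy_nonneg[of G] energy_nonneg[of "\<lambda>x. G (x /\<^sub>R r) /\<^sub>R r"] r by (subst (asm) ennreal_inj) auto
  also have "\<dots> = r powr (real DIM('a) - 2) * energy G"
    using r by (simp add: powr_diff powr_realpow power_one_over)
  finally show ?thesis .
qed

lemma Lnorm_weak_gradient_shift:
  fixes v :: "'a::euclidean_space \<Rightarrow> real"
  assumes C: "C1_supp v G R"
  shows "Lnorm 2 (weak_gradient (\<lambda>x. v (x - z))) = ennreal (sqrt (energy G))"
proof -
  note [measurable] = C1_suppD(6,7)[OF C]
  have "(\<integral>\<^sup>+x. ennreal ((norm (weak_gradient (\<lambda>x. v (x - z)) x))\<^sup>2) \<partial>lebesgue) = (\<integral>\<^sup>+x. ennreal ((norm (G (x - z)))\<^sup>2) \<partial>lborel)"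
  proof (rule nn_integral_lebesgue_cong)
    show "AE x in lebesgue. ennreal ((norm (weak_gradient (\<lambda>x. v (x - z)) x))\<^sup>2) = ennreal ((norm (G (x - z)))\<^sup>2)"
      using C1_supp_weak_gradient(2)[OF C1_supp_shift[OF C, of z]] by eventually_elim simp
  qed measurable
  also have "\<dots> = (\<integral>\<^sup>+x. ennreal ((norm (G x))\<^sup>2) \<partial>lborel)"
    using nn_integral_lborel_shift[of "\<lambda>x. ennreal ((norm (G x))\<^sup>2)" "- z"] by simp
  also have "\<dots> = ennreal (energy G)"
    unfolding energy_def by (intro nn_integral_eq_integral energy_integrable[OF C]) auto
  finally show ?thesis
    using energy_nonneg[of G] by (simp add: Lnorm_2 ennpow_ennreal powr_half_sqrt)
qed

text \<open>Far from the origin \<open>h\<^sub>u\<close> vanishes for small radii and stays bounded, so \<open>b > 1\<close> makes the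
  \<open>L\<^bsup>p,q\<^esup>\<^bsub>b\<^esub>\<close> norm small.\<close>

lemma Lpqb_norm_far:
  fixes v :: "'a::euclidean_space \<Rightarrow> real"
  assumes C: "C1_supp v G R" and p: "p > 0" and q: "q > 0" and b: "b > 1" and \<epsilon>: "\<epsilon> > 0"
  shows "\<exists>T. \<forall>z. norm z \<ge> T \<longrightarrow> Lpqb_norm p q b (\<lambda>x. v (x - z)) \<le> ennreal \<epsilon>"
proof -
  note D = C1_suppD[OF C]
  note [measurable] = D(6)
  define H where "H = (LINT x|lborel. \<bar>v x\<bar> powr p)"
  have H0: "H \<ge> 0" unfolding H_def by (intro Bochner_Integration.integral_nonneg) simp
  have "integrable lborel (\<lambda>x. \<bar>v x\<bar> powr p)"
  proof (rule continuous_compact_support_integrable[where R = R])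
    show "continuous_on UNIV (\<lambda>x. \<bar>v x\<bar> powr p)"
      by (rule continuous_on_powr') (use D(3) p in \<open>auto intro: continuous_on_rabs\<close>)
  qed (use D(4) p in simp)
  then have H: "(\<integral>\<^sup>+x. ennreal (\<bar>v x\<bar> powr p) \<partial>lborel) = ennreal H"
    unfolding H_def by (intro nn_integral_eq_integral) auto
  define f where "f T = (H powr q * (T powr (1 - b) / (b - 1))) powr (1 / (p * q))" for T :: real
  have "((\<lambda>T. H powr q * (T powr (1 - b) / (b - 1))) \<longlongrightarrow> H powr q * (0 / (b - 1))) at_top"
    using b by (intro tendsto_intros tendsto_neg_powr filterlim_ident) auto
  then have "(f \<longlongrightarrow> 0 powr (1 / (p * q))) at_top"
    unfolding f_def using p q b by (intro tendsto_powr' tendsto_const) (auto intro!: always_eventually)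
  then have "\<forall>\<^sub>F T in at_top. f T < \<epsilon>"
    using \<epsilon> by (intro order_tendstoD(2)) auto
  then obtain T where T: "T > 0" "f T < \<epsilon>"
    using eventually_happens'[OF _ eventually_conj[OF _ eventually_gt_at_top[of 0]]] by (metis trivial_limit_at_top_linorder)
  have "Lpqb_norm p q b (\<lambda>x. v (x - z)) \<le> ennreal \<epsilon>" if z: "norm z \<ge> T + R" for z
  proof -
    let ?w = "\<lambda>x. v (x - z)"
    have hle: "h_fun p ?w \<rho> \<le> ennreal H" for \<rho>
    proof -
      have "h_fun p ?w \<rho> \<le> (\<integral>\<^sup>+x. ennreal (\<bar>v (x - z)\<bar> powr p) \<partial>lebesgue)"
        unfolding h_fun_def by (intro nn_integral_mono) (auto simp: indicator_def)
      also have "\<dots> = (\<integral>\<^sup>+x. ennreal (\<bar>v (x - z)\<bar> powr p) \<partial>lborel)"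
        by (rule nn_integral_lebesgue_cong) auto
      also have "\<dots> = ennreal H"
        using nn_integral_lborel_shift[of "\<lambda>x. ennreal (\<bar>v x\<bar> powr p)" "- z"] H by simp
      finally show ?thesis .
    qed
    have h0: "h_fun p ?w \<rho> = 0" if \<rho>: "\<rho> < T" for \<rho>
    proof -
      have "v (x - z) = 0" if "norm x < \<rho>" for x
        using that \<rho> z norm_triangle_ineq3[of z x] by (intro D(4)) (simp add: norm_minus_commute)
      then have "h_fun p ?w \<rho> = (\<integral>\<^sup>+x. 0 \<partial>(lebesgue :: 'a measure))"
        unfolding h_fun_def by (intro nn_integral_cong) (auto simp: indicator_def)
      then show ?thesis by simp
    qed
    have "(\<integral>\<^sup>+\<rho>\<in>{0<..}. ennreal (\<rho> powr (- b)) * ennpow (h_fun p ?w \<rho>) q \<partial>lborel) \<le>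
        (\<integral>\<^sup>+\<rho>. ennreal (H powr q) * ennreal (indicator {T..} \<rho> * \<rho> powr (- b)) \<partial>lborel)"
    proof (rule nn_integral_mono)
      fix \<rho> :: real
      show "ennreal (\<rho> powr (- b)) * ennpow (h_fun p ?w \<rho>) q * indicator {0<..} \<rho> \<le> ennreal (H powr q) * ennreal (indicator {T..} \<rho> * \<rho> powr (- b))"
      proof (cases "\<rho> < T")
        case True
        then show ?thesis using h0 by (simp add: ennpow_def)
      next
        case False
        have "ennpow (h_fun p ?w \<rho>) q \<le> ennreal (H powr q)"
          using ennpow_mono[OF hle, of q] H0 q by (simp add: ennpow_ennreal)
        then have "ennreal (\<rho> powr (- b)) * ennpow (h_fun p ?w \<rho>) q \<le> ennreal (\<rho> powr (- b)) * ennreal (H powr q)"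
          by (intro mult_left_mono) auto
        then show ?thesis using False by (auto simp: indicator_def mult.commute)
      qed
    qed
    also have "\<dots> = ennreal (H powr q) * (\<integral>\<^sup>+\<rho>. ennreal (indicator {T..} \<rho> * \<rho> powr (- b)) \<partial>lborel)"
      by (rule nn_integral_cmult) auto
    also have "(\<integral>\<^sup>+\<rho>. ennreal (indicator {T..} \<rho> * \<rho> powr (- b)) \<partial>lborel) = ennreal (- (T powr (- b + 1)) / (- b + 1))"
      by (rule nn_integral_has_integral_lebesgue[OF _ has_integral_powr_to_inf]) (use b T in auto)
    also have "- (T powr (- b + 1)) / (- b + 1) = T powr (1 - b) / (b - 1)"
      using b by (simp add: field_simps)
    also have "ennreal (H powr q) * ennreal (T powr (1 - b) / (b - 1)) = ennreal (H powr q * (T powr (1 - b) / (b - 1)))"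
      using b by (intro ennreal_mult[symmetric]) auto
    finally have "Lpqb_norm p q b ?w \<le> ennpow (ennreal (H powr q * (T powr (1 - b) / (b - 1)))) (1 / (p * q))"
      unfolding Lpqb_norm_def using p q by (intro ennpow_mono) auto
    also have "\<dots> = ennreal (f T)" using b by (simp add: ennpow_ennreal f_def)
    also have "\<dots> \<le> ennreal \<epsilon>" using T by (intro ennreal_leI) simp
    finally show ?thesis .
  qed
  then show ?thesis by blast
qed

lemma E_norm_le:
  assumes "Lnorm 2 (weak_gradient u) \<le> ennreal A" "Lpqb_norm p q b u \<le> ennreal A" "A \<ge> 0"
    and pq: "p * q > 1"
  shows "E_norm p q b u \<le> ennreal (2 * A)"
proof -
  let ?m = "2 * p * q"
  have m: "?m > 1" using pq by simp
  have "E_norm p q b u \<le> ennpow (ennpow (ennreal A) ?m + ennpow (ennreal A) ?m) (1 / ?m)"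
    unfolding E_norm_def using assms m by (intro ennpow_mono add_mono) auto
  also have "\<dots> = ennpow (ennreal (2 * A powr ?m)) (1 / ?m)"
    using assms(3) by (simp add: ennpow_ennreal flip: ennreal_plus)
  also have "\<dots> = ennreal (2 powr (1 / ?m) * A)"
    using assms(3) m by (subst ennpow_ennreal) (auto simp: powr_mult powr_powr)
  also have "\<dots> \<le> ennreal (2 * A)"
  proof (intro ennreal_leI mult_right_mono assms(3))
    have "2 powr (1 / ?m) \<le> (2::real) powr 1" using m by (intro powr_mono) auto
    then show "2 powr (1 / ?m) \<le> (2::real)" by simp
  qed
  finally show ?thesis .
qed

lemma translate_in_E_space:
  fixes v :: "'a::euclidean_space \<Rightarrow> real"
  assumes C: "C1_supp v G R" and p: "p > 0" and q: "q > 0" and b: "b > 1" and pq: "p * q > 1" and \<epsilon>: "\<epsilon> > 0"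
  shows "\<exists>T. \<forall>z. norm z \<ge> T \<longrightarrow> (\<lambda>x. v (x - z)) \<in> E_space p q b \<and>
     E_norm p q b (\<lambda>x. v (x - z)) \<le> ennreal (2 * max (sqrt (energy G)) \<epsilon>)"
proof -
  obtain T where T: "\<And>z. norm z \<ge> T \<Longrightarrow> Lpqb_norm p q b (\<lambda>x. v (x - z)) \<le> ennreal \<epsilon>"
    using Lpqb_norm_far[OF C p q b \<epsilon>] by blast
  have "(\<lambda>x. v (x - z)) \<in> E_space p q b \<and> E_norm p q b (\<lambda>x. v (x - z)) \<le> ennreal (2 * max (sqrt (energy G)) \<epsilon>)"
    if z: "norm z \<ge> T" for z
  proof
    have "Lpqb_norm p q b (\<lambda>x. v (x - z)) < \<infinity>"
      using T[OF z] by (rule le_less_trans) simp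
    then show "(\<lambda>x. v (x - z)) \<in> E_space p q b"
      unfolding E_space_def using C1_supp_weak_gradient(1)[OF C1_supp_shift[OF C]]
      by (simp add: Lnorm_weak_gradient_shift[OF C])
    show "E_norm p q b (\<lambda>x. v (x - z)) \<le> ennreal (2 * max (sqrt (energy G)) \<epsilon>)"
    proof (rule E_norm_le[OF _ _ _ pq])
      show "Lnorm 2 (weak_gradient (\<lambda>x. v (x - z))) \<le> ennreal (max (sqrt (energy G)) \<epsilon>)"
        unfolding Lnorm_weak_gradient_shift[OF C] by (intro ennreal_leI) simp
      show "Lpqb_norm p q b (\<lambda>x. v (x - z)) \<le> ennreal (max (sqrt (energy G)) \<epsilon>)"
        by (rule order_trans[OF T[OF z]]) (intro ennreal_leI, simp)
    qed (use \<epsilon> in simp)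
  qed
  then show ?thesis by blast
qed

section \<open>Failure of the other embeddings\<close>

lemma measure_ball_pos: "\<delta> > 0 \<Longrightarrow> measure lborel (ball (z::'a::euclidean_space) \<delta>) > 0"
  by simp

text \<open>Translating \<open>v\<close> to infinity removes the second part of the norm, so a continuous embedding
  is already an inequality against the gradient alone.\<close>

lemma embedding_necessary:
  fixes p q b :: real
  assumes emb: "continuously_embedded (E_space p q b :: ('a::euclidean_space \<Rightarrow> real) set) (E_norm p q b) s"
    and s: "s \<ge> 1" and p: "p > 0" and q: "q > 0" and b: "b > 1" and pq: "p * q > 1"
  obtains C where "C > 0" "\<And>(v :: 'a \<Rightarrow> real) G R c \<delta>. C1_supp v G R \<Longrightarrow> c > 0 \<Longrightarrow> \<delta> > 0 \<Longrightarrow>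
      (\<And>x. norm x < \<delta> \<Longrightarrow> c \<le> \<bar>v x\<bar>) \<Longrightarrow>
      c * measure lborel (ball (0::'a) \<delta>) powr (1 / enn2real s) \<le> C * sqrt (energy G)"
proof -
  obtain C where C: "C > 0" "\<And>u :: 'a \<Rightarrow> real. u \<in> E_space p q b \<Longrightarrow> Lnorm s u \<le> ennreal C * E_norm p q b u"
    using emb unfolding continuously_embedded_def by blast
  have "c * measure lborel (ball (0::'a) \<delta>) powr (1 / enn2real s) \<le> 2 * C * sqrt (energy G)"
    if v: "C1_supp v G R" and c: "c > 0" and \<delta>: "\<delta> > 0" and ge: "\<And>x. norm x < \<delta> \<Longrightarrow> c \<le> \<bar>v x\<bar>"
    for v :: "'a \<Rightarrow> real" and G R c \<delta>
  proof (rule field_le_epsilon)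
    fix e :: real assume e: "e > 0"
    define \<epsilon> where "\<epsilon> = e / (2 * C)"
    have \<epsilon>: "\<epsilon> > 0" using e C by (simp add: \<epsilon>_def)
    obtain T where T: "\<And>z. norm z \<ge> T \<Longrightarrow> (\<lambda>x. v (x - z)) \<in> E_space p q b \<and>
        E_norm p q b (\<lambda>x. v (x - z)) \<le> ennreal (2 * max (sqrt (energy G)) \<epsilon>)"
      using translate_in_E_space[OF v p q b pq \<epsilon>] by blast
    obtain z :: 'a where z: "norm z = max T 0" using vector_choose_size[of "max T 0"] by auto
    then have Tz: "norm z \<ge> T" by simp
    have "ennreal (c * measure lborel (ball z \<delta>) powr (1 / enn2real s)) \<le> Lnorm s (\<lambda>x. v (x - z))"
    proof (rule Lnorm_ge_on_ball[OF _ _ c \<delta> s])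
      show "(\<lambda>x. v (x - z)) \<in> borel_measurable borel" using C1_suppD(6)[OF v] by measurable
      show "c \<le> \<bar>v (x - z)\<bar>" if "x \<in> ball z \<delta>" for x
        using that by (intro ge) (simp add: dist_norm norm_minus_commute)
    qed
    also have "\<dots> \<le> ennreal C * E_norm p q b (\<lambda>x. v (x - z))"
      using C(2) T[OF Tz] by blast
    also have "\<dots> \<le> ennreal C * ennreal (2 * max (sqrt (energy G)) \<epsilon>)"
      using T[OF Tz] by (intro mult_left_mono) auto
    also have "\<dots> = ennreal (C * (2 * max (sqrt (energy G)) \<epsilon>))"
      using C(1) \<epsilon> by (intro ennreal_mult[symmetric]) auto
    finally have "c * measure lborel (ball z \<delta>) powr (1 / enn2real s) \<le> C * (2 * max (sqrt (energy G)) \<epsilon>)"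
      using C(1) \<epsilon> by (subst (asm) ennreal_le_iff) auto
    also have "\<dots> \<le> C * (2 * (sqrt (energy G) + \<epsilon>))"
      using C(1) \<epsilon> energy_nonneg[of G] by (intro mult_left_mono) auto
    also have "\<dots> = 2 * C * sqrt (energy G) + e"
      using C(1) by (simp add: \<epsilon>_def field_simps)
    also have "measure lborel (ball z \<delta>) = measure lborel (ball (0::'a) \<delta>)"
      using \<delta> by (simp add: content_ball)
    finally show "c * measure lborel (ball (0::'a) \<delta>) powr (1 / enn2real s) \<le> 2 * C * sqrt (energy G) + e" .
  qed
  then show ?thesis using C(1) by (intro that[of "2 * C"]) auto
qed

lemma powr_bounded_imp_zero:
  fixes d K :: real
  assumes "\<And>r. r > 0 \<Longrightarrow> r powr d \<le> K"
  shows "d = 0"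
proof (rule ccontr)
  assume d: "d \<noteq> 0"
  have "((\<bar>K\<bar> + 1) powr (1 / d)) powr d = \<bar>K\<bar> + 1" using d by (simp add: powr_powr)
  moreover have "((\<bar>K\<bar> + 1) powr (1 / d)) powr d \<le> K"
    by (rule assms) (simp add: add_nonneg_pos)
  ultimately show False by linarith
qed

text \<open>Apply the inequality to the dilates of the cutoff: both sides are powers of the dilation factor,
  so the exponents agree.\<close>

lemma embedding_exponent:
  assumes C: "\<And>(v :: 'a::euclidean_space \<Rightarrow> real) G R c \<delta>. C1_supp v G R \<Longrightarrow> c > 0 \<Longrightarrow> \<delta> > 0 \<Longrightarrow>
      (\<And>x. norm x < \<delta> \<Longrightarrow> c \<le> \<bar>v x\<bar>) \<Longrightarrow>
      c * measure lborel (ball (0::'a) \<delta>) powr \<alpha> \<le> C * sqrt (energy G)"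
  shows "real DIM('a) * \<alpha> = (real DIM('a) - 2) / 2"
proof -
  define \<omega> where "\<omega> = unit_ball_vol (real DIM('a))"
  define A where "A = energy (cutoff_grad :: 'a \<Rightarrow> 'a)"
  have \<omega>: "\<omega> > 0" by (simp add: \<omega>_def)
  have "r powr (real DIM('a) * \<alpha> - (real DIM('a) - 2) / 2) \<le> C * sqrt A / \<omega> powr \<alpha>" if r: "r > 0" for r
  proof -
    have "1 * measure lborel (ball (0::'a) r) powr \<alpha> \<le> C * sqrt (energy (\<lambda>x::'a. cutoff_grad (x /\<^sub>R r) /\<^sub>R r))"
    proof (rule C[OF C1_supp_scale[OF cutoff_C1 r]])
      show "1 \<le> \<bar>cutoff (x /\<^sub>R r)\<bar>" if "norm x < r" for x :: 'a
        using that r by (subst cutoff_eq_1) (auto simp: field_simps)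
    qed (use r in auto)
    also have "energy (\<lambda>x::'a. cutoff_grad (x /\<^sub>R r) /\<^sub>R r) = r powr (real DIM('a) - 2) * A"
      unfolding A_def by (rule energy_scale[OF cutoff_C1 r])
    also have "sqrt \<dots> = r powr ((real DIM('a) - 2) / 2) * sqrt A"
      using r by (simp add: real_sqrt_mult powr_powr flip: powr_half_sqrt)
    also have "measure lborel (ball (0::'a) r) = \<omega> * r powr real DIM('a)"
      using r by (simp add: content_ball \<omega>_def powr_realpow)
    finally have "\<omega> powr \<alpha> * r powr (real DIM('a) * \<alpha>) \<le> C * sqrt A * r powr ((real DIM('a) - 2) / 2)"
      by (simp add: powr_mult powr_powr mult_ac)
    then have "r powr (real DIM('a) * \<alpha>) \<le> C * sqrt A * r powr ((real DIM('a) - 2) / 2) / \<omega> powr \<alpha>"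
      using \<omega> by (subst pos_le_divide_eq) (auto simp: mult.commute)
    then have "r powr (real DIM('a) * \<alpha>) \<le> C * sqrt A / \<omega> powr \<alpha> * r powr ((real DIM('a) - 2) / 2)"
      by simp
    then show ?thesis unfolding powr_diff using r by (subst pos_divide_le_eq) auto
  qed
  then have "real DIM('a) * \<alpha> - (real DIM('a) - 2) / 2 = 0" by (rule powr_bounded_imp_zero)
  then show ?thesis by simp
qed

text \<open>In dimension two the superposition of \<open>n\<close> dyadic dilates of the cutoff reaches height \<open>n\<close>,
  while its energy is only proportional to \<open>n\<close>: the gradients have disjoint supports and equal
  energies.\<close>

definition tower :: "nat \<Rightarrow> 'a::euclidean_space \<Rightarrow> real" where
  "tower n x = (\<Sum>j<n. cutoff (x /\<^sub>R (1 / 2 ^ j)))"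

definition tower_grad :: "nat \<Rightarrow> 'a::euclidean_space \<Rightarrow> 'a" where
  "tower_grad n x = (\<Sum>j<n. cutoff_grad (x /\<^sub>R (1 / 2 ^ j)) /\<^sub>R (1 / 2 ^ j))"

lemma C1_supp_dilate: "C1_supp (\<lambda>x::'a::euclidean_space. cutoff (x /\<^sub>R (1 / 2 ^ j))) (\<lambda>x. cutoff_grad (x /\<^sub>R (1 / 2 ^ j)) /\<^sub>R (1 / 2 ^ j)) 2"
proof (rule C1_supp_mono[OF C1_supp_scale[OF cutoff_C1]])
  show "1 / 2 ^ j * 2 \<le> (2::real)" using one_le_power[of "2::real" j] by (simp add: field_simps)
qed simp

lemma C1_supp_tower: "C1_supp (tower n :: 'a::euclidean_space \<Rightarrow> real) (tower_grad n) 2"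
proof (induction n)
  case 0
  show ?case by (simp add: C1_supp_def tower_def[abs_def] tower_grad_def[abs_def])
next
  case (Suc n)
  from C1_supp_add[OF this C1_supp_dilate[of n]] show ?case
    by (simp add: tower_def[abs_def] tower_grad_def[abs_def])
qed

lemma cutoff_grad_orthogonal:
  assumes "i < j"
  shows "cutoff_grad (2 ^ i *\<^sub>R x) \<bullet> cutoff_grad (2 ^ j *\<^sub>R x) = 0"
proof (rule ccontr)
  assume "\<not> ?thesis"
  then have nz: "cutoff_grad (2 ^ i *\<^sub>R x) \<noteq> 0" "cutoff_grad (2 ^ j *\<^sub>R x) \<noteq> 0" by auto
  have i: "1 < (2 ^ i * norm x)\<^sup>2" using cutoff_grad_nonzero(1)[OF nz(1)] by simp
  have j: "(2 ^ j * norm x)\<^sup>2 < 2" using cutoff_grad_nonzero(2)[OF nz(2)] by simp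
  have "2 * 2 ^ i \<le> (2::real) ^ j" using power_increasing[of "Suc i" j "2::real"] assms by simp
  then have "2 * 2 ^ i * norm x \<le> 2 ^ j * norm x" by (rule mult_right_mono) simp
  then have "(2 * (2 ^ i * norm x))\<^sup>2 \<le> (2 ^ j * norm x)\<^sup>2" by (intro power_mono) (auto simp: mult_ac)
  then have "4 * (2 ^ i * norm x)\<^sup>2 \<le> (2 ^ j * norm x)\<^sup>2" by (simp add: power_mult_distrib)
  with i j show False by linarith
qed

lemma energy_tower:
  assumes "DIM('a::euclidean_space) = 2"
  shows "energy (tower_grad n :: 'a \<Rightarrow> 'a) = real n * energy (cutoff_grad :: 'a \<Rightarrow> 'a)"
proof (induction n)
  case 0
  show ?case by (simp add: energy_def tower_grad_def)
next
  case (Suc n)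
  let ?g = "\<lambda>x::'a. cutoff_grad (x /\<^sub>R (1 / 2 ^ n)) /\<^sub>R (1 / 2 ^ n)"
  have "(norm (tower_grad (Suc n) x))\<^sup>2 = (norm (tower_grad n x))\<^sup>2 + (norm (?g x))\<^sup>2" for x
  proof -
    have "tower_grad n x \<bullet> ?g x = 0"
      unfolding tower_grad_def inner_sum_left by (intro sum.neutral) (auto simp: cutoff_grad_orthogonal)
    moreover have "(norm (a + b))\<^sup>2 = (norm a)\<^sup>2 + (norm b)\<^sup>2" if "a \<bullet> b = 0" for a b :: 'a
      using that by (simp add: power2_norm_eq_inner inner_add_left inner_add_right inner_commute)
    ultimately have "(norm (tower_grad n x + ?g x))\<^sup>2 = (norm (tower_grad n x))\<^sup>2 + (norm (?g x))\<^sup>2"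
      by blast
    then show ?thesis by (simp add: tower_grad_def)
  qed
  then have "energy (tower_grad (Suc n) :: 'a \<Rightarrow> 'a) = energy (tower_grad n :: 'a \<Rightarrow> 'a) + energy ?g"
    unfolding energy_def
    by (simp only: Bochner_Integration.integral_add[OF energy_integrable[OF C1_supp_tower] energy_integrable[OF C1_supp_dilate]])
  also have "energy ?g = energy (cutoff_grad :: 'a \<Rightarrow> 'a)"
    using energy_scale[OF cutoff_C1, of "1 / 2 ^ n", where 'a = 'a] assms by simp
  finally show ?case using Suc by (simp add: algebra_simps)
qed

lemma tower_ge:
  fixes x :: "'a::euclidean_space"
  assumes "norm x < 1 / 2 ^ n"
  shows "tower n x = real n"
proof -
  have "cutoff (x /\<^sub>R (1 / 2 ^ j)) = 1" if "j < n" for j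
  proof (rule cutoff_eq_1)
    have "2 ^ j * norm x \<le> 2 ^ n * norm x" using that by (intro mult_right_mono power_increasing) auto
    also have "\<dots> \<le> 1" using assms by (simp add: field_simps)
    finally show "norm (x /\<^sub>R (1 / 2 ^ j)) \<le> 1" by simp
  qed
  then show ?thesis by (simp add: tower_def)
qed

lemma embedding_only_two_star:
  fixes p q b :: real
  assumes emb: "continuously_embedded (E_space p q b :: ('a::euclidean_space \<Rightarrow> real) set) (E_norm p q b) s"
    and s: "s \<ge> 1" and p: "p > 0" and q: "q > 0" and b: "b > 1" and pq: "p * q > 1" and N: "DIM('a) \<ge> 2"
  shows "DIM('a) \<ge> 3 \<and> s = ennreal (two_star DIM('a))"
proof -
  define \<alpha> where "\<alpha> = 1 / enn2real s"
  obtain C where C: "C > 0" "\<And>(v :: 'a \<Rightarrow> real) G R c \<delta>. C1_supp v G R \<Longrightarrow> c > 0 \<Longrightarrow> \<delta> > 0 \<Longrightarrow>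
      (\<And>x. norm x < \<delta> \<Longrightarrow> c \<le> \<bar>v x\<bar>) \<Longrightarrow>
      c * measure lborel (ball (0::'a) \<delta>) powr \<alpha> \<le> C * sqrt (energy G)"
    using embedding_necessary[OF assms(1-6)] unfolding \<alpha>_def by metis
  have e: "real DIM('a) * \<alpha> = (real DIM('a) - 2) / 2"
    by (rule embedding_exponent[OF C(2)])
  have N3: "DIM('a) \<ge> 3"
  proof (rule ccontr)
    assume "\<not> ?thesis"
    with N have N2: "DIM('a) = 2" by simp
    with e have \<alpha>0: "\<alpha> = 0" by simp
    define A where "A = energy (cutoff_grad :: 'a \<Rightarrow> 'a)"
    have A: "A \<ge> 0" unfolding A_def by (rule energy_nonneg)
    have "real n \<le> C\<^sup>2 * A" if n: "n > 0" for n
    proof -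
      have "real n * measure lborel (ball (0::'a) (1 / 2 ^ n)) powr \<alpha> \<le> C * sqrt (energy (tower_grad n :: 'a \<Rightarrow> 'a))"
        by (rule C(2)[OF C1_supp_tower]) (use n in \<open>auto simp: tower_ge\<close>)
      moreover have "x powr \<alpha> = 1" if "x > 0" for x :: real using that \<alpha>0 by simp
      then have "measure lborel (ball (0::'a) (1 / 2 ^ n)) powr \<alpha> = 1"
        using measure_ball_pos[of "1 / 2 ^ n" "0::'a"] by fastforce
      ultimately have "real n \<le> C * sqrt (real n * A)"
        by (simp only: energy_tower[OF N2] A_def mult_1_right)
      then have "(real n)\<^sup>2 \<le> (C * sqrt (real n * A))\<^sup>2" by (rule power_mono) simp
      also have "\<dots> = real n * (C\<^sup>2 * A)" using A by (simp add: power_mult_distrib)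
      finally show ?thesis using n by (simp add: power2_eq_square)
    qed
    moreover obtain n where "real n > C\<^sup>2 * A" using reals_Archimedean2 by blast
    ultimately show False using A by (metis less_irrefl mult_nonneg_nonneg not_gr_zero of_nat_0 order_le_less_trans zero_le_power2)
  qed
  have "\<alpha> \<noteq> 0" using e N3 by auto
  then have es: "enn2real s = 1 / \<alpha>" by (simp add: \<alpha>_def)
  have "s \<noteq> \<infinity>" using \<open>\<alpha> \<noteq> 0\<close> by (auto simp: \<alpha>_def)
  then have "s = ennreal (enn2real s)" by (simp add: less_top)
  moreover have "1 / \<alpha> = two_star DIM('a)"
  proof -
    have "\<alpha> = (real DIM('a) - 2) / (2 * real DIM('a))" using e N3 by (simp add: field_simps)
    then show ?thesis by (simp add: two_star_def)
  qed
  ultimately show ?thesis using N3 es by simp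
qed

section \<open>Failure of compactness\<close>

text \<open>Disjoint translates of the cutoff form a bounded sequence without convergent subsequence.\<close>

lemma not_compactly_embedded_finite:
  fixes p q b s :: real
  assumes s: "s > 0" and p: "p > 0" and q: "q > 0" and b: "b > 1" and pq: "p * q > 1"
  shows "\<not> compactly_embedded (E_space p q b :: ('a::euclidean_space \<Rightarrow> real) set) (E_norm p q b) (ennreal s)"
proof
  assume cpt: "compactly_embedded (E_space p q b :: ('a \<Rightarrow> real) set) (E_norm p q b) (ennreal s)"
  let ?A = "2 * max (sqrt (energy (cutoff_grad :: 'a \<Rightarrow> 'a))) 1"
  obtain T where T: "\<And>z::'a. norm z \<ge> T \<Longrightarrow> (\<lambda>x. cutoff (x - z)) \<in> E_space p q b \<and>
        E_norm p q b (\<lambda>x. cutoff (x - z)) \<le> ennreal ?A"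
    using translate_in_E_space[OF cutoff_C1 p q b pq zero_less_one] by blast
  obtain e :: 'a where e: "norm e = 1" using vector_choose_size[of 1] by auto
  define z where "z k = (\<bar>T\<bar> + 3 * real k) *\<^sub>R e" for k
  define u where "u k x = cutoff (x - z k)" for k x
  have zT: "norm (z k) \<ge> T" for k unfolding z_def by (simp add: e)
  have far: "norm (z j - z k) \<ge> 3" if "j \<noteq> k" for j k
  proof -
    have "z j - z k = (3 * (real j - real k)) *\<^sub>R e" by (simp add: z_def algebra_simps flip: scaleR_left_diff_distrib)
    moreover have "\<bar>real j - real k\<bar> \<ge> 1" using that by linarith
    ultimately show ?thesis by (simp add: e abs_mult)
  qed
  have [measurable]: "u k \<in> borel_measurable borel" for k
    unfolding u_def using C1_suppD(6)[OF cutoff_C1] by measurable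
  obtain r v where r: "strict_mono (r :: nat \<Rightarrow> nat)" and v: "v \<in> borel_measurable lebesgue"
    and lim: "(\<lambda>k. Lnorm (ennreal s) (\<lambda>x. u (r k) x - v x)) \<longlonglongrightarrow> 0"
  proof -
    have "\<forall>k. u k \<in> E_space p q b" "\<forall>k. E_norm p q b (u k) \<le> ennreal ?A"
      using T[OF zT] unfolding u_def by auto
    then show thesis using cpt that unfolding compactly_embedded_def by blast
  qed
  define \<omega> where "\<omega> = measure lborel (ball (0::'a) 1)"
  have \<omega>: "\<omega> > 0" unfolding \<omega>_def by (rule measure_ball_pos) simp
  \<comment> \<open>Two functions whose distance to \<open>v\<close> has \<open>s\<close>-th power at most \<open>\<eta>\<close> cannot differ by one on a
    unit ball.\<close>
  define \<eta> where "\<eta> = \<omega> / (4 * 2 powr s)"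
  have \<eta>: "\<eta> > 0" using \<omega> by (simp add: \<eta>_def)
  define I where "I k = (\<integral>\<^sup>+x. ennreal (\<bar>u k x - v x\<bar> powr s) \<partial>lebesgue)" for k
  have "\<forall>\<^sub>F k in sequentially. Lnorm (ennreal s) (\<lambda>x. u (r k) x - v x) < ennreal (\<eta> powr (1 / s))"
    using \<eta> by (intro order_tendstoD(2)[OF lim]) simp
  then obtain n where n: "Lnorm (ennreal s) (\<lambda>x. u (r k) x - v x) < ennreal (\<eta> powr (1 / s))" if "k \<ge> n" for k
    by (auto simp: eventually_sequentially)
  have I: "I (r k) \<le> ennreal \<eta>" if "k \<ge> n" for k
  proof -
    have "ennpow (I (r k)) (1 / s) \<le> ennreal (\<eta> powr (1 / s))"
      using n[OF that] s by (simp add: Lnorm_def I_def)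
    then have "ennpow (ennpow (I (r k)) (1 / s)) s \<le> ennpow (ennreal (\<eta> powr (1 / s))) s"
      using s by (intro ennpow_mono) auto
    then show ?thesis using s \<eta> by (simp add: ennpow_ennpow ennpow_ennreal powr_powr)
  qed
  define j k where "j = r n" and "k = r (Suc n)"
  have "j \<noteq> k" unfolding j_def k_def using strict_monoD[OF r, of n "Suc n"] by simp
  have pw: "ennreal 1 * indicator (ball (z j) 1) x \<le>
     ennreal (2 powr s) * (ennreal (\<bar>u j x - v x\<bar> powr s) + ennreal (\<bar>u k x - v x\<bar> powr s))" for x
  proof (cases "x \<in> ball (z j) 1")
    case True
    have "u j x = 1" unfolding u_def using True by (intro cutoff_eq_1) (simp add: dist_norm norm_minus_commute)
    moreover have "u k x = 0"
    proof -
      have "norm (x - z k) \<ge> 2"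
        using True far[OF \<open>j \<noteq> k\<close>] norm_triangle_ineq[of "z j - x" "x - z k"] by (simp add: dist_norm)
      then show ?thesis unfolding u_def using C1_suppD(4)[OF cutoff_C1] by blast
    qed
    ultimately have "\<bar>u j x - v x\<bar> \<ge> 1 / 2 \<or> \<bar>u k x - v x\<bar> \<ge> 1 / 2" by linarith
    then have "(1 / 2) powr s \<le> \<bar>u j x - v x\<bar> powr s + \<bar>u k x - v x\<bar> powr s"
    proof
      assume "\<bar>u j x - v x\<bar> \<ge> 1 / 2"
      then have "(1 / 2) powr s \<le> \<bar>u j x - v x\<bar> powr s" using s by (intro powr_mono2) auto
      then show ?thesis by (simp add: add_increasing2)
    next
      assume "\<bar>u k x - v x\<bar> \<ge> 1 / 2"
      then have "(1 / 2) powr s \<le> \<bar>u k x - v x\<bar> powr s" using s by (intro powr_mono2) auto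
      then show ?thesis by (simp add: add_increasing)
    qed
    then have "2 powr s * (1 / 2) powr s \<le> 2 powr s * (\<bar>u j x - v x\<bar> powr s + \<bar>u k x - v x\<bar> powr s)"
      by (rule mult_left_mono) simp
    then have "1 \<le> 2 powr s * (\<bar>u j x - v x\<bar> powr s + \<bar>u k x - v x\<bar> powr s)"
      by (simp add: powr_divide)
    then have "ennreal 1 \<le> ennreal (2 powr s * (\<bar>u j x - v x\<bar> powr s + \<bar>u k x - v x\<bar> powr s))"
      by (rule ennreal_leI)
    then show ?thesis using True by (simp add: ennreal_mult)
  qed simp
  have "ennreal \<omega> = emeasure lebesgue (ball (z j) 1)"
    using emeasure_lborel_ball_finite[of "z j" 1]
    by (simp add: \<omega>_def content_ball emeasure_eq_ennreal_measure less_top)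
  also have "\<dots> = (\<integral>\<^sup>+x. ennreal 1 * indicator (ball (z j) 1) x \<partial>lebesgue)"
    by (subst nn_integral_cmult_indicator) auto
  also have "\<dots> \<le> (\<integral>\<^sup>+x. ennreal (2 powr s) * (ennreal (\<bar>u j x - v x\<bar> powr s) + ennreal (\<bar>u k x - v x\<bar> powr s)) \<partial>lebesgue)"
    by (intro nn_integral_mono pw)
  also have "\<dots> = ennreal (2 powr s) * (I j + I k)"
  proof -
    have [measurable]: "u i \<in> borel_measurable lebesgue" for i by (rule measurable_completion) simp
    note [measurable] = v
    show ?thesis unfolding I_def by (simp add: nn_integral_cmult nn_integral_add)
  qed
  also have "\<dots> \<le> ennreal (2 powr s) * (ennreal \<eta> + ennreal \<eta>)"
    unfolding j_def k_def by (intro mult_left_mono add_mono I) auto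
  also have "\<dots> = ennreal (2 powr s * (\<eta> + \<eta>))"
  proof -
    have "ennreal \<eta> + ennreal \<eta> = ennreal (\<eta> + \<eta>)" using \<eta> by (intro ennreal_plus[symmetric]) auto
    moreover have "ennreal (2 powr s) * ennreal (\<eta> + \<eta>) = ennreal (2 powr s * (\<eta> + \<eta>))"
      using \<eta> by (intro ennreal_mult[symmetric]) auto
    ultimately show ?thesis by (simp only:)
  qed
  also have "2 powr s * (\<eta> + \<eta>) = \<omega> / 2" by (simp add: \<eta>_def)
  finally have "\<omega> \<le> \<omega> / 2" using \<omega> by (subst (asm) ennreal_le_iff) auto
  with \<omega> show False by simp
qed

section \<open>Characterisation of the embeddings\<close>

theorem theorem2p9:
  fixes p q b :: real
  assumes "CARD('n::finite) \<ge> 2"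
    and "1 < p"
    and "CARD('n) \<ge> 3 \<Longrightarrow> p < two_star CARD('n)"
    and "1 \<le> q"
    and "p * q > 2"
    and "1 < b"
    and "b < b_star CARD('n) p q"
  shows "(\<forall>s::ennreal. 1 \<le> s \<longrightarrow>
            (continuously_embedded (E_space p q b :: ((real ^ 'n) \<Rightarrow> real) set) (E_norm p q b) s
              \<longleftrightarrow> CARD('n) \<ge> 3 \<and> s = ennreal (two_star CARD('n))))
       \<and> (CARD('n) \<ge> 3 \<longrightarrow>
            \<not> compactly_embedded (E_space p q b :: ((real ^ 'n) \<Rightarrow> real) set) (E_norm p q b)
                (ennreal (two_star CARD('n))))"
proof (intro conjI allI impI iffI)
  have D: "DIM(real ^ 'n) = CARD('n)" by simp
  have pos: "p > 0" "q > 0" "p * q > 1" using assms by auto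
  have star: "two_star CARD('n) > 0" if "CARD('n) \<ge> 3" using that by (simp add: two_star_def)
  fix s :: ennreal assume s: "1 \<le> s"
  {
    assume "continuously_embedded (E_space p q b :: ((real ^ 'n) \<Rightarrow> real) set) (E_norm p q b) s"
    from embedding_only_two_star[OF this s pos(1,2) \<open>1 < b\<close> pos(3)] assms(1)
    show "CARD('n) \<ge> 3" "s = ennreal (two_star CARD('n))" by (simp_all add: D)
  next
    assume N: "CARD('n) \<ge> 3 \<and> s = ennreal (two_star CARD('n))"
    have "b < 1 + real CARD('n) * q"
    proof -
      have "real CARD('n) * q * (1 - p / two_star CARD('n)) \<le> real CARD('n) * q * 1"
        using N star pos by (intro mult_left_mono) auto
      moreover have "b < 1 + real CARD('n) * q * (1 - p / two_star CARD('n))"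
        using assms(7) N by (simp add: b_star_def)
      ultimately show ?thesis by linarith
    qed
    with continuously_embedded_two_star[where 'a = "real ^ 'n", OF _ pos(1,2) \<open>1 < b\<close>] N
    show "continuously_embedded (E_space p q b :: ((real ^ 'n) \<Rightarrow> real) set) (E_norm p q b) s"
      by (simp add: D)
  }
next
  assume N: "CARD('n) \<ge> 3"
  then have "two_star CARD('n) > 0" by (simp add: two_star_def)
  then show "\<not> compactly_embedded (E_space p q b :: ((real ^ 'n) \<Rightarrow> real) set) (E_norm p q b)
                (ennreal (two_star CARD('n)))"
    by (rule not_compactly_embedded_finite) (use assms in auto)
qed

end
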